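(* Let $\alpha,\beta>0$, let $\gamma=\inf\{\mathscr G_{\alpha,\beta}[T]:T\in\mathscr F,\ \mathscr G_{\alpha,\beta}[T]>1-\alpha\}$, and let $q'\ge\lfloor\gamma/(\alpha\wedge\beta)\rfloor>1$ be such that $q'/|\mathscr N^T|>1$ for all $T\in\mathscr F^{\gamma,\alpha,\beta}$. Let $(\mathbf p,\mathbf q)$ be the dual integrability functional on $\mathscr F^{\gamma,\alpha,\beta}$ with $q[T]_h=q'/|h|$ for $h\in H^T$. Let $\mu$ be a probability measure on $C^1([0,1];\mathbb R^d)$ with finite moment of order $q'$ (for the norm $\|x\|_1=|x_0|+\sup_s|x'_s|$), and let $\Omega=\operatorname{supp}(\mu)$ with its Borel $\sigma$-algebra. For $s,t\in[0,1]$ let $\mathcal J_{s,t}^{\gamma,\alpha,\beta}[\mu]$ be the family $\big((x,y_{H^T})\mapsto\mathcal J^T_{s,t}(x)(y_{H^T})\big)_{T\in\mathscr F_0^{\gamma,\alpha,\beta}}$, where the functions $\mathcal J^T_{s,t}:\Omega\times\Omega^{\times|H^T|}\to(\mathbb R^d)^{\otimes|\mathscr N^T|}$ are determined inductively by $\mathcal J^{\mathbf 1}_{s,t}=1$ and $$\mathcal J_{s,t}^{\lfloor\mathbf 1\rfloor}(x)=x_{s,t}=x_t-x_s,\qquad \mathcal J_{s,t}^{T_1\circledast T_2}(x)(y_{H^{T_1}},y_{H^{T_2}})=\mathcal J_{s,t}^{T_1}(x)(y_{H^{T_1}})\otimes\mathcal J_{s,t}^{T_2}(x)(y_{H^{T_2}}),$$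 $$\mathcal J_{s,t}^{\mathcal E[T]}(x)(y_{h_0^T},y_{H^T})=\mathcal J_{s,t}^{T}(y_{h_0^T})(y_{H^T})\ \ (h_0^T\ne\emptyset),\qquad \mathcal J_{s,t}^{\lfloor T\rfloor}(x)(y_{H^T})=\int_s^t\mathcal J_{s,r}^{T}(x)(y_{H^T})\otimes dx_r .$$ Then for all $s,t,u\in[0,1]$ the increments $\mathcal J_{s,t}^{\gamma,\alpha,\beta}[\mu]$ are elements of the group $G_{\mathbf q}^{\gamma,\alpha,\beta}(L^0(\Omega,\mu;\mathbb R^e))$ of McKean–Vlasov characters over $(\Omega,\mu)$ and satisfy, for $x\in\operatorname{supp}(\mu)$, $$\mathcal J_{s,t}^{\gamma,\alpha,\beta}[\mu](x)\ast\mathcal J_{t,u}^{\gamma,\alpha,\beta}[\mu](x)=\mathcal J_{s,u}^{\gamma,\alpha,\beta}[\mu](x).$$ As such, the path $t\mapsto\mathcal J^{\gamma,\alpha,\beta}_{0,t}[\mu]$ is a McKean–Vlasov probabilistic rough path over $(\Omega,\mu)$.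
   Context: **Lions forests.** A directed forest $(\mathscr N,\mathscr E)$ is a finite node set $\mathscr N$ with $\mathscr E\subseteq\mathscr N\times\mathscr N$ such that every connected component is a tree with all edges pointing towards a single root. The depth of a node is the number of nodes on its unique path to a root; write $x\le y$ if $\mathrm{depth}(x)\le\mathrm{depth}(y)$ and $x<y$ if the inequality is strict. A Lions forest is $T=(\mathscr N,\mathscr E,h_0,H)$ where $\mathscr N\neq\emptyset$, $(\mathscr N,\mathscr E)$ is a directed forest, $h_0\subseteq\mathscr N$ (possibly empty), $H$ is a partition of $\mathscr N\setminus h_0$ and, with $H'=(H\cup\{h_0\})\setminus\{\emptyset\}$: (i) if $h_0\ne\emptyset$ there is $x\in h_0$ with $x\le y$ for all $y\in\mathscr N$; (ii) if $h\in H'$, $x,y\in h$ and $x<y$, there is $z\in h$ with $(y,z)\in\mathscr E$; (iii) if $h\in H'$, $x_1,y_1\in h$ have equal depth, $(x_1,x_2),(y_1,y_2)\in\mathscr E$ and $x_2\ne y_2$, then $x_2,y_2\in h$. $\mathscr F$ is the set of Lions forests, $\mathbf 1$ the empty forest, $\mathscr F_0=\mathscr F\cup\{\mathbf 1\}$. Components of $T$ are written $\mathscr N^T,\mathscr E^T,h_0^T,H^T$. Lions forests are considered up to isomorphism; all families indexed by Lions forests are understood to be compatible with isomorphisms (relabelling of nodes and hyperedges). **Operations and truncation.** $T_1\circledast T_2=(\mathscr N^{T_1}\sqcup\mathscr N^{T_2},\mathscr E^{T_1}\sqcup\mathscr E^{T_2},h_0^{T_1}\sqcup h_0^{T_2},H^{T_1}\sqcup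 H^{T_2})$. Decoupling: $\mathcal E[T]=(\mathscr N^T,\mathscr E^T,\emptyset,(H^T\cup\{h_0^T\})\setminus\{\emptyset\})$. Rooting: $\lfloor T\rfloor$ is obtained by adding one new node $x_0$, edges from every root of $T$ to $x_0$, and replacing $h_0^T$ by $h_0^T\cup\{x_0\}$; $\lfloor\mathbf 1\rfloor$ is the single tagged node. Every Lions forest is obtained from $\mathbf 1$ by these three operations. Put $\mathscr G_{\alpha,\beta}[T]=\alpha|h_0^T|+\beta|\mathscr N^T\setminus h_0^T|$, $\mathscr F^{\gamma,\alpha,\beta}=\{T\in\mathscr F:\mathscr G_{\alpha,\beta}[T]\le\gamma\}$, $\mathscr F_0^{\gamma,\alpha,\beta}=\mathscr F^{\gamma,\alpha,\beta}\cup\{\mathbf 1\}$. **Cuts.** $R\subseteq\mathscr N^T$ is ancestor-closed if $y\in R$ and $(y,z)\in\mathscr E^T$ imply $z\in R$. For $A\subseteq\mathscr N^T$ let $T|_A=(A,\mathscr E^T\cap(A\times A),h_0^T\cap A,\{h\cap A:h\in H^T\}\setminus\{\emptyset\})$; for $R$ ancestor-closed, $T|_R$ and $T|_{\mathscr N^T\setminus R}$ are in $\mathscr F_0$. **Dual integrability functional.** A pair of families $\mathbf p=(p[T])$, $\mathbf q=(q[T])$ indexed by $T\in\mathscr F^{\gamma,\alpha,\beta}$, with $p[T],q[T]\in(1,\infty)^{H^T}$, such that: $1/p[T]_h+1/q[T]_h=1$; $p[T_1\circledast T_2]=(p[T_1],p[T_2])$ and likewise for $q$ whenever $T_1\circledast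 T_2\in\mathscr F^{\gamma,\alpha,\beta}$; and for every $T$, ancestor-closed $R$, $h\in H^T$, with $\Upsilon=T|_{\mathscr N^T\setminus R}$, $Y=T|_R$, one has $1/q[T]_h\ge 1/q[\Upsilon]_{h\cap\mathscr N^\Upsilon}+1/q[Y]_{h\cap\mathscr N^Y}$, where a term is omitted if the corresponding intersection is empty. **McKean–Vlasov characters over $(\Omega,\mu)$.** $G_{\mathbf q}^{\gamma,\alpha,\beta}(L^0(\Omega,\mu;\mathbb R^e))$ ($e$ plays no role) is the set of families $f=(\langle f,T\rangle)_{T\in\mathscr F_0^{\gamma,\alpha,\beta}}$ of (a.e. classes of) measurable functions $\langle f,T\rangle:\Omega\times\Omega^{\times|H^T|}\to(\mathbb R^d)^{\otimes|\mathscr N^T|}$ (tensor factors indexed by nodes; in the product and rooting formulas factors are placed at the corresponding nodes), written $\langle f,T\rangle(\omega_0,\omega_{H^T})$, $\omega_{H^T}=(\omega_h)_{h\in H^T}$, such that: $\langle f,T\rangle(\omega_0,\cdot)$ lies for a.e. $\omega_0$ in the mixed-norm space $L^{q[T]}(\Omega^{\times|H^T|},\mu^{\times|H^T|})$ with exponent $q[T]_h$ in $\omega_h$ (no order of integration privileged); $\langle f,\mathbf 1\rangle=1$; $\langle f,T_1\circledast T_2\rangle(\omega_0,\omega_{H^{T_1}},\omega_{H^{T_2}})=\langle f,T_1\rangle(\omega_0,\omega_{H^{T_1}})\otimes\langle f,T_2\rangle(\omega_0,\omega_{H^{T_2}})$ a.s. whenever $T_1\circledast T_2\in\mathscr F^{\gamma,\alpha,\beta}$;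 for $T$ with $h_0^T\ne\emptyset$ and $T,\mathcal E[T]\in\mathscr F^{\gamma,\alpha,\beta}$, $\langle f,T\rangle(\omega_{h_0^T},\omega_{H^T})=\langle f,\mathcal E[T]\rangle(\omega_0,\omega_{h_0^T},\omega_{H^T})$ a.s.; and for $h_0^T=\emptyset$, $\langle f,T\rangle$ does not depend on $\omega_0$ a.s. With the convolution $$\langle f\ast g,T\rangle(\omega_0,\omega_{H^T})=\sum_{R\subseteq\mathscr N^T\text{ ancestor-closed}}\langle f,T|_{\mathscr N^T\setminus R}\rangle\otimes^{H^T}\langle g,T|_R\rangle(\omega_0,\omega_{H^T}),$$ where $\otimes^{H^T}$ means that in each factor the variable attached to the hyperedge $h\cap(\mathscr N^T\setminus R)$ (resp. $h\cap R$), $h\in H^T$, is set equal to $\omega_h$ and both factors share $\omega_0$, this set is a group with unit $\epsilon$ ($\langle\epsilon,\mathbf 1\rangle=1$, $\langle\epsilon,T\rangle=0$ otherwise). **McKean–Vlasov probabilistic rough path.** With $\gamma$ as in the claim, a path $\mathbf W:[0,1]\to G_{\mathbf q}^{\gamma,\alpha,\beta}$ such that, setting $\mathbf W_{s,t}=(\mathbf W_s)^{-1}\ast\mathbf W_t$, one has $\mathbf W_{s,t}\ast\mathbf W_{t,u}=\mathbf W_{s,u}$ a.s. for all $s,t,u\in[0,1]$, and for all $T\in\mathscr F^{\gamma,\alpha,\beta}$, for a.e. $\omega_0$, $$\sup_{s,t\in[0,1]}\frac{\int|\langle\mathbf W_{s,t},T\rangle(\omega_0,\omega_{H^T})|\,d\mu^{\times|H^T|}(\omega_{H^T})}{|t-s|^{\mathscr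 G_{\alpha,\beta}[T]}}<\infty .$$ *)

theory Defs
  imports "HOL-Probability.Probability" "HOL-Library.Disjoint_Sets"
begin

section \<open>Lions forests\<close>

text \<open>
  Nodes are natural numbers; every Lions forest is isomorphic to one of these.  The paper's
  convention that forests are considered up to isomorphism becomes, for each family indexed by
  forests, an explicit compatibility condition with \<open>relabel\<close>.
\<close>

datatype forest =
  Forest (nodes: "nat set") (edges: "(nat \<times> nat) set") (tagged: "nat set") (hyper: "nat set set")

definition walk :: "(nat \<times> nat) set \<Rightarrow> nat \<Rightarrow> nat \<Rightarrow> nat list \<Rightarrow> bool" where
  "walk E x y ns \<longleftrightarrow> ns \<noteq> [] \<and> hd ns = x \<and> last ns = y \<and> successively (\<lambda>a b. (a, b) \<in> E) ns"

text \<open>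
  A component is a tree with all edges pointing towards a root iff it contains a node that every node
  of the component reaches by exactly one directed walk (walks may repeat nodes, so this excludes
  cycles; the unique walk from the root to itself is the trivial one).
\<close>

definition directed_forest :: "nat set \<Rightarrow> (nat \<times> nat) set \<Rightarrow> bool" where
  "directed_forest N E \<longleftrightarrow> finite N \<and> E \<subseteq> N \<times> N \<and>
     (\<forall>C \<in> N // (E \<union> E\<inverse>)\<^sup>*. \<exists>r\<in>C. \<forall>x\<in>C. \<exists>!ns. walk E x r ns)"

definition is_root :: "nat set \<Rightarrow> (nat \<times> nat) set \<Rightarrow> nat \<Rightarrow> bool" where
  "is_root N E r \<longleftrightarrow> r \<in> N \<and> (\<forall>z. (r, z) \<notin> E)"

definition depth :: "forest \<Rightarrow> nat \<Rightarrow> nat" where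
  "depth T x = length (THE ns. \<exists>r. is_root (nodes T) (edges T) r \<and> walk (edges T) x r ns)"

definition hyper' :: "forest \<Rightarrow> nat set set" where
  "hyper' T = (hyper T \<union> {tagged T}) - {{}}"

definition lions_forest :: "forest \<Rightarrow> bool" where
  "lions_forest T \<longleftrightarrow>
     nodes T \<noteq> {} \<and> directed_forest (nodes T) (edges T) \<and> tagged T \<subseteq> nodes T \<and>
     partition_on (nodes T - tagged T) (hyper T) \<and>
     (tagged T \<noteq> {} \<longrightarrow> (\<exists>x\<in>tagged T. \<forall>y\<in>nodes T. depth T x \<le> depth T y)) \<and>
     (\<forall>h\<in>hyper' T. \<forall>x\<in>h. \<forall>y\<in>h. depth T x < depth T y \<longrightarrow> (\<exists>z\<in>h. (y, z) \<in> edges T)) \<and>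
     (\<forall>h\<in>hyper' T. \<forall>x1\<in>h. \<forall>y1\<in>h. \<forall>x2 y2. depth T x1 = depth T y1 \<and> (x1, x2) \<in> edges T \<and>
        (y1, y2) \<in> edges T \<and> x2 \<noteq> y2 \<longrightarrow> x2 \<in> h \<and> y2 \<in> h)"

definition empty_forest :: forest where
  "empty_forest = Forest {} {} {} {}"

text \<open>
  \<open>T\<^sub>1 \<circledast> T\<^sub>2\<close>, to be used for forests with disjoint node sets only; by compatibility with relabelling
  this covers arbitrary pairs of forests.
\<close>

definition join :: "forest \<Rightarrow> forest \<Rightarrow> forest" where
  "join T1 T2 = Forest (nodes T1 \<union> nodes T2) (edges T1 \<union> edges T2)
     (tagged T1 \<union> tagged T2) (hyper T1 \<union> hyper T2)"

definition decouple :: "forest \<Rightarrow> forest" where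
  "decouple T = Forest (nodes T) (edges T) {} (hyper' T)"

text \<open>\<open>\<lfloor>T\<rfloor>\<close>; the new node \<open>n\<close> has to be fresh for \<open>T\<close>.\<close>

definition rooting :: "nat \<Rightarrow> forest \<Rightarrow> forest" where
  "rooting n T = Forest (insert n (nodes T))
     (edges T \<union> {(r, n) |r. is_root (nodes T) (edges T) r}) (insert n (tagged T)) (hyper T)"

definition relabel :: "(nat \<Rightarrow> nat) \<Rightarrow> forest \<Rightarrow> forest" where
  "relabel \<pi> T = Forest (\<pi> ` nodes T) (map_prod \<pi> \<pi> ` edges T) (\<pi> ` tagged T) ((`) \<pi> ` hyper T)"

definition grade :: "real \<Rightarrow> real \<Rightarrow> forest \<Rightarrow> real" where
  "grade \<alpha> \<beta> T = \<alpha> * real (card (tagged T)) + \<beta> * real (card (nodes T - tagged T))"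

definition forests :: "real \<Rightarrow> real \<Rightarrow> real \<Rightarrow> forest set" where
  "forests \<gamma> \<alpha> \<beta> = {T. lions_forest T \<and> grade \<alpha> \<beta> T \<le> \<gamma>}"

definition forests0 :: "real \<Rightarrow> real \<Rightarrow> real \<Rightarrow> forest set" where
  "forests0 \<gamma> \<alpha> \<beta> = insert empty_forest (forests \<gamma> \<alpha> \<beta>)"

definition ancestor_closed :: "forest \<Rightarrow> nat set \<Rightarrow> bool" where
  "ancestor_closed T R \<longleftrightarrow> R \<subseteq> nodes T \<and> (\<forall>y z. y \<in> R \<and> (y, z) \<in> edges T \<longrightarrow> z \<in> R)"

definition subforest :: "forest \<Rightarrow> nat set \<Rightarrow> forest" where
  "subforest T A = Forest A (edges T \<inter> A \<times> A) (tagged T \<inter> A) ((\<lambda>h. h \<inter> A) ` hyper T - {{}})"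

definition dual_integrability_functional ::
  "real \<Rightarrow> real \<Rightarrow> real \<Rightarrow> (forest \<Rightarrow> nat set \<Rightarrow> real) \<Rightarrow> (forest \<Rightarrow> nat set \<Rightarrow> real) \<Rightarrow> bool" where
  "dual_integrability_functional \<gamma> \<alpha> \<beta> p q \<longleftrightarrow>
     (\<forall>T\<in>forests \<gamma> \<alpha> \<beta>. \<forall>h\<in>hyper T. p T h > 1 \<and> q T h > 1 \<and> 1 / p T h + 1 / q T h = 1) \<and>
     (\<forall>T\<in>forests \<gamma> \<alpha> \<beta>. \<forall>\<pi>. inj_on \<pi> (nodes T) \<longrightarrow>
        (\<forall>h\<in>hyper T. p (relabel \<pi> T) (\<pi> ` h) = p T h \<and> q (relabel \<pi> T) (\<pi> ` h) = q T h)) \<and>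
     (\<forall>T1 T2. lions_forest T1 \<and> lions_forest T2 \<and> nodes T1 \<inter> nodes T2 = {} \<and>
        join T1 T2 \<in> forests \<gamma> \<alpha> \<beta> \<longrightarrow>
        (\<forall>h\<in>hyper T1. p (join T1 T2) h = p T1 h \<and> q (join T1 T2) h = q T1 h) \<and>
        (\<forall>h\<in>hyper T2. p (join T1 T2) h = p T2 h \<and> q (join T1 T2) h = q T2 h)) \<and>
     (\<forall>T\<in>forests \<gamma> \<alpha> \<beta>. \<forall>R. ancestor_closed T R \<longrightarrow> (\<forall>h\<in>hyper T.
        1 / q T h \<ge>
          (if h \<inter> (nodes T - R) = {} then 0
           else 1 / q (subforest T (nodes T - R)) (h \<inter> (nodes T - R))) +
          (if h \<inter> R = {} then 0 else 1 / q (subforest T R) (h \<inter> R))))"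

section \<open>Tensors and McKean--Vlasov characters\<close>

text \<open>
  An element of \<open>(\<real>\<^sup>d)\<^sup>\<otimes>\<^sup>N\<close>, with tensor factors indexed by the finite node set \<open>N\<close>, is given by its
  coordinates with respect to the standard basis, i.e. by its values at the multi-indices
  \<open>i \<in> N \<rightarrow>\<^sub>E UNIV\<close>, where \<open>real ^ 'd\<close> plays the role of \<open>\<real>\<^sup>d\<close>; other values are irrelevant.
  Hence the coordinate at \<open>i\<close> of the tensor product of \<open>v\<close> over \<open>N\<^sub>1\<close> and \<open>w\<close> over \<open>N\<^sub>2\<close> (disjoint) is
  \<open>v (restrict i N\<^sub>1) * w (restrict i N\<^sub>2)\<close>, each factor being placed at its own nodes.
\<close>

type_synonym 'd tensor = "(nat \<Rightarrow> 'd) \<Rightarrow> real"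

abbreviation multi_index :: "forest \<Rightarrow> (nat \<Rightarrow> 'd) set" where
  "multi_index T \<equiv> (nodes T \<rightarrow>\<^sub>E UNIV)"

definition tensor_norm :: "nat set \<Rightarrow> 'd::finite tensor \<Rightarrow> real" where
  "tensor_norm N v = L2_set v (N \<rightarrow>\<^sub>E UNIV)"

text \<open>
  A family \<open>f\<close> is evaluated as \<open>f T \<omega>\<^sub>0 \<omega>\<close> with \<open>\<omega> \<in> hyper T \<rightarrow>\<^sub>E space M\<close>, the underlying set of the
  product \<open>Pi\<^sub>M (hyper T) (\<lambda>_. M)\<close>.
\<close>

type_synonym ('w, 'd) family = "forest \<Rightarrow> 'w \<Rightarrow> (nat set \<Rightarrow> 'w) \<Rightarrow> 'd tensor"

abbreviation hyper_measure :: "'w measure \<Rightarrow> forest \<Rightarrow> (nat set \<Rightarrow> 'w) measure" where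
  "hyper_measure M T \<equiv> Pi\<^sub>M (hyper T) (\<lambda>_. M)"

definition ennpowr :: "ennreal \<Rightarrow> real \<Rightarrow> ennreal" where
  "ennpowr x a = (if x = \<top> then \<top> else ennreal (enn2real x powr a))"

text \<open>Mixed norm with iterated integration in the order of the list, its head being outermost.\<close>

primrec mixed_norm ::
  "'w measure \<Rightarrow> ('h \<Rightarrow> real) \<Rightarrow> 'h list \<Rightarrow> (('h \<Rightarrow> 'w) \<Rightarrow> ennreal) \<Rightarrow> ('h \<Rightarrow> 'w) \<Rightarrow> ennreal" where
  "mixed_norm M q [] F \<omega> = F \<omega>"
| "mixed_norm M q (h # hs) F \<omega> =
     ennpowr (\<integral>\<^sup>+ w. ennpowr (mixed_norm M q hs F (fun_upd \<omega> h w)) (q h) \<partial>M) (1 / q h)"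

text \<open>No order of integration is privileged: the mixed norm has to be finite for every order.\<close>

definition in_mixed_space ::
  "'w measure \<Rightarrow> ('h \<Rightarrow> real) \<Rightarrow> 'h set \<Rightarrow> (('h \<Rightarrow> 'w) \<Rightarrow> ennreal) \<Rightarrow> bool" where
  "in_mixed_space M q H F \<longleftrightarrow>
     F \<in> borel_measurable (Pi\<^sub>M H (\<lambda>_. M)) \<and>
     (\<forall>hs. distinct hs \<and> set hs = H \<longrightarrow> mixed_norm M q hs F (\<lambda>_. undefined) < \<infinity>)"

text \<open>
  Elements of the group are represented by measurable functions; a.e. equality of representatives is
  \<open>family_ae_eq\<close>.  The conditions are, in this order: measurability and integrability,
  \<open>\<langle>f, \<one>\<rangle> = 1\<close>, compatibility with isomorphisms, multiplicativity, the decoupling identity, and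
  independence of \<open>\<omega>\<^sub>0\<close> for \<open>h\<^sub>0 = \<emptyset>\<close>.
\<close>

definition mv_characters ::
  "real \<Rightarrow> real \<Rightarrow> real \<Rightarrow> (forest \<Rightarrow> nat set \<Rightarrow> real) \<Rightarrow> 'w measure \<Rightarrow> ('w, 'd::finite) family set" where
  "mv_characters \<gamma> \<alpha> \<beta> q M = {f.
     (\<forall>T\<in>forests0 \<gamma> \<alpha> \<beta>.
        (\<forall>i\<in>multi_index T. (\<lambda>(\<omega>0, \<omega>). f T \<omega>0 \<omega> i) \<in> borel_measurable (M \<Otimes>\<^sub>M hyper_measure M T)) \<and>
        (AE \<omega>0 in M. in_mixed_space M (q T) (hyper T) (\<lambda>\<omega>. ennreal (tensor_norm (nodes T) (f T \<omega>0 \<omega>))))) \<and>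
     (\<forall>\<omega>0\<in>space M. \<forall>\<omega>\<in>space (hyper_measure M empty_forest). \<forall>i\<in>multi_index empty_forest.
        f empty_forest \<omega>0 \<omega> i = 1) \<and>
     (\<forall>T\<in>forests \<gamma> \<alpha> \<beta>. \<forall>\<pi>. inj_on \<pi> (nodes T) \<longrightarrow>
        (AE (\<omega>0, \<omega>) in M \<Otimes>\<^sub>M hyper_measure M (relabel \<pi> T). \<forall>i\<in>multi_index (relabel \<pi> T).
           f (relabel \<pi> T) \<omega>0 \<omega> i = f T \<omega>0 (\<lambda>h\<in>hyper T. \<omega> (\<pi> ` h)) (\<lambda>n\<in>nodes T. i (\<pi> n)))) \<and>
     (\<forall>T1 T2. lions_forest T1 \<and> lions_forest T2 \<and> nodes T1 \<inter> nodes T2 = {} \<and>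
        join T1 T2 \<in> forests \<gamma> \<alpha> \<beta> \<longrightarrow>
        (AE (\<omega>0, \<omega>) in M \<Otimes>\<^sub>M hyper_measure M (join T1 T2). \<forall>i\<in>multi_index (join T1 T2).
           f (join T1 T2) \<omega>0 \<omega> i =
             f T1 \<omega>0 (restrict \<omega> (hyper T1)) (restrict i (nodes T1)) *
             f T2 \<omega>0 (restrict \<omega> (hyper T2)) (restrict i (nodes T2)))) \<and>
     (\<forall>T. tagged T \<noteq> {} \<and> T \<in> forests \<gamma> \<alpha> \<beta> \<and> decouple T \<in> forests \<gamma> \<alpha> \<beta> \<longrightarrow>
        (AE (\<omega>0, \<omega>) in M \<Otimes>\<^sub>M hyper_measure M (decouple T). \<forall>i\<in>multi_index T.
           f T (\<omega> (tagged T)) (restrict \<omega> (hyper T)) i = f (decouple T) \<omega>0 \<omega> i)) \<and>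
     (\<forall>T\<in>forests \<gamma> \<alpha> \<beta>. tagged T = {} \<longrightarrow>
        (AE ((\<omega>0, \<omega>0'), \<omega>) in (M \<Otimes>\<^sub>M M) \<Otimes>\<^sub>M hyper_measure M T. \<forall>i\<in>multi_index T.
           f T \<omega>0 \<omega> i = f T \<omega>0' \<omega> i))}"

text \<open>The variable of a hyperedge \<open>h \<inter> A\<close> of the subforest is the one of the hyperedge \<open>h\<close> of \<open>T\<close>.\<close>

definition coupled :: "forest \<Rightarrow> nat set \<Rightarrow> (nat set \<Rightarrow> 'w) \<Rightarrow> nat set \<Rightarrow> 'w" where
  "coupled T A \<omega> = (\<lambda>k\<in>hyper (subforest T A). \<omega> (THE h. h \<in> hyper T \<and> h \<inter> A = k))"

definition mv_conv :: "('w, 'd) family \<Rightarrow> ('w, 'd) family \<Rightarrow> ('w, 'd) family" where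
  "mv_conv f g T \<omega>0 \<omega> i =
     (\<Sum>R | ancestor_closed T R.
        f (subforest T (nodes T - R)) \<omega>0 (coupled T (nodes T - R) \<omega>) (restrict i (nodes T - R)) *
        g (subforest T R) \<omega>0 (coupled T R \<omega>) (restrict i R))"

definition mv_unit :: "('w, 'd) family" where
  "mv_unit T \<omega>0 \<omega> i = (if T = empty_forest then 1 else 0)"

definition family_eq ::
  "real \<Rightarrow> real \<Rightarrow> real \<Rightarrow> 'w measure \<Rightarrow> ('w, 'd) family \<Rightarrow> ('w, 'd) family \<Rightarrow> bool" where
  "family_eq \<gamma> \<alpha> \<beta> M f g \<longleftrightarrow> (\<forall>T\<in>forests0 \<gamma> \<alpha> \<beta>. \<forall>\<omega>0\<in>space M. \<forall>\<omega>\<in>space (hyper_measure M T).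
     \<forall>i\<in>multi_index T. f T \<omega>0 \<omega> i = g T \<omega>0 \<omega> i)"

definition family_ae_eq ::
  "real \<Rightarrow> real \<Rightarrow> real \<Rightarrow> 'w measure \<Rightarrow> ('w, 'd) family \<Rightarrow> ('w, 'd) family \<Rightarrow> bool" where
  "family_ae_eq \<gamma> \<alpha> \<beta> M f g \<longleftrightarrow> (\<forall>T\<in>forests0 \<gamma> \<alpha> \<beta>. AE (\<omega>0, \<omega>) in M \<Otimes>\<^sub>M hyper_measure M T.
     \<forall>i\<in>multi_index T. f T \<omega>0 \<omega> i = g T \<omega>0 \<omega> i)"

text \<open>
  The convolution acts pointwise in \<open>(\<omega>\<^sub>0, \<omega>)\<close>, and a family with \<open>\<langle>f, \<one>\<rangle> = 1\<close> has exactly one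
  pointwise convolution inverse.  This is the representative of the group inverse used here.  Fixing
  one matters: the supremum over the uncountably many \<open>s, t\<close> in \<open>mv_rough_path\<close> is not invariant
  under changing each increment on a null set.
\<close>

definition mv_inverse ::
  "real \<Rightarrow> real \<Rightarrow> real \<Rightarrow> (forest \<Rightarrow> nat set \<Rightarrow> real) \<Rightarrow> 'w measure \<Rightarrow>
   ('w, 'd::finite) family \<Rightarrow> ('w, 'd) family" where
  "mv_inverse \<gamma> \<alpha> \<beta> q M f = (SOME g. g \<in> mv_characters \<gamma> \<alpha> \<beta> q M \<and>
     family_eq \<gamma> \<alpha> \<beta> M (mv_conv f g) mv_unit \<and> family_eq \<gamma> \<alpha> \<beta> M (mv_conv g f) mv_unit)"

definition mv_increment ::
  "real \<Rightarrow> real \<Rightarrow> real \<Rightarrow> (forest \<Rightarrow> nat set \<Rightarrow> real) \<Rightarrow> 'w measure \<Rightarrow>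
   (real \<Rightarrow> ('w, 'd::finite) family) \<Rightarrow> real \<Rightarrow> real \<Rightarrow> ('w, 'd) family" where
  "mv_increment \<gamma> \<alpha> \<beta> q M W s t = mv_conv (mv_inverse \<gamma> \<alpha> \<beta> q M (W s)) (W t)"

text \<open>In the supremum, \<open>s = t\<close> contributes \<open>0 / 0 = 0\<close> since the increment is then the unit.\<close>

definition mv_rough_path ::
  "real \<Rightarrow> real \<Rightarrow> real \<Rightarrow> (forest \<Rightarrow> nat set \<Rightarrow> real) \<Rightarrow> 'w measure \<Rightarrow>
   (real \<Rightarrow> ('w, 'd::finite) family) \<Rightarrow> bool" where
  "mv_rough_path \<gamma> \<alpha> \<beta> q M W \<longleftrightarrow>
     (\<forall>t\<in>{0..1}. W t \<in> mv_characters \<gamma> \<alpha> \<beta> q M) \<and>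
     (\<forall>s\<in>{0..1}. \<forall>t\<in>{0..1}. \<forall>u\<in>{0..1}.
        family_ae_eq \<gamma> \<alpha> \<beta> M
          (mv_conv (mv_increment \<gamma> \<alpha> \<beta> q M W s t) (mv_increment \<gamma> \<alpha> \<beta> q M W t u))
          (mv_increment \<gamma> \<alpha> \<beta> q M W s u)) \<and>
     (\<forall>T\<in>forests \<gamma> \<alpha> \<beta>. AE \<omega>0 in M.
        (SUP s\<in>{0..1}. SUP t\<in>{0..1}.
           (\<integral>\<^sup>+ \<omega>. ennreal (tensor_norm (nodes T) (mv_increment \<gamma> \<alpha> \<beta> q M W s t T \<omega>0 \<omega>))
              \<partial>hyper_measure M T) /
           ennreal (\<bar>t - s\<bar> powr grade \<alpha> \<beta> T)) < \<infinity>)"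

section \<open>The space of continuously differentiable paths\<close>

text \<open>\<open>C\<^sup>1([0,1]; \<real>\<^sup>d)\<close>; paths are extended by zero outside \<open>[0,1]\<close> to make the representation unique.\<close>

typedef ('d::finite) c1_path =
  "{x :: real \<Rightarrow> real ^ 'd.
      (\<exists>x'. continuous_on {0..1} x' \<and>
            (\<forall>t\<in>{0..1}. (x has_vector_derivative x' t) (at t within {0..1}))) \<and>
      (\<forall>t. t \<notin> {0..1} \<longrightarrow> x t = 0)}"
  morphisms c1_fun Abs_c1_path
  by (rule exI[of _ "\<lambda>_. 0"]) (auto intro!: exI[of _ "\<lambda>_. 0"])

setup_lifting type_definition_c1_path

definition c1_deriv :: "'d::finite c1_path \<Rightarrow> real \<Rightarrow> real ^ 'd" where
  "c1_deriv x t = vector_derivative (c1_fun x) (at t within {0..1})"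

lemma c1_deriv_unique:
  assumes "(c1_fun x has_vector_derivative v) (at t within {0..1})" "t \<in> {0..1}"
  shows "c1_deriv x t = v"
  unfolding c1_deriv_def
  using vector_derivative_within_cbox[of 0 1 t "c1_fun x" v] assms by simp

lemma c1_fun_has_deriv:
  assumes "t \<in> {0..1}"
  shows "(c1_fun x has_vector_derivative c1_deriv x t) (at t within {0..1})"
proof -
  obtain x' where "\<forall>t\<in>{0..1}. (c1_fun x has_vector_derivative x' t) (at t within {0..1})"
    using c1_fun[of x] by auto
  then show ?thesis using c1_deriv_unique assms by metis
qed

lemma continuous_on_c1_deriv: "continuous_on {0..1} (c1_deriv x)"
proof -
  obtain x' where x': "continuous_on {0..1} x'"
    "\<forall>t\<in>{0..1}. (c1_fun x has_vector_derivative x' t) (at t within {0..1})"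
    using c1_fun[of x] by auto
  then have "\<And>t. t \<in> {0..1} \<Longrightarrow> c1_deriv x t = x' t" using c1_deriv_unique by metis
  then show ?thesis using x'(1) continuous_on_cong by metis
qed

lemma c1_fun_outside: "t \<notin> {0..1} \<Longrightarrow> c1_fun x t = 0"
  using c1_fun[of x] by auto

lemma c1_path_eqI:
  assumes "\<And>t. t \<in> {0..1} \<Longrightarrow> c1_fun x t = c1_fun y t"
  shows "x = y"
  using assms c1_fun_outside[of _ x] c1_fun_outside[of _ y] by (metis c1_fun_inject ext)

lemma bdd_above_c1_deriv: "bdd_above ((\<lambda>s. norm (c1_deriv x s)) ` {0..1})"
  by (intro bounded_imp_bdd_above compact_imp_bounded compact_continuous_image
        continuous_on_norm continuous_on_c1_deriv) simp

instantiation c1_path :: (finite) real_normed_vector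
begin

lift_definition zero_c1_path :: "'a c1_path" is "\<lambda>_. 0"
  by (auto intro!: exI[of _ "\<lambda>_. 0"])

lift_definition plus_c1_path :: "'a c1_path \<Rightarrow> 'a c1_path \<Rightarrow> 'a c1_path" is "\<lambda>x y t. x t + y t"
proof -
  fix x y :: "real \<Rightarrow> real ^ 'a"
  assume "(\<exists>x'. continuous_on {0..1} x' \<and>
    (\<forall>t\<in>{0..1}. (x has_vector_derivative x' t) (at t within {0..1}))) \<and> (\<forall>t. t \<notin> {0..1} \<longrightarrow> x t = 0)"
  then obtain x' where "continuous_on {0..1} x'"
    "\<forall>t\<in>{0..1}. (x has_vector_derivative x' t) (at t within {0..1})" "\<forall>t. t \<notin> {0..1} \<longrightarrow> x t = 0"
    by auto
  moreover assume "(\<exists>x'. continuous_on {0..1} x' \<and>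
    (\<forall>t\<in>{0..1}. (y has_vector_derivative x' t) (at t within {0..1}))) \<and> (\<forall>t. t \<notin> {0..1} \<longrightarrow> y t = 0)"
  then obtain y' where "continuous_on {0..1} y'"
    "\<forall>t\<in>{0..1}. (y has_vector_derivative y' t) (at t within {0..1})" "\<forall>t. t \<notin> {0..1} \<longrightarrow> y t = 0"
    by auto
  ultimately show "(\<exists>x'. continuous_on {0..1} x' \<and>
    (\<forall>t\<in>{0..1}. ((\<lambda>t. x t + y t) has_vector_derivative x' t) (at t within {0..1}))) \<and>
    (\<forall>t. t \<notin> {0..1} \<longrightarrow> x t + y t = 0)"
    by (intro conjI exI[of _ "\<lambda>t. x' t + y' t"] ballI has_vector_derivative_add continuous_on_add) auto
qed

lift_definition scaleR_c1_path :: "real \<Rightarrow> 'a c1_path \<Rightarrow> 'a c1_path" is "\<lambda>c x t. c *\<^sub>R x t"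
proof -
  fix c :: real and x :: "real \<Rightarrow> real ^ 'a"
  assume "(\<exists>x'. continuous_on {0..1} x' \<and>
    (\<forall>t\<in>{0..1}. (x has_vector_derivative x' t) (at t within {0..1}))) \<and> (\<forall>t. t \<notin> {0..1} \<longrightarrow> x t = 0)"
  then obtain x' where x': "continuous_on {0..1} x'"
    "\<forall>t\<in>{0..1}. (x has_vector_derivative x' t) (at t within {0..1})" "\<forall>t. t \<notin> {0..1} \<longrightarrow> x t = 0"
    by auto
  have "((\<lambda>t. c *\<^sub>R x t) has_vector_derivative c *\<^sub>R x' t) (at t within {0..1})" if "t \<in> {0..1}" for t
    using bounded_linear.has_vector_derivative[OF bounded_linear_scaleR_right] x'(2) that by blast
  then show "(\<exists>x'. continuous_on {0..1} x' \<and>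
    (\<forall>t\<in>{0..1}. ((\<lambda>t. c *\<^sub>R x t) has_vector_derivative x' t) (at t within {0..1}))) \<and>
    (\<forall>t. t \<notin> {0..1} \<longrightarrow> c *\<^sub>R x t = 0)"
    using x' by (intro conjI exI[of _ "\<lambda>t. c *\<^sub>R x' t"]) (auto intro!: continuous_intros)
qed

definition uminus_c1_path :: "'a c1_path \<Rightarrow> 'a c1_path" where
  "uminus_c1_path x = (-1) *\<^sub>R x"

definition minus_c1_path :: "'a c1_path \<Rightarrow> 'a c1_path \<Rightarrow> 'a c1_path" where
  "minus_c1_path x y = x + (-1) *\<^sub>R y"

definition norm_c1_path :: "'a c1_path \<Rightarrow> real" where
  "norm_c1_path x = norm (c1_fun x 0) + (SUP s\<in>{0..1}. norm (c1_deriv x s))"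

definition dist_c1_path :: "'a c1_path \<Rightarrow> 'a c1_path \<Rightarrow> real" where
  "dist_c1_path x y = norm (x - y)"

definition sgn_c1_path :: "'a c1_path \<Rightarrow> 'a c1_path" where
  "sgn_c1_path x = inverse (norm x) *\<^sub>R x"

definition uniformity_c1_path :: "('a c1_path \<times> 'a c1_path) filter" where
  "uniformity_c1_path = (INF e\<in>{0<..}. principal {(x, y). dist x y < e})"

definition open_c1_path :: "'a c1_path set \<Rightarrow> bool" where
  "open_c1_path S = (\<forall>x\<in>S. \<forall>\<^sub>F (x', y) in uniformity. x' = x \<longrightarrow> y \<in> S)"

instance
proof
  fix x y z :: "'a c1_path" and a b :: real
  have deriv_add: "c1_deriv (x + y) t = c1_deriv x t + c1_deriv y t" if "t \<in> {0..1}" for t x y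
    using that by (intro c1_deriv_unique)
      (auto simp: plus_c1_path.rep_eq intro!: has_vector_derivative_add c1_fun_has_deriv)
  have deriv_scale: "c1_deriv (a *\<^sub>R x) t = a *\<^sub>R c1_deriv x t" if "t \<in> {0..1}" for t a x
    using that by (intro c1_deriv_unique)
      (auto simp: scaleR_c1_path.rep_eq
        intro!: bounded_linear.has_vector_derivative[OF bounded_linear_scaleR_right] c1_fun_has_deriv)
  show "x + y + z = x + (y + z)" by transfer (simp add: add.assoc)
  show "x + y = y + x" by transfer (simp add: add.commute)
  show "0 + x = x" by transfer simp
  show "- x + x = 0" unfolding uminus_c1_path_def by transfer simp
  show "x - y = x + - y" unfolding uminus_c1_path_def minus_c1_path_def ..
  show "a *\<^sub>R (x + y) = a *\<^sub>R x + a *\<^sub>R y" by transfer (simp add: scaleR_add_right)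
  show "(a + b) *\<^sub>R x = a *\<^sub>R x + b *\<^sub>R x" by transfer (simp add: scaleR_add_left)
  show "a *\<^sub>R b *\<^sub>R x = (a * b) *\<^sub>R x" by transfer simp
  show "1 *\<^sub>R x = x" by transfer simp
  show "dist x y = norm (x - y)" by (rule dist_c1_path_def)
  show "sgn x = inverse (norm x) *\<^sub>R x" by (rule sgn_c1_path_def)
  show "uniformity = (INF e\<in>{0<..}. principal {(x, y::'a c1_path). dist x y < e})"
    by (rule uniformity_c1_path_def)
  show "open U = (\<forall>x\<in>U. \<forall>\<^sub>F (x', y) in uniformity. x' = x \<longrightarrow> y \<in> U)" for U :: "'a c1_path set"
    by (rule open_c1_path_def)
  have deriv_le: "norm (c1_deriv x t) \<le> (SUP s\<in>{0..1}. norm (c1_deriv x s))" if "t \<in> {0..1}" for x :: "'a c1_path" and t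
    using that by (intro cSUP_upper bdd_above_c1_deriv)
  have sup_nonneg: "0 \<le> (SUP s\<in>{0..1}. norm (c1_deriv x s))" for x :: "'a c1_path"
    by (rule order_trans[OF norm_ge_zero deriv_le[of 0]]) simp
  show "(norm x = 0) = (x = 0)"
  proof
    assume *: "norm x = 0"
    then have x0: "c1_fun x 0 = 0" and d: "(SUP s\<in>{0..1}. norm (c1_deriv x s)) = 0"
      using sup_nonneg[of x] unfolding norm_c1_path_def
      by (simp_all add: add_nonneg_eq_0_iff)
    have "(c1_fun x has_vector_derivative 0) (at t within {0..1})" if "t \<in> {0..1}" for t
      using c1_fun_has_deriv[OF that, of x] deriv_le[OF that, of x] d by simp
    then obtain c where c: "\<And>t. t \<in> {0..1} \<Longrightarrow> c1_fun x t = c"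
      using has_vector_derivative_zero_constant[of "{0..1::real}" "c1_fun x"] by auto
    show "x = 0"
      by (rule c1_path_eqI) (use c x0 in \<open>force simp: zero_c1_path.rep_eq\<close>)
  next
    assume "x = 0"
    have "c1_deriv (0 :: 'a c1_path) t = 0" if "t \<in> {0..1}" for t
      using that by (intro c1_deriv_unique) (auto simp: zero_c1_path.rep_eq)
    then show "norm x = 0"
      using \<open>x = 0\<close> by (simp add: norm_c1_path_def zero_c1_path.rep_eq)
  qed
  show "norm (x + y) \<le> norm x + norm y"
  proof -
    have "(SUP s\<in>{0..1}. norm (c1_deriv (x + y) s)) \<le>
          (SUP s\<in>{0..1}. norm (c1_deriv x s)) + (SUP s\<in>{0..1}. norm (c1_deriv y s))"
    proof (rule cSUP_least)
      fix s :: real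
      assume s: "s \<in> {0..1}"
      show "norm (c1_deriv (x + y) s) \<le>
          (SUP s\<in>{0..1}. norm (c1_deriv x s)) + (SUP s\<in>{0..1}. norm (c1_deriv y s))"
        unfolding deriv_add[OF s]
        by (rule order_trans[OF norm_triangle_ineq add_mono[OF deriv_le[OF s] deriv_le[OF s]]])
    qed simp
    then show ?thesis
      using norm_triangle_ineq[of "c1_fun x 0" "c1_fun y 0"]
      by (simp add: norm_c1_path_def plus_c1_path.rep_eq)
  qed
  show "norm (a *\<^sub>R x) = \<bar>a\<bar> * norm x"
  proof -
    have "(SUP s\<in>{0..1}. norm (c1_deriv (a *\<^sub>R x) s)) = (SUP s\<in>{0..1}. \<bar>a\<bar> * norm (c1_deriv x s))"
      by (rule SUP_cong) (auto simp: deriv_scale)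
    also have "\<dots> = \<bar>a\<bar> * (SUP s\<in>{0..1}. norm (c1_deriv x s))"
    proof -
      have "continuous (at_left r) (\<lambda>r. \<bar>a\<bar> * r)" for r :: real
        by (intro continuous_intros)
      then show ?thesis
        using continuous_at_Sup_mono[of "\<lambda>r. \<bar>a\<bar> * r" "(\<lambda>s. norm (c1_deriv x s)) ` {0..1}"]
          bdd_above_c1_deriv[of x]
        by (simp add: image_image mono_def mult_left_mono)
    qed
    finally show ?thesis
      by (simp add: norm_c1_path_def scaleR_c1_path.rep_eq distrib_left)
  qed
qed

end

definition measure_support :: "'a::topological_space measure \<Rightarrow> 'a set" where
  "measure_support \<mu> = {x. \<forall>U. open U \<and> x \<in> U \<longrightarrow> emeasure \<mu> U > 0}"

section \<open>Iterated integrals\<close>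

text \<open>
  The equations that determine \<open>J s t = (J\<^sup>T\<^sub>s\<^sub>,\<^sub>t)\<close> over all Lions forests, for paths in \<open>\<Omega>\<close>.
  The integral against \<open>dx\<^sub>r = x'\<^sub>r dr\<close> is oriented, since \<open>s > t\<close> is allowed.
\<close>

definition iterated_integrals ::
  "'d::finite c1_path set \<Rightarrow> (real \<Rightarrow> real \<Rightarrow> ('d c1_path, 'd) family) \<Rightarrow> bool" where
  "iterated_integrals \<Omega> J \<longleftrightarrow> (\<forall>s\<in>{0..1}. \<forall>t\<in>{0..1}. \<forall>x\<in>\<Omega>.
     (\<forall>y\<in>hyper empty_forest \<rightarrow>\<^sub>E \<Omega>. \<forall>i\<in>multi_index empty_forest. J s t empty_forest x y i = 1) \<and>
     (\<forall>n. \<forall>y\<in>hyper (rooting n empty_forest) \<rightarrow>\<^sub>E \<Omega>. \<forall>i\<in>multi_index (rooting n empty_forest).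
        J s t (rooting n empty_forest) x y i = (c1_fun x t - c1_fun x s) $ i n) \<and>
     (\<forall>T \<pi>. lions_forest T \<and> inj_on \<pi> (nodes T) \<longrightarrow>
        (\<forall>y\<in>hyper (relabel \<pi> T) \<rightarrow>\<^sub>E \<Omega>. \<forall>i\<in>multi_index (relabel \<pi> T).
           J s t (relabel \<pi> T) x y i = J s t T x (\<lambda>h\<in>hyper T. y (\<pi> ` h)) (\<lambda>n\<in>nodes T. i (\<pi> n)))) \<and>
     (\<forall>T1 T2. lions_forest T1 \<and> lions_forest T2 \<and> nodes T1 \<inter> nodes T2 = {} \<longrightarrow>
        (\<forall>y\<in>hyper (join T1 T2) \<rightarrow>\<^sub>E \<Omega>. \<forall>i\<in>multi_index (join T1 T2).
           J s t (join T1 T2) x y i =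
             J s t T1 x (restrict y (hyper T1)) (restrict i (nodes T1)) *
             J s t T2 x (restrict y (hyper T2)) (restrict i (nodes T2)))) \<and>
     (\<forall>T. lions_forest T \<and> tagged T \<noteq> {} \<longrightarrow>
        (\<forall>y\<in>hyper (decouple T) \<rightarrow>\<^sub>E \<Omega>. \<forall>i\<in>multi_index (decouple T).
           J s t (decouple T) x y i = J s t T (y (tagged T)) (restrict y (hyper T)) i)) \<and>
     (\<forall>T n. lions_forest T \<and> n \<notin> nodes T \<longrightarrow>
        (\<forall>y\<in>hyper (rooting n T) \<rightarrow>\<^sub>E \<Omega>. \<forall>i\<in>multi_index (rooting n T).
           J s t (rooting n T) x y i =
             (LBINT r=s..t. J s r T x y (restrict i (nodes T)) * c1_deriv x r $ i n))))"

text \<open>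
  Such a family exists: a node \<open>n\<close> carrying the path \<open>z\<close> contributes the integral over \<open>[s,t]\<close> of the
  product of the contributions of its children, as functions of the upper limit, against
  \<open>dz\<close>, and \<open>J\<^sup>T\<^sub>s\<^sub>,\<^sub>t\<close> is the product of the contributions of the roots.
\<close>

lemma trancl_walk: "(a, b) \<in> E\<^sup>+ \<Longrightarrow> \<exists>ns. walk E a b ns \<and> length ns \<ge> 2"
proof (induction rule: trancl_induct)
  case (base y)
  then show ?case by (intro exI[of _ "[a, y]"]) (auto simp: walk_def)
next
  case (step y z)
  then obtain ns where "walk E a y ns" "length ns \<ge> 2" by blast
  then show ?case using step(2)
    by (intro exI[of _ "ns @ [z]"]) (auto simp: walk_def successively_append_iff)
qed

lemma walk_append:
  assumes "walk E a b ns" "walk E b c ms"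
  shows "walk E a c (ns @ tl ms)"
proof (cases ms)
  case Nil then show ?thesis using assms by (simp add: walk_def)
next
  case (Cons m ms')
  then show ?thesis using assms
    by (cases ms') (auto simp: walk_def successively_append_iff)
qed

lemma directed_forest_wf:
  assumes "directed_forest N E" shows "wf E"
proof -
  have E: "finite N" "E \<subseteq> N \<times> N" using assms by (auto simp: directed_forest_def)
  have "acyclic E"
  proof (rule acyclicI, intro allI notI)
    fix x assume x: "(x, x) \<in> E\<^sup>+"
    then obtain ns where ns: "walk E x x ns" "length ns \<ge> 2" using trancl_walk by blast
    have "x \<in> N" using trancl_subset_Sigma[OF E(2)] x by auto
    let ?C = "(E \<union> E\<inverse>)\<^sup>* `` {x}"
    have C: "?C \<in> N // (E \<union> E\<inverse>)\<^sup>*" by (rule quotientI[OF \<open>x \<in> N\<close>])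
    have "x \<in> ?C" by simp
    moreover have "\<exists>r\<in>?C. \<forall>x\<in>?C. \<exists>!ns. walk E x r ns"
      using assms C unfolding directed_forest_def by (elim conjE bspec)
    ultimately obtain r where "\<exists>!ms. walk E x r ms" by (elim bexE) (drule (1) bspec)
    then obtain ms where ms: "walk E x r ms" "\<And>ms'. walk E x r ms' \<Longrightarrow> ms' = ms" by blast
    have "ns @ tl ms = ms" using walk_append[OF ns(1) ms(1)] ms(2) by blast
    moreover have "length (ns @ tl ms) > length ms" using ns(2) by (cases ms) auto
    ultimately show False by simp
  qed
  moreover have "finite E" using E finite_subset by blast
  ultimately show ?thesis using finite_acyclic_wf by blast
qed

definition path_at :: "forest \<Rightarrow> 'a \<Rightarrow> (nat set \<Rightarrow> 'a) \<Rightarrow> nat \<Rightarrow> 'a" where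
  "path_at T x y n = (if n \<in> tagged T then x else y (THE h. h \<in> hyper T \<and> n \<in> h))"

definition node_integral ::
  "(nat \<times> nat) set \<Rightarrow> (nat \<Rightarrow> 'd::finite c1_path) \<Rightarrow> (nat \<Rightarrow> 'd) \<Rightarrow> real \<Rightarrow> nat \<Rightarrow> real \<Rightarrow> real" where
  "node_integral E c i s = wfrec E (\<lambda>K n t.
     LBINT r=s..t. (\<Prod>m\<in>{m. (m, n) \<in> E}. K m r) * c1_deriv (c n) r $ i n)"

definition explicit_integral :: "real \<Rightarrow> real \<Rightarrow> ('d::finite c1_path, 'd) family" where
  "explicit_integral s t T x y i =
     (\<Prod>n\<in>{n. is_root (nodes T) (edges T) n}. node_integral (edges T) (path_at T x y) i s n t)"

lemma node_integral_unfold: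
  assumes "wf E"
  shows "node_integral E c i s n t =
    (LBINT r=s..t. (\<Prod>m\<in>{m. (m, n) \<in> E}. node_integral E c i s m r) * c1_deriv (c n) r $ i n)"
proof -
  have cut: "(\<Prod>m\<in>{m. (m, n) \<in> E}. cut K E n m r) = (\<Prod>m\<in>{m. (m, n) \<in> E}. K m r)"
    for K :: "nat \<Rightarrow> real \<Rightarrow> real" and r
    by (intro prod.cong) (auto simp: cut_apply)
  show ?thesis
    unfolding node_integral_def by (subst wfrec[OF assms]) (simp only: cut)
qed

lemma node_integral_transfer:
  assumes "wf E" "wf E'" "inj_on \<pi> N" "E \<subseteq> N \<times> N"
    and "\<And>n. n \<in> N \<Longrightarrow> {m. (m, \<pi> n) \<in> E'} = \<pi> ` {m. (m, n) \<in> E}"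
    and "\<And>n. n \<in> N \<Longrightarrow> c' (\<pi> n) = c n" and "\<And>n. n \<in> N \<Longrightarrow> i' (\<pi> n) = i n"
  shows "n \<in> N \<Longrightarrow> node_integral E' c' i' s (\<pi> n) t = node_integral E c i s n t"
  using assms(1)
proof (induction n arbitrary: t rule: wf_induct_rule)
  case (less n)
  have sub: "{m. (m, n) \<in> E} \<subseteq> N" using assms(4) by auto
  have eq: "(\<Prod>m\<in>{m. (m, \<pi> n) \<in> E'}. node_integral E' c' i' s m r) =
        (\<Prod>m\<in>{m. (m, n) \<in> E}. node_integral E c i s m r)" for r
    unfolding assms(5)[OF less.prems]
    by (subst prod.reindex[OF inj_on_subset[OF assms(3) sub]])
       (use less.IH sub in \<open>auto intro!: prod.cong\<close>)
  show ?case
    by (subst node_integral_unfold[OF assms(2)], subst node_integral_unfold[OF assms(1)])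
       (simp only: eq assms(6)[OF less.prems] assms(7)[OF less.prems])
qed

lemma lions_forestD:
  assumes "lions_forest T"
  shows "wf (edges T)" "finite (nodes T)" "edges T \<subseteq> nodes T \<times> nodes T" "tagged T \<subseteq> nodes T"
    "partition_on (nodes T - tagged T) (hyper T)" "\<And>h. h \<in> hyper T \<Longrightarrow> h \<subseteq> nodes T - tagged T"
proof -
  note L = assms[unfolded lions_forest_def]
  note df = L[THEN conjunct2, THEN conjunct1]
    and tag = L[THEN conjunct2, THEN conjunct2, THEN conjunct1]
    and part = L[THEN conjunct2, THEN conjunct2, THEN conjunct2, THEN conjunct1]
  show "wf (edges T)" by (rule directed_forest_wf[OF df])
  show "finite (nodes T)" "edges T \<subseteq> nodes T \<times> nodes T"
    by (rule df[unfolded directed_forest_def, THEN conjunct1])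
       (rule df[unfolded directed_forest_def, THEN conjunct2, THEN conjunct1])
  show "tagged T \<subseteq> nodes T" "partition_on (nodes T - tagged T) (hyper T)" by fact+
  show "\<And>h. h \<in> hyper T \<Longrightarrow> h \<subseteq> nodes T - tagged T"
    using partition_onD1[OF part] by blast
qed

lemma the_hyper:
  assumes "lions_forest T" "h \<in> hyper T" "n \<in> h"
  shows "(THE h. h \<in> hyper T \<and> n \<in> h) = h"
proof (rule the_equality)
  fix k assume "k \<in> hyper T \<and> n \<in> k"
  then show "k = h" using assms lions_forestD(5)[OF assms(1)]
    by (auto simp: partition_on_def disjoint_def)
qed (use assms in auto)

lemma path_at_hyper:
  assumes "lions_forest T" "h \<in> hyper T" "n \<in> h"
  shows "path_at T x y n = y h"
  using the_hyper[OF assms] lions_forestD(6)[OF assms(1,2)] assms(3) by (auto simp: path_at_def)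

lemma hyper_cases:
  assumes "lions_forest T" "n \<in> nodes T"
  obtains "n \<in> tagged T" | h where "h \<in> hyper T" "n \<in> h" "n \<notin> tagged T"
  using assms lions_forestD(5)[OF assms(1)] by (auto simp: partition_on_def)

lemma roots_eq: "{n. is_root N E n} = N - Domain E"
  by (auto simp: is_root_def)

lemma explicit_relabel:
  assumes T: "lions_forest T" and inj: "inj_on \<pi> (nodes T)"
  shows "explicit_integral s t (relabel \<pi> T) x y i =
    explicit_integral s t T x (\<lambda>h\<in>hyper T. y (\<pi> ` h)) (\<lambda>n\<in>nodes T. i (\<pi> n))"
proof -
  note D = lions_forestD[OF T]
  have inj': "\<pi> a = \<pi> b \<Longrightarrow> a = b" if "a \<in> nodes T" "b \<in> nodes T" for a b
    using inj that by (auto dest: inj_onD)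
  have wf': "wf (map_prod \<pi> \<pi> ` edges T)"
  proof (rule wf_map_prod_image_Dom_Ran[OF D(1)])
    fix a b assume "a \<in> Domain (edges T)" "b \<in> Range (edges T)" "\<pi> a = \<pi> b"
    moreover from this have "a \<in> nodes T" "b \<in> nodes T" using D(3) by blast+
    ultimately show "a = b" using inj' by blast
  qed
  have roots: "{n. is_root (nodes (relabel \<pi> T)) (edges (relabel \<pi> T)) n} =
    \<pi> ` {n. is_root (nodes T) (edges T) n}"
  proof -
    have "Domain (map_prod \<pi> \<pi> ` edges T) = \<pi> ` Domain (edges T)"
      by (force simp: Domain_iff image_iff)
    moreover have "Domain (edges T) \<subseteq> nodes T" using D(3) by blast
    ultimately show ?thesis
      using inj_on_image_set_diff[OF inj, of "nodes T" "Domain (edges T)"]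
      by (simp add: roots_eq relabel_def Diff_subset)
  qed
  have colour: "path_at (relabel \<pi> T) x y (\<pi> n) = path_at T x (\<lambda>h\<in>hyper T. y (\<pi> ` h)) n"
    if n: "n \<in> nodes T" for n
    using T n
  proof (cases rule: hyper_cases)
    case 1
    then show ?thesis by (auto simp: path_at_def relabel_def)
  next
    case (2 h)
    have "(THE k. k \<in> (`) \<pi> ` hyper T \<and> \<pi> n \<in> k) = \<pi> ` h"
    proof (rule the_equality)
      fix k assume "k \<in> (`) \<pi> ` hyper T \<and> \<pi> n \<in> k"
      then obtain h' m where h': "k = \<pi> ` h'" "h' \<in> hyper T" "m \<in> h'" "\<pi> n = \<pi> m" by auto
      then have "n = m" using inj' n D(6)[OF h'(2)] by blast
      then have "h' = h" using the_hyper[OF T h'(2), of n] the_hyper[OF T 2(1,2)] h' by simp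
      then show "k = \<pi> ` h" using h' by simp
    qed (use 2 in auto)
    moreover have "\<pi> n \<notin> \<pi> ` tagged T" using 2(3) n D(4) inj' by blast
    ultimately have "path_at (relabel \<pi> T) x y (\<pi> n) = y (\<pi> ` h)"
      by (simp add: path_at_def relabel_def)
    then show ?thesis
      using 2(1) by (simp add: path_at_hyper[OF T 2(1,2)])
  qed
  have ch: "{m. (m, \<pi> n) \<in> map_prod \<pi> \<pi> ` edges T} = \<pi> ` {m. (m, n) \<in> edges T}" if "n \<in> nodes T" for n
  proof (rule set_eqI, rule iffI)
    fix m assume "m \<in> {m. (m, \<pi> n) \<in> map_prod \<pi> \<pi> ` edges T}"
    then obtain a b where ab: "(a, b) \<in> edges T" "m = \<pi> a" "\<pi> n = \<pi> b" by auto
    then have "b \<in> nodes T" using D(3) by blast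
    then have "n = b" using inj'[OF that] ab(3) by blast
    then show "m \<in> \<pi> ` {m. (m, n) \<in> edges T}" using ab by blast
  qed force
  have "node_integral (edges (relabel \<pi> T)) (path_at (relabel \<pi> T) x y) i s (\<pi> n) t =
    node_integral (edges T) (path_at T x (\<lambda>h\<in>hyper T. y (\<pi> ` h))) (\<lambda>n\<in>nodes T. i (\<pi> n)) s n t"
    if "n \<in> nodes T" for n
    by (rule node_integral_transfer[OF D(1) _ inj D(3)])
       (use that wf' ch colour in \<open>auto simp: relabel_def\<close>)
  then show ?thesis
    unfolding explicit_integral_def roots
    by (subst prod.reindex) (auto simp: is_root_def intro: inj_on_subset[OF inj])
qed

lemma explicit_join:
  assumes T1: "lions_forest T1" and T2: "lions_forest T2" and dis: "nodes T1 \<inter> nodes T2 = {}"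
  shows "explicit_integral s t (join T1 T2) x y i =
    explicit_integral s t T1 x (restrict y (hyper T1)) (restrict i (nodes T1)) *
    explicit_integral s t T2 x (restrict y (hyper T2)) (restrict i (nodes T2))"
proof -
  note D1 = lions_forestD[OF T1] and D2 = lions_forestD[OF T2]
  have wf': "wf (edges T1 \<union> edges T2)"
    by (rule wf_Un[OF D1(1) D2(1)]) (use D1(3) D2(3) dis in auto)
  let ?r = "\<lambda>T. {n. is_root (nodes T) (edges T) n}"
  have roots: "?r (join T1 T2) = ?r T1 \<union> ?r T2" "?r T1 \<inter> ?r T2 = {}" "finite (?r T1)" "finite (?r T2)"
    using D1(2,3) D2(2,3) dis by (auto simp: is_root_def join_def)
  have *: "node_integral (edges (join T1 T2)) (path_at (join T1 T2) x y) i s n t =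
    node_integral (edges T) (path_at T x (restrict y (hyper T))) (restrict i (nodes T)) s n t"
    if n: "n \<in> nodes T" and T: "T = T1 \<or> T = T2" for n T
  proof -
    have L: "lions_forest T" using T T1 T2 by auto
    obtain T' where T': "lions_forest T'" "nodes T \<inter> nodes T' = {}"
      "tagged (join T1 T2) = tagged T \<union> tagged T'" "hyper (join T1 T2) = hyper T \<union> hyper T'"
      "edges (join T1 T2) = edges T \<union> edges T'"
    proof (cases "T = T1")
      case True
      then show ?thesis using that[of T2] T2 dis by (simp add: join_def)
    next
      case False
      then have "T = T2" using T by simp
      then show ?thesis using that[of T1] T1 dis by (simp add: join_def Un_commute Int_commute)
    qed
    note D = lions_forestD[OF L] and D' = lions_forestD[OF T'(1)]
    have sub1: "tagged (join T1 T2) \<inter> nodes T = tagged T"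
      using T'(2,3) D(4) D'(4) by blast
    have sub2: "hyper T \<subseteq> hyper (join T1 T2)" using T'(4) by blast
    have sub3: "h \<in> hyper T" if "h \<in> hyper (join T1 T2)" "h \<inter> nodes T \<noteq> {}" for h
    proof (rule ccontr)
      assume "h \<notin> hyper T"
      then have "h \<subseteq> nodes T'" using that(1) T'(4) D'(6)[of h] by blast
      then show False using that(2) T'(2) by blast
    qed
    have sub4: "(m, k) \<in> edges (join T1 T2) \<longleftrightarrow> (m, k) \<in> edges T" if "k \<in> nodes T" for m k
    proof -
      have "(m, k) \<notin> edges T'" using that T'(2) D'(3) by blast
      then show ?thesis using T'(5) by simp
    qed
    note sub = sub1 sub2 sub3 sub4
    have colour: "path_at (join T1 T2) x y k = path_at T x (restrict y (hyper T)) k"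
      if k: "k \<in> nodes T" for k
      using L k
    proof (cases rule: hyper_cases)
      case 1
      then show ?thesis using sub(1) by (auto simp: path_at_def)
    next
      case (2 h)
      have "(THE h. h \<in> hyper (join T1 T2) \<and> k \<in> h) = h"
      proof (rule the_equality)
        fix l assume l: "l \<in> hyper (join T1 T2) \<and> k \<in> l"
        then have "l \<in> hyper T" using sub(3)[of l] k by blast
        then show "l = h" using the_hyper[OF L _, of l k] the_hyper[OF L 2(1,2)] l by simp
      qed (use 2 sub(2) in auto)
      moreover have "k \<notin> tagged (join T1 T2)" using 2(3) sub(1) k by blast
      ultimately have "path_at (join T1 T2) x y k = y h" by (simp add: path_at_def)
      then show ?thesis using 2(1) by (simp add: path_at_hyper[OF L 2(1,2)])
    qed
    show ?thesis
      using node_integral_transfer[OF lions_forestD(1)[OF L], of "edges (join T1 T2)" id "nodes T"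
          "path_at (join T1 T2) x y" "path_at T x (restrict y (hyper T))" i "restrict i (nodes T)" n s t]
        wf' lions_forestD(3)[OF L] sub(4) colour n
      by (simp add: join_def)
  qed
  show ?thesis
    unfolding explicit_integral_def roots(1)
    by (subst prod.union_disjoint[OF roots(3,4,2)])
       (auto intro!: arg_cong2[where f = "(*)"] prod.cong simp: is_root_def *)
qed

lemma explicit_decouple:
  assumes T: "lions_forest T" and "tagged T \<noteq> {}"
  shows "explicit_integral s t (decouple T) x y i =
    explicit_integral s t T (y (tagged T)) (restrict y (hyper T)) i"
proof -
  note D = lions_forestD[OF T]
  have h': "hyper' T = insert (tagged T) (hyper T)"
    using D(5) assms(2) by (auto simp: hyper'_def partition_on_def)
  have colour: "path_at (decouple T) x y n = path_at T (y (tagged T)) (restrict y (hyper T)) n"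
    if "n \<in> nodes T" for n
    using T that
  proof (cases rule: hyper_cases)
    case 1
    then have "(THE h. h \<in> hyper' T \<and> n \<in> h) = tagged T"
      using h' D(6) by (intro the_equality) auto
    then show ?thesis using 1 by (simp add: path_at_def decouple_def)
  next
    case (2 h)
    have "(THE h. h \<in> hyper' T \<and> n \<in> h) = h"
    proof (rule the_equality)
      fix l assume l: "l \<in> hyper' T \<and> n \<in> l"
      then have "l \<in> hyper T" using 2 h' by auto
      then show "l = h" using the_hyper[OF T _, of l n] the_hyper[OF T 2(1,2)] l by simp
    qed (use 2 h' in auto)
    then have "path_at (decouple T) x y n = y h" by (simp add: path_at_def decouple_def)
    then show ?thesis using 2(1) by (simp add: path_at_hyper[OF T 2(1,2)])
  qed
  have "node_integral (edges T) (path_at (decouple T) x y) i s n t =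
    node_integral (edges T) (path_at T (y (tagged T)) (restrict y (hyper T))) i s n t"
    if "n \<in> nodes T" for n
    using node_integral_transfer[OF D(1) D(1), of id "nodes T" "path_at (decouple T) x y"
        "path_at T (y (tagged T)) (restrict y (hyper T))" i i n s t] colour that D(3) by simp
  then show ?thesis
    unfolding explicit_integral_def
    by (intro prod.cong) (auto simp: decouple_def is_root_def)
qed

lemma explicit_rooting:
  assumes T: "lions_forest T" and n: "n \<notin> nodes T"
  shows "explicit_integral s t (rooting n T) x y i =
    (LBINT r=s..t. explicit_integral s r T x y (restrict i (nodes T)) * c1_deriv x r $ i n)"
proof -
  note D = lions_forestD[OF T]
  let ?R = "{m. is_root (nodes T) (edges T) m}"
  let ?E = "edges T \<union> {(r, n) |r. is_root (nodes T) (edges T) r}"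
  have wf2: "wf {(r, n) |r. is_root (nodes T) (edges T) r}"
    by (rule wf_subset[OF wf_measure[of "\<lambda>m. if m = n then 1 else 0"]]) (use n in \<open>auto simp: is_root_def\<close>)
  have wf': "wf ?E"
    by (rule wf_Un[OF D(1) wf2]) (use D(3) n in \<open>auto simp: is_root_def\<close>)
  have root: "{m. is_root (nodes (rooting n T)) (edges (rooting n T)) m} = {n}"
    using D(3) n by (auto simp: is_root_def rooting_def)
  have E: "edges (rooting n T) = ?E" by (simp add: rooting_def)
  have ch: "{m. (m, n) \<in> ?E} = ?R" using D(3) n by auto
  have *: "node_integral ?E (path_at (rooting n T) x y) i s m r =
    node_integral (edges T) (path_at T x y) (restrict i (nodes T)) s m r" if "m \<in> nodes T" for m r
  proof -
    have "{l. (l, k) \<in> ?E} = {l. (l, k) \<in> edges T}" "path_at (rooting n T) x y k = path_at T x y k"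
      if "k \<in> nodes T" for k
    proof -
      have "k \<noteq> n" using that n by blast
      then show "{l. (l, k) \<in> ?E} = {l. (l, k) \<in> edges T}" by simp
      show "path_at (rooting n T) x y k = path_at T x y k"
        using \<open>k \<noteq> n\<close> by (simp add: path_at_def rooting_def)
    qed
    then show ?thesis
      using node_integral_transfer[OF D(1) wf' inj_on_id D(3),
          of "path_at (rooting n T) x y" "path_at T x y" i "restrict i (nodes T)" m s r] that
      by simp
  qed
  have "(\<Prod>m\<in>{m. (m, n) \<in> ?E}. node_integral ?E (path_at (rooting n T) x y) i s m r) =
     explicit_integral s r T x y (restrict i (nodes T))" for r
    unfolding ch explicit_integral_def
  proof (rule prod.cong[OF refl])
    fix m assume "m \<in> ?R"
    then have "m \<in> nodes T" by (simp add: is_root_def)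
    then show "node_integral ?E (path_at (rooting n T) x y) i s m r =
      node_integral (edges T) (path_at T x y) (restrict i (nodes T)) s m r" by (rule *)
  qed
  moreover have "path_at (rooting n T) x y n = x" by (simp add: path_at_def rooting_def)
  ultimately show ?thesis
    unfolding explicit_integral_def[of s t "rooting n T"] root unfolding E
    using node_integral_unfold[OF wf', of "path_at (rooting n T) x y" i s n t] by simp
qed

lemma explicit_single:
  assumes "s \<in> {0..1}" "t \<in> {0..1}"
  shows "explicit_integral s t (rooting n empty_forest) x y i = (c1_fun x t - c1_fun x s) $ i n"
proof -
  have "{m. is_root (nodes (rooting n empty_forest)) (edges (rooting n empty_forest)) m} = {n}"
    "edges (rooting n empty_forest) = {}" "path_at (rooting n empty_forest) x y n = x"
    by (auto simp: is_root_def rooting_def empty_forest_def path_at_def)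
  then have "explicit_integral s t (rooting n empty_forest) x y i = (LBINT r=s..t. c1_deriv x r $ i n)"
    using node_integral_unfold[of "{}" "path_at (rooting n empty_forest) x y" i s n t]
    by (simp add: explicit_integral_def)
  also have "\<dots> = c1_fun x t $ i n - c1_fun x s $ i n"
  proof (rule interval_integral_FTC_finite)
    have sub: "{min s t..max s t} \<subseteq> {0..1}" using assms by auto
    show "continuous_on {min s t..max s t} (\<lambda>r. c1_deriv x r $ i n)"
      by (intro continuous_intros continuous_on_subset[OF continuous_on_c1_deriv sub])
    fix r assume "min s t \<le> r" "r \<le> max s t"
    then have "r \<in> {0..1}" using assms by auto
    then show "((\<lambda>r. c1_fun x r $ i n) has_vector_derivative c1_deriv x r $ i n) (at r within {min s t..max s t})"
      using bounded_linear.has_vector_derivative[OF bounded_linear_vec_nth c1_fun_has_deriv]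
        has_vector_derivative_within_subset[OF _ sub] by blast
  qed
  finally show ?thesis by simp
qed

lemma explicit_empty: "explicit_integral s t empty_forest x y i = 1"
  by (simp add: explicit_integral_def empty_forest_def is_root_def)

lemma iterated_integrals_exist: "\<exists>J. iterated_integrals \<Omega> J"
  by (rule exI[of _ explicit_integral], unfold iterated_integrals_def, intro ballI conjI allI impI)
     (simp_all add: explicit_empty explicit_single explicit_relabel explicit_join explicit_decouple
       explicit_rooting)

end

theory Submission
  imports Defs
begin

text \<open>
  The statement is about an arbitrary solution \<open>J\<close> of the equations for iterated integrals. Every
  Lions forest is generated by rooting, products and decoupling (\<open>lions_forest_induct\<close>), so \<open>J\<close>
  agrees on \<open>\<Omega>\<close> with the explicit solution (\<open>iterated_integrals_explicit\<close>), which is an integral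
  over the directed forest in which each node carries a fixed path, namely the variable of its
  hyperedge. After this reduction hyperedges only matter as a colouring of the nodes by paths.

  For a fixed colouring, let \<open>I\<^sub>s\<^sub>,\<^sub>t(A)\<close> be the integral over the forest induced on a set \<open>A\<close> of
  nodes. The product rule and the fundamental theorem of calculus give the differential equation
  (\<open>cut_integral_deriv\<close>)

    \<open>d/dt I\<^sub>s\<^sub>,\<^sub>t(A) = (\<Sum>n root of A. I\<^sub>s\<^sub>,\<^sub>t(A - {n}) * c'\<^sub>n(t))\<close>,

  with \<open>I\<^sub>s\<^sub>,\<^sub>s(A) = 0\<close> for nonempty \<open>A\<close>. By induction on the number of nodes it yields the bound
  \<open>\<bar>I\<^sub>s\<^sub>,\<^sub>t(A)\<bar> \<le> C * \<bar>t - s\<bar> ^ card A * (\<Prod>n\<in>A. norm (c n))\<close> (\<open>cut_integral_bound\<close>) and Chen's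
  relation, since both sides of the latter solve the same equation in the upper limit
  (\<open>cut_integral_chen\<close>). That the pieces of a cut are again Lions forests (\<open>lions_subforest\<close>)
  makes this Chen's relation for the convolution.

  Measurability follows by induction on the nodes. In the bound each hyperedge \<open>h\<close> contributes the
  power \<open>card h\<close> of the norm of its variable, so the mixed norm with exponents \<open>q' / card h\<close> is
  controlled by moments of order \<open>q'\<close> (\<open>mixed_norm_product_bound\<close>). The remaining conditions on
  characters are among the equations for \<open>J\<close>, except for the independence of \<open>\<omega>\<^sub>0\<close>, which holds
  because no node carries the tagged path if \<open>h\<^sub>0\<close> is empty.

  For the rough path, Chen's relation makes \<open>J s 0\<close> the inverse of \<open>J 0 s\<close>, so the increments are
  \<open>J s t\<close>. Their integrals are of order \<open>\<bar>t - s\<bar>\<close> to the number of nodes, and the choice of \<open>\<gamma>\<close>,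
  together with \<open>\<lfloor>\<gamma> / min \<alpha> \<beta>\<rfloor> > 1\<close>, forces the grade of each forest of grade at most \<open>\<gamma>\<close> to be at
  most its number of nodes (\<open>grade_le_card_nodes\<close>).
\<close>

section \<open>Directed forests as acyclic parent relations\<close>

text \<open>
  A directed forest is a partial function \<open>parent\<close> without cycles. In this form the set of
  ancestors \<open>E\<^sup>* `` {x}\<close> of a node is a finite chain, which replaces the walks of the original
  definition.
\<close>

locale parent_forest =
  fixes N :: "nat set" and E :: "(nat \<times> nat) set"
  assumes finite_nodes: "finite N"
    and edges_subset: "E \<subseteq> N \<times> N"
    and parent_unique: "single_valued E"
    and edges_wf: "wf E"

lemma walk_Cons_iff:
  "walk E x r (a # ns) \<longleftrightarrow> a = x \<and> (if ns = [] then r = x else (x, hd ns) \<in> E \<and> walk E (hd ns) r ns)"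
  by (cases ns) (auto simp: walk_def)

lemma walk_ConsI: "(x, y) \<in> E \<Longrightarrow> walk E y r ns \<Longrightarrow> walk E x r (x # ns)"
  by (cases ns) (auto simp: walk_def)

text \<open>
  Two parents of a node would give two different walks from it to the root of its component.
\<close>

lemma directed_forest_single_valued:
  assumes "directed_forest N E"
  shows "single_valued E"
proof (rule single_valuedI)
  fix x y z assume xy: "(x, y) \<in> E" and xz: "(x, z) \<in> E"
  let ?C = "(E \<union> E\<inverse>)\<^sup>* `` {x}"
  have "x \<in> N" using xy assms by (auto simp: directed_forest_def)
  then have "?C \<in> N // (E \<union> E\<inverse>)\<^sup>*" by (rule quotientI)
  then obtain r where "\<forall>x\<in>?C. \<exists>!ns. walk E x r ns"
    using assms unfolding directed_forest_def by blast
  moreover have "x \<in> ?C" "y \<in> ?C" "z \<in> ?C" using xy xz by auto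
  ultimately obtain ns ms ms'
    where ns: "\<And>ns'. walk E x r ns' \<Longrightarrow> ns' = ns" and ms: "walk E y r ms" "walk E z r ms'"
    by metis
  have "walk E x r (x # ms)" "walk E x r (x # ms')"
    using ms xy xz by (auto intro: walk_ConsI)
  then have "ms = ms'" using ns by blast
  then show "y = z" using ms by (auto simp: walk_def)
qed

lemma walk_to_root_unique:
  assumes "single_valued E" "r \<notin> Domain E" "r' \<notin> Domain E"
  shows "walk E x r ns \<Longrightarrow> walk E x r' ns' \<Longrightarrow> ns = ns'"
proof (induction ns arbitrary: x ns')
  case Nil
  then show ?case by (simp add: walk_def)
next
  case (Cons a ns)
  obtain a' ms where ns': "ns' = a' # ms" using Cons.prems(2) by (cases ns') (auto simp: walk_def)
  show ?case
  proof (cases "x \<in> Domain E")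
    case False
    then show ?thesis using Cons.prems unfolding ns' walk_Cons_iff by (auto split: if_splits)
  next
    case True
    then have "x \<noteq> r" "x \<noteq> r'" using assms by auto
    then have "(x, hd ns) \<in> E" "walk E (hd ns) r ns" "(x, hd ms) \<in> E" "walk E (hd ms) r' ms"
      "a = x" "a' = x"
      using Cons.prems unfolding ns' walk_Cons_iff by (auto split: if_splits)
    moreover from this have "hd ns = hd ms" using assms(1) by (auto dest: single_valuedD)
    ultimately show ?thesis using Cons.IH[of "hd ns" ms] ns' by simp
  qed
qed

lemma rtrancl_walk: "(x, y) \<in> E\<^sup>* \<Longrightarrow> \<exists>ns. walk E x y ns"
proof (induction rule: converse_rtrancl_induct)
  case base
  have "walk E y y [y]" by (simp add: walk_def)
  then show ?case ..
next
  case (step x z)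
  then obtain ns where "walk E z y ns" by blast
  then show ?case using step(1) walk_ConsI by blast
qed

context parent_forest
begin

lemma finite_edges: "finite E"
  using finite_nodes edges_subset finite_subset by blast

lemma converse_wf: "wf (E\<inverse>)"
  using finite_edges edges_wf finite_acyclic_wf_converse wf_acyclic by blast

lemma reaches_root: "\<exists>r. (x, r) \<in> E\<^sup>* \<and> r \<notin> Domain E"
  using converse_wf
proof (induction x rule: wf_induct_rule)
  case (less x)
  show ?case
  proof (cases "x \<in> Domain E")
    case True
    then obtain y where "(x, y) \<in> E" by blast
    then show ?thesis using less[of y] by (auto intro: converse_rtrancl_into_rtrancl)
  qed auto
qed

lemma reachable_nodes: "x \<in> N \<Longrightarrow> E\<^sup>* `` {x} \<subseteq> N"
  using edges_subset by (auto elim: rtranclE)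

lemma finite_reachable: "finite (E\<^sup>* `` {x})"
proof -
  have "E\<^sup>* `` {x} \<subseteq> insert x N" using edges_subset by (auto elim: rtranclE)
  then show ?thesis using finite_nodes finite_subset by blast
qed

lemma root_reaches: "x \<notin> Domain E \<Longrightarrow> E\<^sup>* `` {x} = {x}"
  by (auto elim: converse_rtranclE)

lemma node_reaches:
  assumes "(x, y) \<in> E"
  shows "E\<^sup>* `` {x} = insert x (E\<^sup>* `` {y})" "x \<notin> E\<^sup>* `` {y}"
proof -
  show "E\<^sup>* `` {x} = insert x (E\<^sup>* `` {y})"
  proof
    show "E\<^sup>* `` {x} \<subseteq> insert x (E\<^sup>* `` {y})"
    proof
      fix z assume "z \<in> E\<^sup>* `` {x}"
      then have "(x, z) \<in> E\<^sup>*" by simp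
      then show "z \<in> insert x (E\<^sup>* `` {y})"
      proof (cases rule: converse_rtranclE)
        case (step y')
        then show ?thesis using single_valuedD[OF parent_unique assms step(1)] by simp
      qed simp
    qed
    show "insert x (E\<^sup>* `` {y}) \<subseteq> E\<^sup>* `` {x}"
      using assms by (auto intro: converse_rtrancl_into_rtrancl)
  qed
  show "x \<notin> E\<^sup>* `` {y}"
  proof
    assume "x \<in> E\<^sup>* `` {y}"
    then have "(x, x) \<in> E\<^sup>+" using assms by (auto intro: rtrancl_into_trancl2)
    then show False using wf_acyclic[OF edges_wf] by (auto simp: acyclic_def)
  qed
qed

lemma trancl_reaches:
  assumes "(x, y) \<in> E\<^sup>+"
  shows "x \<notin> E\<^sup>* `` {y}"
proof
  assume "x \<in> E\<^sup>* `` {y}"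
  then have "(x, x) \<in> E\<^sup>+" using assms by (auto intro: trancl_rtrancl_trancl)
  then show False using wf_acyclic[OF edges_wf] by (auto simp: acyclic_def)
qed

lemma is_directed_forest: "directed_forest N E"
  unfolding directed_forest_def
proof (intro conjI ballI)
  fix C assume "C \<in> N // (E \<union> E\<inverse>)\<^sup>*"
  then obtain x0 where x0: "x0 \<in> N" "C = (E \<union> E\<inverse>)\<^sup>* `` {x0}" by (auto elim: quotientE)
  obtain r where r: "(x0, r) \<in> E\<^sup>*" "r \<notin> Domain E" using reaches_root by blast
  have "(x0, r) \<in> (E \<union> E\<inverse>)\<^sup>*" using r(1) rtrancl_mono[of E "E \<union> E\<inverse>"] by blast
  then have "r \<in> C" using x0 by simp
  moreover have "\<exists>!ns. walk E x r ns" if "x \<in> C" for x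
  proof -
    have "(x0, x) \<in> (E \<union> E\<inverse>)\<^sup>*" using that x0 by simp
    then have "(x, r) \<in> E\<^sup>*"
    proof (induction rule: rtrancl_induct)
      case (step y z)
      show ?case
      proof (cases "(z, y) \<in> E")
        case True
        then show ?thesis using step.IH by (auto intro: converse_rtrancl_into_rtrancl)
      next
        case False
        then have yz: "(y, z) \<in> E" using step by auto
        from step.IH show ?thesis
        proof (cases rule: converse_rtranclE)
          case base
          then show ?thesis using r(2) yz by blast
        next
          case (step z')
          then show ?thesis using single_valuedD[OF parent_unique yz step(1)] by simp
        qed
      qed
    qed (use r in simp)
    then obtain ns where "walk E x r ns" using rtrancl_walk by blast
    then show ?thesis using walk_to_root_unique[OF parent_unique r(2) r(2)] by blast
  qed
  ultimately show "\<exists>r\<in>C. \<forall>x\<in>C. \<exists>!ns. walk E x r ns" by blast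
qed (use finite_nodes edges_subset in auto)

lemma walk_length:
  "walk E x r ns \<Longrightarrow> r \<notin> Domain E \<Longrightarrow> length ns = card (E\<^sup>* `` {x})"
proof (induction ns arbitrary: x)
  case (Cons a ns)
  show ?case
  proof (cases "ns = []")
    case True
    then show ?thesis using Cons.prems by (auto simp: walk_Cons_iff root_reaches)
  next
    case False
    then have "(x, hd ns) \<in> E" "walk E (hd ns) r ns" using Cons.prems by (auto simp: walk_Cons_iff)
    then show ?thesis using Cons.IH[of "hd ns"] Cons.prems node_reaches[of x "hd ns"] finite_reachable
      by simp
  qed
qed (simp add: walk_def)

end

lemma parent_forest_iff: "directed_forest N E \<longleftrightarrow> parent_forest N E"
proof
  assume "directed_forest N E"
  then show "parent_forest N E"
    using directed_forest_single_valued directed_forest_wf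
    by unfold_locales (simp_all add: directed_forest_def)
qed (rule parent_forest.is_directed_forest)

section \<open>Lions forests and their restriction to pieces of a cut\<close>

text \<open>
  The depth of a node, as the number of its ancestors including itself.
\<close>

definition height :: "(nat \<times> nat) set \<Rightarrow> nat \<Rightarrow> nat" where
  "height E x = card (E\<^sup>* `` {x})"

lemma depth_eq_height:
  assumes "parent_forest (nodes T) (edges T)" "x \<in> nodes T"
  shows "depth T x = height (edges T) x"
proof -
  interpret parent_forest "nodes T" "edges T" by fact
  obtain r where r: "(x, r) \<in> (edges T)\<^sup>*" "r \<notin> Domain (edges T)" using reaches_root by blast
  then have "r \<in> nodes T" using reachable_nodes[OF assms(2)] by blast
  then have root: "is_root (nodes T) (edges T) r" using r by (auto simp: is_root_def)
  obtain ns where ns: "walk (edges T) x r ns" using rtrancl_walk r by blast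
  have "(THE ns. \<exists>r. is_root (nodes T) (edges T) r \<and> walk (edges T) x r ns) = ns"
  proof (rule the_equality)
    fix ms assume "\<exists>r. is_root (nodes T) (edges T) r \<and> walk (edges T) x r ms"
    then obtain r' where "r' \<notin> Domain (edges T)" "walk (edges T) x r' ms" by (auto simp: is_root_def)
    then show "ms = ns" using walk_to_root_unique[OF parent_unique _ r(2) _ ns] by blast
  qed (use root ns in blast)
  then show ?thesis using walk_length[OF ns r(2)] by (simp add: depth_def height_def)
qed


text \<open>
  The two conditions on a single hyperedge in the definition of a Lions forest, with the depth
  replaced by \<open>height\<close>, so that they only refer to the edges.
\<close>

definition linked :: "(nat \<times> nat) set \<Rightarrow> nat set \<Rightarrow> bool" where
  "linked E h \<longleftrightarrow>
     (\<forall>x\<in>h. \<forall>y\<in>h. height E x < height E y \<longrightarrow> (\<exists>z\<in>h. (y, z) \<in> E)) \<and>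
     (\<forall>x1\<in>h. \<forall>y1\<in>h. \<forall>x2 y2. height E x1 = height E y1 \<and> (x1, x2) \<in> E \<and> (y1, y2) \<in> E \<and>
        x2 \<noteq> y2 \<longrightarrow> x2 \<in> h \<and> y2 \<in> h)"

context parent_forest
begin

lemma height_root: "x \<notin> Domain E \<Longrightarrow> height E x = 1"
  by (simp add: height_def root_reaches)

lemma height_child: "(x, y) \<in> E \<Longrightarrow> height E x = Suc (height E y)"
  using node_reaches[of x y] finite_reachable by (simp add: height_def)

lemma height_pos: "height E x > 0"
  unfolding height_def using finite_reachable[of x] by (auto simp: card_gt_0_iff)

lemma height_eq_1_iff: "height E x = 1 \<longleftrightarrow> x \<notin> Domain E"
proof
  assume *: "height E x = 1"
  show "x \<notin> Domain E"
  proof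
    assume "x \<in> Domain E"
    then obtain y where "(x, y) \<in> E" by blast
    then show False using * height_child[of x y] height_pos[of y] by simp
  qed
qed (rule height_root)

text \<open>
  Iterating the first linking condition. In this way two nodes of a hyperedge are brought to equal
  depth without leaving the hyperedge.
\<close>

lemma linked_climb:
  assumes "linked E h" "y \<in> h"
  shows "x \<in> h \<Longrightarrow> height E y < height E x \<Longrightarrow> \<exists>w\<in>h. (x, w) \<in> E\<^sup>+ \<and> height E w = height E y"
proof (induction "height E x" arbitrary: x rule: less_induct)
  case less
  then obtain z where z: "z \<in> h" "(x, z) \<in> E" using assms unfolding linked_def by blast
  note hz = height_child[OF z(2)]
  show ?case
  proof (cases "height E y < height E z")
    case True
    then obtain w where "w \<in> h" "(z, w) \<in> E\<^sup>+" "height E w = height E y"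
      using less.hyps[of z] hz z(1) by auto
    then show ?thesis using z(2) by (meson trancl_into_trancl2)
  next
    case False
    then have "height E z = height E y" using less.prems(2) hz by simp
    then show ?thesis using z by blast
  qed
qed

lemma trancl_reach_card:
  assumes "(x, y) \<in> E\<^sup>+" "x \<in> A"
  shows "card (E\<^sup>* `` {y} \<inter> A) < card (E\<^sup>* `` {x} \<inter> A)"
proof (rule psubset_card_mono)
  have "E\<^sup>* `` {y} \<subseteq> E\<^sup>* `` {x}" using assms(1) by (auto dest: trancl_into_rtrancl)
  moreover have "x \<in> E\<^sup>* `` {x} \<inter> A" using assms(2) by simp
  ultimately show "E\<^sup>* `` {y} \<inter> A \<subset> E\<^sup>* `` {x} \<inter> A" using trancl_reaches[OF assms(1)] by blast
qed (use finite_reachable in simp)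

lemma parent_reach_card:
  assumes "(x, y) \<in> E" "x \<in> A"
  shows "card (E\<^sup>* `` {x} \<inter> A) = Suc (card (E\<^sup>* `` {y} \<inter> A))"
  using node_reaches[OF assms(1)] assms(2) finite_reachable by simp

lemma restrict_reach_up:
  assumes "\<And>x y. (x, y) \<in> E \<Longrightarrow> x \<in> A \<Longrightarrow> y \<in> A" "x \<in> A"
  shows "(E \<inter> A \<times> A)\<^sup>* `` {x} = E\<^sup>* `` {x}"
proof -
  have "(x, z) \<in> (E \<inter> A \<times> A)\<^sup>*" if "(x, z) \<in> E\<^sup>*" for z
    using that assms(2)
  proof (induction rule: converse_rtrancl_induct)
    case (step u v)
    then show ?case using assms(1)[of u v] by (auto intro: converse_rtrancl_into_rtrancl)
  qed simp
  moreover have "(E \<inter> A \<times> A)\<^sup>* \<subseteq> E\<^sup>*" by (rule rtrancl_mono) auto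
  ultimately show ?thesis by blast
qed

lemma restrict_reach_down:
  assumes down: "\<And>x y. (x, y) \<in> E \<Longrightarrow> y \<in> A \<Longrightarrow> x \<in> A" and "x \<in> A"
  shows "(E \<inter> A \<times> A)\<^sup>* `` {x} = E\<^sup>* `` {x} \<inter> A"
proof -
  have 1: "(x, z) \<in> (E \<inter> A \<times> A)\<^sup>*" if "(x, z) \<in> E\<^sup>*" "z \<in> A" for z
    using that
  proof (induction rule: rtrancl_induct)
    case (step u v)
    then show ?case using down[of u v] by (auto intro: rtrancl_into_rtrancl)
  qed simp
  have "(E \<inter> A \<times> A)\<^sup>* \<subseteq> E\<^sup>*" by (rule rtrancl_mono) auto
  moreover have "z \<in> A" if "(x, z) \<in> (E \<inter> A \<times> A)\<^sup>*" for z
    using that assms(2) by (cases rule: rtranclE) auto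
  ultimately show ?thesis using 1 by blast
qed

lemma restrict: "A \<subseteq> N \<Longrightarrow> parent_forest A (E \<inter> A \<times> A)"
  using finite_nodes parent_unique edges_wf
  by unfold_locales (auto intro: finite_subset wf_subset simp: single_valued_def)

lemma linked_restrict_up:
  assumes up: "\<And>x y. (x, y) \<in> E \<Longrightarrow> x \<in> A \<Longrightarrow> y \<in> A" and h: "linked E h"
  shows "linked (E \<inter> A \<times> A) (h \<inter> A)"
proof -
  have d: "height (E \<inter> A \<times> A) x = height E x" if "x \<in> A" for x
    using restrict_reach_up[OF up that] by (simp add: height_def)
  show ?thesis
    unfolding linked_def
  proof (intro conjI ballI allI impI)
    fix x y
    assume *: "x \<in> h \<inter> A" "y \<in> h \<inter> A" "height (E \<inter> A \<times> A) x < height (E \<inter> A \<times> A) y"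
    then have "x \<in> h" "y \<in> h" "height E x < height E y" using d by simp_all
    then obtain z where "z \<in> h" "(y, z) \<in> E" using h unfolding linked_def by blast
    then show "\<exists>z\<in>h \<inter> A. (y, z) \<in> E \<inter> A \<times> A" using up[of y z] *(2) by blast
  next
    fix x1 y1 x2 y2
    assume *: "x1 \<in> h \<inter> A" "y1 \<in> h \<inter> A"
      "height (E \<inter> A \<times> A) x1 = height (E \<inter> A \<times> A) y1 \<and> (x1, x2) \<in> E \<inter> A \<times> A \<and>
       (y1, y2) \<in> E \<inter> A \<times> A \<and> x2 \<noteq> y2"
    then have "x1 \<in> h" "y1 \<in> h" "height E x1 = height E y1" "(x1, x2) \<in> E" "(y1, y2) \<in> E" "x2 \<noteq> y2"
      using d by simp_all
    then have "x2 \<in> h \<and> y2 \<in> h" using h unfolding linked_def by blast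
    then show "x2 \<in> h \<inter> A" "y2 \<in> h \<inter> A" using * by simp_all
  qed
qed

text \<open>
  Cutting off an ancestor-closed set shortens the walks to the roots by amounts that differ from
  branch to branch, so that nodes of a hyperedge may be ordered differently by the depth in the
  remaining forest \<open>A\<close>. If the order changes, the nodes are first brought to equal depth in the
  whole forest by climbing inside the hyperedge; then the second linking condition applies unless
  both have the same parent, and this is excluded by counting the ancestors that lie in \<open>A\<close>.
\<close>

lemma linked_restrict_down:
  assumes down: "\<And>x y. (x, y) \<in> E \<Longrightarrow> y \<in> A \<Longrightarrow> x \<in> A" and h: "linked E h"
  shows "linked (E \<inter> A \<times> A) (h \<inter> A)"
proof -
  let ?d = "\<lambda>x. card (E\<^sup>* `` {x} \<inter> A)"
  have d: "height (E \<inter> A \<times> A) x = ?d x" if "x \<in> A" for x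
    using restrict_reach_down[OF down that] by (simp add: height_def)
  have reach_down: "x \<in> A" if "(x, z) \<in> E\<^sup>*" "z \<in> A" for x z
    using that by (induction rule: converse_rtrancl_induct) (auto intro: down)
  have h1: "\<exists>z\<in>h. (y, z) \<in> E" if "x \<in> h" "y \<in> h" "height E x < height E y" for x y
    using h that unfolding linked_def by blast
  have h2: "x2 \<in> h" "y2 \<in> h" if "x1 \<in> h" "y1 \<in> h" "height E x1 = height E y1" "(x1, x2) \<in> E"
    "(y1, y2) \<in> E" "x2 \<noteq> y2" for x1 x2 y1 y2
    using h that unfolding linked_def by blast+
  have first: "\<exists>z\<in>h \<inter> A. (y, z) \<in> E \<inter> A \<times> A"
    if x: "x \<in> h" "x \<in> A" and y: "y \<in> h" "y \<in> A" and xy: "?d x < ?d y" for x y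
  proof -
    have dx: "?d x \<ge> 1" using x(2) finite_reachable[of x] by (auto simp: Suc_le_eq card_gt_0_iff)
    have "y \<in> Domain E"
    proof (rule ccontr)
      assume "y \<notin> Domain E"
      then have "?d y = 1" using y root_reaches by simp
      then show False using xy dx by simp
    qed
    then obtain z where z: "(y, z) \<in> E" by blast
    have dz: "?d y = Suc (?d z)" by (rule parent_reach_card[OF z y(2)])
    have "z \<in> A"
    proof (rule ccontr)
      assume "z \<notin> A"
      then have "E\<^sup>* `` {z} \<inter> A = {}" using reach_down by blast
      then show False using xy dx dz by simp
    qed
    moreover have "z \<in> h"
    proof (cases "height E x < height E y")
      case True
      then show ?thesis using h1[OF x(1) y(1)] z parent_unique by (auto dest: single_valuedD)
    next
      case False
      then obtain w where w: "w \<in> h" "(x, w) \<in> E\<^sup>*" "height E w = height E y"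
        using linked_climb[OF h y(1) x(1)] x(1)
        by (cases "height E x = height E y") (auto dest: trancl_into_rtrancl)
      obtain v where v: "(w, v) \<in> E"
        using w(3) height_eq_1_iff[of w] height_eq_1_iff[of y] z by auto
      have "v \<noteq> z"
      proof
        assume "v = z"
        then have "(x, z) \<in> E\<^sup>+" using w v by (auto intro: rtrancl_into_trancl1)
        then show False using trancl_reach_card[of x z A] x xy dz by simp
      qed
      then show ?thesis using h2(2)[OF w(1) y(1) w(3) v z] by simp
    qed
    ultimately show ?thesis using z y by blast
  qed
  have second: "x2 \<in> h"
    if x: "x1 \<in> h" "x1 \<in> A" and y: "y1 \<in> h" "y1 \<in> A" and xy: "?d x1 = ?d y1"
      and x2: "(x1, x2) \<in> E" "x2 \<in> A" and y2: "(y1, y2) \<in> E" "y2 \<in> A" and ne: "x2 \<noteq> y2" for x1 y1 x2 y2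
  proof -
    consider "height E x1 = height E y1" | "height E y1 < height E x1" | "height E x1 < height E y1"
      by linarith
    then show ?thesis
    proof cases
      case 1
      then show ?thesis using h2[OF x(1) y(1) 1 x2(1) y2(1) ne] by simp
    next
      case 2
      then show ?thesis using h1[OF y(1) x(1)] x2(1) parent_unique by (auto dest: single_valuedD)
    next
      case 3
      then obtain w where w: "w \<in> h" "(y1, w) \<in> E\<^sup>+" "height E w = height E x1"
        using linked_climb[OF h x(1) y(1)] by blast
      obtain v where v: "(w, v) \<in> E"
        using w(3) height_eq_1_iff[of w] height_eq_1_iff[of x1] x2 by auto
      have "v \<noteq> x2"
      proof
        assume "v = x2"
        then have wx: "(w, x2) \<in> E" using v by simp
        then have "w \<in> A" using down x2(2) by blast
        then have "?d w = ?d x1"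
          using parent_reach_card[OF wx] parent_reach_card[OF x2(1) x(2)] by simp
        then show False using trancl_reach_card[OF w(2) y(2)] xy by simp
      qed
      then show ?thesis using h2(2)[OF w(1) x(1) w(3) v x2(1)] by simp
    qed
  qed
  show ?thesis
    unfolding linked_def
  proof (intro conjI ballI allI impI)
    fix x y
    assume "x \<in> h \<inter> A" "y \<in> h \<inter> A" "height (E \<inter> A \<times> A) x < height (E \<inter> A \<times> A) y"
    then show "\<exists>z\<in>h \<inter> A. (y, z) \<in> E \<inter> A \<times> A" using first[of x y] d by simp
  next
    fix x1 y1 x2 y2
    assume *: "x1 \<in> h \<inter> A" "y1 \<in> h \<inter> A"
      "height (E \<inter> A \<times> A) x1 = height (E \<inter> A \<times> A) y1 \<and> (x1, x2) \<in> E \<inter> A \<times> A \<and>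
       (y1, y2) \<in> E \<inter> A \<times> A \<and> x2 \<noteq> y2"
    show "x2 \<in> h \<inter> A" using second[of x1 y1 x2 y2] * d by simp
    show "y2 \<in> h \<inter> A" using second[of y1 x1 y2 x2] * d by simp
  qed
qed

end

lemma lions_forest_iff:
  "lions_forest T \<longleftrightarrow> nodes T \<noteq> {} \<and> parent_forest (nodes T) (edges T) \<and> tagged T \<subseteq> nodes T \<and>
     partition_on (nodes T - tagged T) (hyper T) \<and>
     (tagged T \<noteq> {} \<longrightarrow> (\<exists>x\<in>tagged T. x \<notin> Domain (edges T))) \<and>
     (\<forall>h\<in>hyper' T. linked (edges T) h)"
proof (cases "nodes T \<noteq> {} \<and> parent_forest (nodes T) (edges T) \<and> tagged T \<subseteq> nodes T \<and>
    partition_on (nodes T - tagged T) (hyper T)")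
  case False
  then show ?thesis unfolding lions_forest_def parent_forest_iff by blast
next
  case True
  then interpret parent_forest "nodes T" "edges T" by blast
  have d: "depth T x = height (edges T) x" if "x \<in> nodes T" for x
    using depth_eq_height parent_forest_axioms that by blast
  have "(\<forall>y\<in>nodes T. depth T x \<le> depth T y) \<longleftrightarrow> x \<notin> Domain (edges T)" if x: "x \<in> tagged T" for x
  proof
    assume *: "\<forall>y\<in>nodes T. depth T x \<le> depth T y"
    obtain r where "(x, r) \<in> (edges T)\<^sup>*" and r: "r \<notin> Domain (edges T)" using reaches_root by blast
    then have "r \<in> nodes T" using reachable_nodes[of x] x True by blast
    then have "height (edges T) x \<le> 1" using bspec[OF *, of r] d[of r] d[of x] x
        subsetD[of "tagged T" "nodes T" x] True height_root[OF r]
      by simp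
    then show "x \<notin> Domain (edges T)" using height_pos[of x] height_eq_1_iff[of x] by simp
  next
    assume "x \<notin> Domain (edges T)"
    then have "height (edges T) x = 1" by (rule height_root)
    moreover have "1 \<le> height (edges T) y" for y using height_pos[of y] by simp
    ultimately show "\<forall>y\<in>nodes T. depth T x \<le> depth T y"
      using d x True by (metis subsetD)
  qed
  then have tag: "(\<exists>x\<in>tagged T. \<forall>y\<in>nodes T. depth T x \<le> depth T y) \<longleftrightarrow> (\<exists>x\<in>tagged T. x \<notin> Domain (edges T))"
    by blast
  have "linked (edges T) h \<longleftrightarrow>
     (\<forall>x\<in>h. \<forall>y\<in>h. depth T x < depth T y \<longrightarrow> (\<exists>z\<in>h. (y, z) \<in> edges T)) \<and>
     (\<forall>x1\<in>h. \<forall>y1\<in>h. \<forall>x2 y2. depth T x1 = depth T y1 \<and> (x1, x2) \<in> edges T \<and>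
        (y1, y2) \<in> edges T \<and> x2 \<noteq> y2 \<longrightarrow> x2 \<in> h \<and> y2 \<in> h)" if h: "h \<in> hyper' T" for h
  proof -
    have "h \<subseteq> nodes T" using h True by (auto simp: hyper'_def partition_on_def)
    then have "height (edges T) x = depth T x" if "x \<in> h" for x using that d by (simp add: subset_iff)
    then show ?thesis by (simp add: linked_def cong: ball_cong)
  qed
  then have lnk: "(\<forall>h\<in>hyper' T. linked (edges T) h) \<longleftrightarrow>
     (\<forall>h\<in>hyper' T. \<forall>x\<in>h. \<forall>y\<in>h. depth T x < depth T y \<longrightarrow> (\<exists>z\<in>h. (y, z) \<in> edges T)) \<and>
     (\<forall>h\<in>hyper' T. \<forall>x1\<in>h. \<forall>y1\<in>h. \<forall>x2 y2. depth T x1 = depth T y1 \<and> (x1, x2) \<in> edges T \<and>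
        (y1, y2) \<in> edges T \<and> x2 \<noteq> y2 \<longrightarrow> x2 \<in> h \<and> y2 \<in> h)"
    by (simp only: ball_conj_distrib cong: ball_cong)
  show ?thesis by (simp only: lions_forest_def parent_forest_iff tag lnk)
qed

lemma lions_forestE:
  assumes "lions_forest T"
  shows "nodes T \<noteq> {}" "parent_forest (nodes T) (edges T)" "tagged T \<subseteq> nodes T"
    "partition_on (nodes T - tagged T) (hyper T)"
    "tagged T \<noteq> {} \<Longrightarrow> \<exists>x\<in>tagged T. x \<notin> Domain (edges T)"
    "h \<in> hyper' T \<Longrightarrow> linked (edges T) h"
proof -
  note L = assms[unfolded lions_forest_iff]
  show "nodes T \<noteq> {}" "parent_forest (nodes T) (edges T)" "tagged T \<subseteq> nodes T"
    "partition_on (nodes T - tagged T) (hyper T)"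
    using L by - (elim conjE, assumption)+
  show "\<exists>x\<in>tagged T. x \<notin> Domain (edges T)" if "tagged T \<noteq> {}"
    using L that by (elim conjE) (erule (1) mp)
  show "linked (edges T) h" if "h \<in> hyper' T"
    using L that by (elim conjE) (erule (1) bspec)
qed

text \<open>
  Closed under parents or closed under children: the two kinds of pieces of a cut.
\<close>

definition edge_closed :: "(nat \<times> nat) set \<Rightarrow> nat set \<Rightarrow> bool" where
  "edge_closed E A \<longleftrightarrow> (\<forall>(x, y)\<in>E. x \<in> A \<longrightarrow> y \<in> A) \<or> (\<forall>(x, y)\<in>E. y \<in> A \<longrightarrow> x \<in> A)"

text \<open>
  Both pieces of a cut are Lions forests. For the condition on \<open>h\<^sub>0\<close>, a node of \<open>h\<^sub>0 \<inter> A\<close> of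
  minimal depth has no parent in \<open>A\<close>: unless it is a root of the whole forest, its parent is in
  \<open>h\<^sub>0\<close> because \<open>h\<^sub>0\<close> is linked and contains a root, and a parent in \<open>A\<close> would contradict
  minimality.
\<close>

lemma lions_subforest:
  assumes T: "lions_forest T" and A: "A \<subseteq> nodes T" "A \<noteq> {}" and cl: "edge_closed (edges T) A"
  shows "lions_forest (subforest T A)"
proof -
  note L = lions_forestE[OF T]
  interpret parent_forest "nodes T" "edges T" by (rule L(2))
  let ?E = "edges T \<inter> A \<times> A"
  have part: "partition_on (nodes T - tagged T) (hyper T)" by (rule L(4))
  have "partition_on (A - tagged T \<inter> A) ((\<lambda>h. h \<inter> A) ` hyper T - {{}})"
  proof (rule partition_onI)
    show "\<Union> ((\<lambda>h. h \<inter> A) ` hyper T - {{}}) = A - tagged T \<inter> A"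
    proof -
      have "\<Union> ((\<lambda>h. h \<inter> A) ` hyper T - {{}}) = \<Union> (hyper T) \<inter> A" by auto
      also have "\<dots> = A - tagged T \<inter> A"
        unfolding partition_onD1[OF part, symmetric] using A(1) by blast
      finally show ?thesis .
    qed
    fix p p' assume "p \<in> (\<lambda>h. h \<inter> A) ` hyper T - {{}}" "p' \<in> (\<lambda>h. h \<inter> A) ` hyper T - {{}}" "p \<noteq> p'"
    then show "disjnt p p'"
      using partition_onD2[OF part] by (auto simp: disjoint_def disjnt_def)
  qed auto
  moreover have "\<exists>x\<in>tagged T \<inter> A. x \<notin> Domain ?E" if ne: "tagged T \<inter> A \<noteq> {}"
  proof -
    obtain r where r: "r \<in> tagged T" "r \<notin> Domain (edges T)" using L(5) ne by blast
    have tag: "linked (edges T) (tagged T)" by (rule L(6)) (use ne in \<open>auto simp: hyper'_def\<close>)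
    obtain x where x: "x \<in> tagged T \<inter> A"
      and min: "\<And>y. y \<in> tagged T \<inter> A \<Longrightarrow> height (edges T) x \<le> height (edges T) y"
      using ex_has_least_nat[of "\<lambda>x. x \<in> tagged T \<inter> A" _ "height (edges T)"] ne by blast
    have "x \<notin> Domain ?E"
    proof
      assume "x \<in> Domain ?E"
      then obtain y where y: "(x, y) \<in> edges T" "y \<in> A" by blast
      have "height (edges T) r < height (edges T) x"
        using height_root[OF r(2)] height_child[OF y(1)] height_pos[of y] by simp
      then obtain z where "z \<in> tagged T" "(x, z) \<in> edges T"
        using tag r(1) x unfolding linked_def by blast
      then have "y \<in> tagged T" using single_valuedD[OF parent_unique y(1)] by blast
      then show False using min[of y] y(2) height_child[OF y(1)] by simp
    qed
    then show ?thesis using x by blast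
  qed
  moreover have "linked ?E k" if k: "k \<in> hyper' (subforest T A)" for k
  proof -
    obtain h where h: "h \<in> hyper' T" "k = h \<inter> A"
      using k by (auto simp: hyper'_def subforest_def)
    then have "linked (edges T) h" by (intro L(6))
    then show ?thesis
      using cl linked_restrict_up[of A h] linked_restrict_down[of A h] h(2)
      unfolding edge_closed_def by blast
  qed
  moreover have "parent_forest A ?E" by (rule restrict[OF A(1)])
  ultimately show ?thesis using A unfolding lions_forest_iff by (simp add: subforest_def)
qed

section \<open>Generation of Lions forests\<close>

lemma subforest_simps [simp]:
  "nodes (subforest T A) = A" "edges (subforest T A) = edges T \<inter> A \<times> A"
  "tagged (subforest T A) = tagged T \<inter> A" "hyper (subforest T A) = (\<lambda>h. h \<inter> A) ` hyper T - {{}}"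
  by (simp_all add: subforest_def)

lemma hyper_nonempty: "lions_forest T \<Longrightarrow> h \<in> hyper T \<Longrightarrow> h \<noteq> {}"
  using lions_forestE(4)[of T] by (auto simp: partition_on_def)

lemma root_exists:
  assumes "lions_forest T"
  shows "\<exists>r\<in>nodes T. r \<notin> Domain (edges T)"
proof -
  interpret parent_forest "nodes T" "edges T" by (rule lions_forestE(2)[OF assms])
  obtain x where x: "x \<in> nodes T" using lions_forestE(1)[OF assms] by blast
  obtain r where r: "(x, r) \<in> (edges T)\<^sup>*" "r \<notin> Domain (edges T)" using reaches_root by blast
  then have "r \<in> nodes T" using reachable_nodes[OF x] by blast
  then show ?thesis using r(2) by blast
qed

text \<open>
  A hyperedge that meets two different unions of trees contains a root from each of them: from one
  node on each side, climb towards the roots, always moving the deeper node, or both if the depths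
  agree; their parents then differ because they lie in different trees.
\<close>

lemma linked_roots:
  assumes pf: "parent_forest N E" and h: "linked E h"
    and A: "\<And>x y. (x, y) \<in> E \<Longrightarrow> x \<in> A \<longleftrightarrow> y \<in> A"
  shows "x \<in> h \<inter> A \<Longrightarrow> y \<in> h - A \<Longrightarrow> \<exists>r\<in>h \<inter> A. r \<notin> Domain E"
proof (induction "height E x + height E y" arbitrary: x y rule: less_induct)
  case less
  interpret parent_forest N E by (rule pf)
  have h1: "\<exists>z\<in>h. (y, z) \<in> E" if "x \<in> h" "y \<in> h" "height E x < height E y" for x y
    using h that unfolding linked_def by blast
  consider "height E x < height E y" | "height E y < height E x" | "height E x = height E y" by linarith
  then show ?case
  proof cases
    case 1
    then obtain z where z: "z \<in> h" "(y, z) \<in> E" using h1[of x y] less.prems by blast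
    then have "z \<in> h - A" using A less.prems by blast
    then show ?thesis using less.hyps[of x z] less.prems height_child[OF z(2)] by simp
  next
    case 2
    then obtain z where z: "z \<in> h" "(x, z) \<in> E" using h1[of y x] less.prems by blast
    then have "z \<in> h \<inter> A" using A less.prems by blast
    then show ?thesis using less.hyps[of z y] less.prems height_child[OF z(2)] by simp
  next
    case 3
    show ?thesis
    proof (cases "x \<in> Domain E")
      case True
      then obtain x' where x': "(x, x') \<in> E" by blast
      have "height E y \<noteq> 1" using 3 height_eq_1_iff[of x] True by simp
      then obtain y' where y': "(y, y') \<in> E" using height_eq_1_iff[of y] by blast
      have mem: "x' \<in> A" "y' \<notin> A" using A[OF x'] A[OF y'] less.prems by auto
      then have "x' \<noteq> y'" by blast
      then have "x' \<in> h" "y' \<in> h" using h 3 x' y' less.prems unfolding linked_def by blast+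
      then show ?thesis
        using less.hyps[of x' y'] mem height_child[OF x'] height_child[OF y'] by simp
    qed (use less.prems in blast)
  qed
qed

text \<open>
  If \<open>h\<^sub>0\<close> is empty, the hyperedge of some root can be turned into \<open>h\<^sub>0\<close>, and \<open>T\<close> is the
  decoupling of the result. Otherwise let \<open>r\<close> be a root in \<open>h\<^sub>0\<close> and \<open>A\<close> its tree. If \<open>A\<close> is
  everything, then \<open>T\<close> arises by rooting at \<open>r\<close>. If not, \<open>T\<close> is the product of its restrictions to
  \<open>A\<close> and to the other trees: a hyperedge in \<open>H\<close> meeting both would contain \<open>r\<close>, which belongs to
  \<open>h\<^sub>0\<close>.
\<close>

lemma lions_forest_cases:
  assumes T: "lions_forest T"
  obtains (single) n where "T = rooting n empty_forest"
    | (rooting) n T' where "T = rooting n T'" "lions_forest T'" "n \<notin> nodes T'"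
    | (join) T1 T2 where "T = join T1 T2" "lions_forest T1" "lions_forest T2"
        "nodes T1 \<inter> nodes T2 = {}"
    | (decouple) T' where "T = decouple T'" "lions_forest T'" "tagged T' \<noteq> {}" "tagged T = {}"
        "nodes T' = nodes T"
proof (cases "tagged T = {}")
  case True
  note L = lions_forestE[OF T]
  obtain r where r: "r \<in> nodes T" "r \<notin> Domain (edges T)" using root_exists[OF T] by blast
  then obtain h where h: "h \<in> hyper T" "r \<in> h" using True partition_onD1[OF L(4)] by auto
  let ?T = "Forest (nodes T) (edges T) h (hyper T - {h})"
  have hs: "hyper' ?T = hyper T" using h hyper_nonempty[OF T] by (auto simp: hyper'_def)
  have hT: "hyper' T = hyper T" using True hyper_nonempty[OF T] by (auto simp: hyper'_def)
  have "partition_on (nodes T - h) (hyper T - {h})"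
  proof (rule partition_onI)
    have dis: "disjnt h k" if "k \<in> hyper T" "k \<noteq> h" for k
      using partition_onD2[OF L(4)] h(1) that by (auto simp: disjoint_def disjnt_def)
    have "\<Union> (hyper T - {h}) = \<Union> (hyper T) - h"
      using dis by (auto simp: disjnt_iff)
    then show "\<Union> (hyper T - {h}) = nodes T - h"
      using partition_onD1[OF L(4)] True by simp
    fix k l assume "k \<in> hyper T - {h}" "l \<in> hyper T - {h}" "k \<noteq> l"
    then show "disjnt k l"
      using partition_onD2[OF L(4)] by (auto simp: disjoint_def disjnt_def)
  qed (use hyper_nonempty[OF T] in blast)
  moreover have "h \<subseteq> nodes T" using h partition_onD1[OF L(4)] by blast
  ultimately have "lions_forest ?T"
    unfolding lions_forest_iff hs using L(1,2) L(6)[unfolded hT] h(2) r(2) by auto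
  moreover have "decouple ?T = T"
    unfolding decouple_def hs using True by (cases T) simp
  ultimately show thesis using decouple[of ?T] h True by auto
next
  case False
  note L = lions_forestE[OF T]
  interpret parent_forest "nodes T" "edges T" by (rule L(2))
  obtain r where r: "r \<in> tagged T" "r \<notin> Domain (edges T)" using L(5) False by blast
  have rN: "r \<in> nodes T" using r L(3) by blast
  define A where "A = {x \<in> nodes T. (x, r) \<in> (edges T)\<^sup>*}"
  have A: "x \<in> A \<longleftrightarrow> y \<in> A" if xy: "(x, y) \<in> edges T" for x y
  proof -
    have "x \<noteq> r" using xy r(2) by blast
    then have "(x, r) \<in> (edges T)\<^sup>* \<longleftrightarrow> (y, r) \<in> (edges T)\<^sup>*"
      using node_reaches(1)[OF xy] by auto
    then show ?thesis using edges_subset xy by (auto simp: A_def)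
  qed
  have hN: "h \<subseteq> nodes T - tagged T" if "h \<in> hyper T" for h
    using that partition_onD1[OF L(4)] by blast
  show thesis
  proof (cases "A = nodes T")
    case False
    let ?B = "nodes T - A"
    have cl: "edge_closed (edges T) A" "edge_closed (edges T) ?B"
      using A edges_subset by (auto simp: edge_closed_def)
    have "A \<subseteq> nodes T" "A \<noteq> {}" "?B \<noteq> {}" using rN False by (auto simp: A_def)
    then have lf: "lions_forest (subforest T A)" "lions_forest (subforest T ?B)"
      using lions_subforest[OF T _ _ cl(1)] lions_subforest[OF T _ _ cl(2)] by auto
    have sep: "h \<subseteq> A \<or> h \<subseteq> ?B" if h: "h \<in> hyper T" for h
    proof (rule ccontr)
      assume "\<not> (h \<subseteq> A \<or> h \<subseteq> ?B)"
      then obtain x y where "x \<in> h \<inter> A" "y \<in> h - A" using hN[OF h] by blast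
      moreover have "linked (edges T) h" by (rule L(6)) (use h hyper_nonempty[OF T] in \<open>auto simp: hyper'_def\<close>)
      ultimately obtain s where s: "s \<in> h \<inter> A" "s \<notin> Domain (edges T)"
        using linked_roots[OF L(2) _ A] by blast
      then have "s = r" by (auto simp: A_def elim: converse_rtranclE)
      then show False using s(1) hN[OF h] r(1) by blast
    qed
    have "hyper (subforest T A) \<union> hyper (subforest T ?B) = hyper T"
    proof (intro equalityI subsetI)
      fix k assume "k \<in> hyper (subforest T A) \<union> hyper (subforest T ?B)"
      then obtain h where h: "h \<in> hyper T" "k = h \<inter> A \<or> k = h \<inter> ?B" "k \<noteq> {}" by auto
      then have "k = h" using sep[OF h(1)] by blast
      then show "k \<in> hyper T" using h by simp
    next
      fix h assume h: "h \<in> hyper T"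
      then have "h \<inter> A = h \<or> h \<inter> ?B = h" using sep[OF h] by blast
      then show "h \<in> hyper (subforest T A) \<union> hyper (subforest T ?B)"
        using h hyper_nonempty[OF T h] by (metis DiffI UnCI empty_iff imageI insertE subforest_simps(4))
    qed
    moreover have "edges (subforest T A) \<union> edges (subforest T ?B) = edges T"
      using A edges_subset by auto
    moreover have "tagged (subforest T A) \<union> tagged (subforest T ?B) = tagged T" "A \<union> ?B = nodes T"
      using L(3) by (auto simp: A_def)
    ultimately have "T = join (subforest T A) (subforest T ?B)"
      unfolding join_def by (cases T) (simp del: subforest_simps(2-4))
    then show thesis using join[OF _ lf] by simp
  next
    case True
    let ?B = "nodes T - {r}"
    have root: "is_root ?B (edges T \<inter> ?B \<times> ?B) x \<longleftrightarrow> (x, r) \<in> edges T" for x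
    proof
      assume x: "is_root ?B (edges T \<inter> ?B \<times> ?B) x"
      then have "x \<in> A" "x \<noteq> r" using True by (auto simp: is_root_def)
      then obtain z where z: "(x, z) \<in> edges T" by (auto simp: A_def elim: converse_rtranclE)
      then have "z = r" using x edges_subset by (auto simp: is_root_def)
      then show "(x, r) \<in> edges T" using z by simp
    next
      assume x: "(x, r) \<in> edges T"
      have "(x, z) \<notin> edges T" if "z \<noteq> r" for z
        using single_valuedD[OF parent_unique x] that by blast
      then show "is_root ?B (edges T \<inter> ?B \<times> ?B) x"
        using x edges_subset r(2) by (auto simp: is_root_def)
    qed
    have hs: "h \<inter> ?B = h" if "h \<in> hyper T" for h using hN[OF that] r by blast
    have "hyper (subforest T ?B) = hyper T"
      using hs hyper_nonempty[OF T] by (auto simp: image_iff)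
    moreover have "edges T \<inter> ?B \<times> ?B \<union> {(x, r) |x. (x, r) \<in> edges T} = edges T"
      using edges_subset r(2) by auto
    moreover have "insert r (tagged T \<inter> ?B) = tagged T" "insert r ?B = nodes T"
      using L(3) r(1) by auto
    ultimately have eq: "T = rooting r (subforest T ?B)"
      by (intro forest.expand) (simp add: rooting_def root del: subforest_simps(4))
    show thesis
    proof (cases "?B = {}")
      case True
      have "hyper T = {}"
      proof -
        have "h = {}" if "h \<in> hyper T" for h using hs[OF that] True by blast
        then show ?thesis using hyper_nonempty[OF T] by blast
      qed
      then have "subforest T ?B = empty_forest" unfolding True by (simp add: subforest_def empty_forest_def)
      then show thesis using eq single by simp
    next
      case False
      have "edge_closed (edges T) ?B" using edges_subset r(2) by (auto simp: edge_closed_def)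
      then have "lions_forest (subforest T ?B)" using lions_subforest[OF T _ False] by blast
      then show thesis using rooting[OF eq] by simp
    qed
  qed
qed

lemma lions_forest_induct [consumes 1, case_names single rooting join decouple]:
  assumes "lions_forest T"
    and single: "\<And>n. P (rooting n empty_forest)"
    and rooting: "\<And>n T. lions_forest T \<Longrightarrow> n \<notin> nodes T \<Longrightarrow> P T \<Longrightarrow> P (rooting n T)"
    and join: "\<And>T1 T2. lions_forest T1 \<Longrightarrow> lions_forest T2 \<Longrightarrow> nodes T1 \<inter> nodes T2 = {} \<Longrightarrow>
      P T1 \<Longrightarrow> P T2 \<Longrightarrow> P (join T1 T2)"
    and decouple: "\<And>T. lions_forest T \<Longrightarrow> tagged T \<noteq> {} \<Longrightarrow> P T \<Longrightarrow> P (decouple T)"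
  shows "P T"
  using assms(1)
proof (induction "2 * card (nodes T) + (if tagged T = {} then 1 else 0)" arbitrary: T rule: less_induct)
  case less
  note fin = parent_forest.finite_nodes[OF lions_forestE(2)]
  have fT: "finite (nodes T)" by (rule fin[OF less.prems])
  from less.prems show ?case
  proof (cases rule: lions_forest_cases)
    case (single n)
    then show ?thesis using assms(2) by simp
  next
    case (rooting n T')
    then have "card (nodes T) = Suc (card (nodes T'))" using fin[of T'] by (simp add: rooting_def)
    then show ?thesis using less.hyps[of T'] rooting assms(3) by simp
  next
    case (join T1 T2)
    have "card (nodes T) = card (nodes T1) + card (nodes T2)"
      using join fin[of T1] fin[of T2] by (simp add: join_def card_Un_disjoint)
    moreover have "card (nodes T1) > 0" "card (nodes T2) > 0"
      using lions_forestE(1)[of T1] lions_forestE(1)[of T2] fin[of T1] fin[of T2] join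
      by (auto simp: card_gt_0_iff)
    ultimately show ?thesis using less.hyps[of T1] less.hyps[of T2] join assms(4) by simp
  next
    case (decouple T')
    then show ?thesis using less.hyps[of T'] assms(5) by simp
  qed
qed

section \<open>Uniqueness of the iterated integrals\<close>

lemma iterated_integralsD:
  assumes J: "iterated_integrals \<Omega> J" and st: "s \<in> {0..1}" "t \<in> {0..1}" and x: "x \<in> \<Omega>"
  shows
    "\<lbrakk>y \<in> hyper empty_forest \<rightarrow>\<^sub>E \<Omega>; i \<in> multi_index empty_forest\<rbrakk> \<Longrightarrow> J s t empty_forest x y i = 1"
    "\<lbrakk>y \<in> hyper (rooting n empty_forest) \<rightarrow>\<^sub>E \<Omega>; i \<in> multi_index (rooting n empty_forest)\<rbrakk> \<Longrightarrow>
      J s t (rooting n empty_forest) x y i = (c1_fun x t - c1_fun x s) $ i n"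
    "\<lbrakk>lions_forest T; inj_on \<pi> (nodes T); y \<in> hyper (relabel \<pi> T) \<rightarrow>\<^sub>E \<Omega>; i \<in> multi_index (relabel \<pi> T)\<rbrakk> \<Longrightarrow>
      J s t (relabel \<pi> T) x y i = J s t T x (\<lambda>h\<in>hyper T. y (\<pi> ` h)) (\<lambda>n\<in>nodes T. i (\<pi> n))"
    "\<lbrakk>lions_forest T1; lions_forest T2; nodes T1 \<inter> nodes T2 = {};
      y \<in> hyper (join T1 T2) \<rightarrow>\<^sub>E \<Omega>; i \<in> multi_index (join T1 T2)\<rbrakk> \<Longrightarrow>
      J s t (join T1 T2) x y i = J s t T1 x (restrict y (hyper T1)) (restrict i (nodes T1)) *
        J s t T2 x (restrict y (hyper T2)) (restrict i (nodes T2))"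
    "\<lbrakk>lions_forest T; tagged T \<noteq> {}; y \<in> hyper (decouple T) \<rightarrow>\<^sub>E \<Omega>; i \<in> multi_index (decouple T)\<rbrakk> \<Longrightarrow>
      J s t (decouple T) x y i = J s t T (y (tagged T)) (restrict y (hyper T)) i"
    "\<lbrakk>lions_forest T; n \<notin> nodes T; y \<in> hyper (rooting n T) \<rightarrow>\<^sub>E \<Omega>; i \<in> multi_index (rooting n T)\<rbrakk> \<Longrightarrow>
      J s t (rooting n T) x y i =
        (LBINT r=s..t. J s r T x y (restrict i (nodes T)) * c1_deriv x r $ i n)"
proof -
  note D = bspec[OF bspec[OF bspec[OF J[unfolded iterated_integrals_def] st(1)] st(2)] x]
  show "J s t empty_forest x y i = 1"
    if "y \<in> hyper empty_forest \<rightarrow>\<^sub>E \<Omega>" "i \<in> multi_index empty_forest"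
    by (rule D[THEN conjunct1, rule_format, OF that])
  show "J s t (rooting n empty_forest) x y i = (c1_fun x t - c1_fun x s) $ i n"
    if "y \<in> hyper (rooting n empty_forest) \<rightarrow>\<^sub>E \<Omega>" "i \<in> multi_index (rooting n empty_forest)"
    by (rule D[THEN conjunct2, THEN conjunct1, rule_format, OF that])
  show "J s t (relabel \<pi> T) x y i = J s t T x (\<lambda>h\<in>hyper T. y (\<pi> ` h)) (\<lambda>n\<in>nodes T. i (\<pi> n))"
    if "lions_forest T" "inj_on \<pi> (nodes T)" "y \<in> hyper (relabel \<pi> T) \<rightarrow>\<^sub>E \<Omega>" "i \<in> multi_index (relabel \<pi> T)"
    by (rule D[THEN conjunct2, THEN conjunct2, THEN conjunct1, rule_format, OF conjI[OF that(1,2)] that(3,4)])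
  show "J s t (join T1 T2) x y i = J s t T1 x (restrict y (hyper T1)) (restrict i (nodes T1)) *
      J s t T2 x (restrict y (hyper T2)) (restrict i (nodes T2))"
    if "lions_forest T1" "lions_forest T2" "nodes T1 \<inter> nodes T2 = {}"
      "y \<in> hyper (join T1 T2) \<rightarrow>\<^sub>E \<Omega>" "i \<in> multi_index (join T1 T2)"
    by (rule D[THEN conjunct2, THEN conjunct2, THEN conjunct2, THEN conjunct1, rule_format,
          OF conjI[OF that(1) conjI[OF that(2,3)]] that(4,5)])
  show "J s t (decouple T) x y i = J s t T (y (tagged T)) (restrict y (hyper T)) i"
    if "lions_forest T" "tagged T \<noteq> {}" "y \<in> hyper (decouple T) \<rightarrow>\<^sub>E \<Omega>" "i \<in> multi_index (decouple T)"
    by (rule D[THEN conjunct2, THEN conjunct2, THEN conjunct2, THEN conjunct2, THEN conjunct1, rule_format,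
          OF conjI[OF that(1,2)] that(3,4)])
  show "J s t (rooting n T) x y i =
      (LBINT r=s..t. J s r T x y (restrict i (nodes T)) * c1_deriv x r $ i n)"
    if "lions_forest T" "n \<notin> nodes T" "y \<in> hyper (rooting n T) \<rightarrow>\<^sub>E \<Omega>" "i \<in> multi_index (rooting n T)"
    by (rule D[THEN conjunct2, THEN conjunct2, THEN conjunct2, THEN conjunct2, THEN conjunct2, rule_format,
          OF conjI[OF that(1,2)] that(3,4)])
qed

lemma restrict_UNIV_PiE: "restrict i A \<in> A \<rightarrow>\<^sub>E UNIV"
  by auto

text \<open>
  The defining equations have only one solution on Lions forests, because every Lions forest is
  generated by the operations in them. Hence Chen's relation, the estimates and measurability need
  to be proved for the explicit family only.
\<close>

lemma iterated_integrals_explicit: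
  assumes J: "iterated_integrals \<Omega> J" and "lions_forest T"
  shows "\<lbrakk>s \<in> {0..1}; t \<in> {0..1}; x \<in> \<Omega>; y \<in> hyper T \<rightarrow>\<^sub>E \<Omega>; i \<in> multi_index T\<rbrakk> \<Longrightarrow>
    J s t T x y i = explicit_integral s t T x y i"
  using assms(2)
proof (induction T arbitrary: s t x y i rule: lions_forest_induct)
  case (single n)
  have "J s t (rooting n empty_forest) x y i = (c1_fun x t - c1_fun x s) $ i n"
    by (rule iterated_integralsD(2)[OF J single])
  then show ?case using explicit_single[OF single(1,2)] by metis
next
  case (rooting n T)
  have hy: "hyper (rooting n T) = hyper T" and nd: "nodes (rooting n T) = insert n (nodes T)"
    by (simp_all add: rooting_def)
  have "J s t (rooting n T) x y i =
    (LBINT r=s..t. J s r T x y (restrict i (nodes T)) * c1_deriv x r $ i n)"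
    by (rule iterated_integralsD(6)[OF J rooting.prems(1-3) rooting(1,2) rooting.prems(4,5)])
  also have "\<dots> = (LBINT r=s..t. explicit_integral s r T x y (restrict i (nodes T)) * c1_deriv x r $ i n)"
  proof (rule interval_integral_cong)
    fix r assume "r \<in> einterval (min (ereal s) (ereal t)) (max (ereal s) (ereal t))"
    then have "r \<in> {0..1}"
      using rooting.prems(1,2) by (auto simp: einterval_def min_def max_def split: if_splits)
    moreover have "restrict i (nodes T) \<in> multi_index T" by simp
    ultimately show "J s r T x y (restrict i (nodes T)) * c1_deriv x r $ i n =
      explicit_integral s r T x y (restrict i (nodes T)) * c1_deriv x r $ i n"
      using rooting.IH rooting.prems unfolding hy by simp
  qed
  also have "\<dots> = explicit_integral s t (rooting n T) x y i"
    by (rule explicit_rooting[OF rooting(1,2), symmetric])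
  finally show ?case .
next
  case (join T1 T2)
  have hy: "hyper (join T1 T2) = hyper T1 \<union> hyper T2" by (simp add: join_def)
  have y: "restrict y (hyper T1) \<in> hyper T1 \<rightarrow>\<^sub>E \<Omega>" "restrict y (hyper T2) \<in> hyper T2 \<rightarrow>\<^sub>E \<Omega>"
    using join.prems(4) unfolding hy by auto
  have "J s t (join T1 T2) x y i = J s t T1 x (restrict y (hyper T1)) (restrict i (nodes T1)) *
     J s t T2 x (restrict y (hyper T2)) (restrict i (nodes T2))"
    by (rule iterated_integralsD(4)[OF J join.prems(1-3) join(1-3) join.prems(4,5)])
  also have "\<dots> = explicit_integral s t T1 x (restrict y (hyper T1)) (restrict i (nodes T1)) *
     explicit_integral s t T2 x (restrict y (hyper T2)) (restrict i (nodes T2))"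
    by (intro arg_cong2[where f = "(*)"] join.IH join.prems(1-3) y restrict_UNIV_PiE)
  finally show ?case unfolding explicit_join[OF join(1-3)] .
next
  case (decouple T)
  have hy: "hyper (decouple T) = insert (tagged T) (hyper T)"
    using decouple(2) hyper_nonempty[OF decouple(1)] by (auto simp: decouple_def hyper'_def)
  have nd: "nodes (decouple T) = nodes T" by (simp add: decouple_def)
  have y: "y (tagged T) \<in> \<Omega>" "restrict y (hyper T) \<in> hyper T \<rightarrow>\<^sub>E \<Omega>"
    using decouple.prems(4) unfolding hy by auto
  have "J s t (decouple T) x y i = J s t T (y (tagged T)) (restrict y (hyper T)) i"
    by (rule iterated_integralsD(5)[OF J decouple.prems(1-3) decouple(1,2) decouple.prems(4,5)])
  also have "\<dots> = explicit_integral s t T (y (tagged T)) (restrict y (hyper T)) i"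
    by (rule decouple.IH[OF decouple.prems(1,2) y decouple.prems(5)[unfolded nd]])
  finally show ?case unfolding explicit_decouple[OF decouple(1,2)] .
qed

section \<open>Integrals over sets of nodes and Chen's relation\<close>

lemma norm_c1_deriv_le: "r \<in> {0..1} \<Longrightarrow> norm (c1_deriv x r) \<le> norm x"
  using cSUP_upper[OF _ bdd_above_c1_deriv, of r x] by (simp add: norm_c1_path_def add_increasing)

text \<open>
  The iterated integral over the forest induced on an arbitrary set \<open>A\<close> of nodes, for a fixed
  choice \<open>c\<close> of a path at every node. Allowing arbitrary \<open>A\<close> makes it possible to remove a root,
  and to treat all cuts with the same edges and paths.
\<close>

definition cut_integral ::
  "(nat \<times> nat) set \<Rightarrow> (nat \<Rightarrow> 'd::finite c1_path) \<Rightarrow> (nat \<Rightarrow> 'd) \<Rightarrow> real \<Rightarrow> real \<Rightarrow> nat set \<Rightarrow> real" where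
  "cut_integral E c i s t A = (\<Prod>n\<in>A - Domain (E \<inter> A \<times> A). node_integral (E \<inter> A \<times> A) c i s n t)"

lemma node_integral_deriv:
  assumes wf: "wf E" and s: "s \<in> {0..1}"
  shows "t \<in> {0..1} \<Longrightarrow> (node_integral E c i s n has_field_derivative
    (\<Prod>m\<in>{m. (m, n) \<in> E}. node_integral E c i s m t) * c1_deriv (c n) t $ i n) (at t within {0..1})"
  using wf
proof (induction n arbitrary: t rule: wf_induct_rule)
  case (less n)
  let ?f = "\<lambda>r. (\<Prod>m\<in>{m. (m, n) \<in> E}. node_integral E c i s m r) * c1_deriv (c n) r $ i n"
  have "continuous_on {0..1} (node_integral E c i s m)" if "(m, n) \<in> E" for m
    using less.IH[OF that] by (intro DERIV_continuous_on) blast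
  then have "continuous_on {0..1} ?f"
    by (intro continuous_intros continuous_on_c1_deriv) auto
  then have "((\<lambda>t. LBINT r=s..t. ?f r) has_vector_derivative ?f t) (at t within {0..1})"
    using interval_integral_FTC2[of 0 s 1 ?f t] s less.prems by simp
  moreover have "node_integral E c i s n = (\<lambda>t. LBINT r=s..t. ?f r)"
    by (rule ext) (rule node_integral_unfold[OF wf])
  ultimately show ?case by (simp add: has_real_derivative_iff_has_vector_derivative)
qed

lemma has_field_derivative_prod_within:
  fixes f :: "'a \<Rightarrow> 'b::real_normed_field \<Rightarrow> 'b"
  assumes "\<And>x. x \<in> A \<Longrightarrow> (f x has_field_derivative f' x) (at z within S)"
  shows "((\<lambda>u. \<Prod>x\<in>A. f x u) has_field_derivative (\<Sum>x\<in>A. f' x * (\<Prod>y\<in>A - {x}. f y z))) (at z within S)"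
  using assms
proof (induction A rule: infinite_finite_induct)
  case (insert x A)
  have eq: "insert x A - {y} = insert x (A - {y})" if "y \<in> A" for y
    using insert.hyps that by auto
  show ?case
    using insert.hyps
    by (auto intro!: derivative_eq_intros insert.prems insert.IH sum.cong
             simp: sum_distrib_left sum_distrib_right eq)
qed auto

text \<open>
  The differential equation that carries the analytic part. Differentiating the factor of a root
  \<open>n\<close> in the product over the roots replaces it by the product over the children of \<open>n\<close>, and these
  are exactly the roots that appear when \<open>n\<close> is removed.
\<close>

lemma cut_integral_deriv:
  assumes E: "wf E" "single_valued E" and A: "finite A" and st: "s \<in> {0..1}" "t \<in> {0..1}"
  shows "((\<lambda>t. cut_integral E c i s t A) has_field_derivative
    (\<Sum>n\<in>A - Domain (E \<inter> A \<times> A). cut_integral E c i s t (A - {n}) * c1_deriv (c n) t $ i n))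
      (at t within {0..1})"
proof -
  let ?E = "E \<inter> A \<times> A" and ?R = "A - Domain (E \<inter> A \<times> A)"
  let ?ch = "\<lambda>n. {m. (m, n) \<in> E \<inter> A \<times> A}"
  have wf: "wf ?E" using E(1) by (rule wf_subset) auto
  have step: "(\<Prod>m\<in>?ch n. node_integral ?E c i s m t) * c1_deriv (c n) t $ i n *
      (\<Prod>m\<in>?R - {n}. node_integral ?E c i s m t) =
    cut_integral E c i s t (A - {n}) * c1_deriv (c n) t $ i n" if n: "n \<in> ?R" for n
  proof -
    let ?B = "A - {n}"
    let ?F = "E \<inter> ?B \<times> ?B"
    have wfF: "wf ?F" using E(1) by (rule wf_subset) auto
    have ch: "{m. (m, id k) \<in> ?E} = id ` {m. (m, k) \<in> ?F}" if "k \<in> ?B" for k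
      using n that by auto
    have sub: "?F \<subseteq> ?B \<times> ?B" by blast
    have eq: "node_integral ?F c i s m t = node_integral ?E c i s m t" if "m \<in> ?B" for m
    proof -
      have "node_integral ?E c i s (id m) t = node_integral ?F c i s m t"
        by (rule node_integral_transfer[OF wfF wf inj_on_id sub ch]) (simp_all add: that[simplified])
      then show ?thesis by simp
    qed
    have roots: "?B - Domain ?F = (?R - {n}) \<union> ?ch n"
    proof
      show "?B - Domain ?F \<subseteq> (?R - {n}) \<union> ?ch n" by auto
      have "(m, n) \<in> E \<Longrightarrow> (m, k) \<in> E \<Longrightarrow> k = n" for m k
        using E(2) by (auto dest: single_valuedD)
      then show "(?R - {n}) \<union> ?ch n \<subseteq> ?B - Domain ?F"
        using n E(1) by (auto dest: wf_irrefl)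
    qed
    have "cut_integral E c i s t ?B = (\<Prod>m\<in>?B - Domain ?F. node_integral ?E c i s m t)"
      unfolding cut_integral_def
    proof (rule prod.cong[OF refl])
      fix m assume "m \<in> ?B - Domain ?F"
      then show "node_integral ?F c i s m t = node_integral ?E c i s m t" by (intro eq) (rule DiffD1)
    qed
    also have "\<dots> = (\<Prod>m\<in>(?R - {n}) \<union> ?ch n. node_integral ?E c i s m t)"
      by (simp only: roots)
    also have "\<dots> = (\<Prod>m\<in>?R - {n}. node_integral ?E c i s m t) * (\<Prod>m\<in>?ch n. node_integral ?E c i s m t)"
    proof (rule prod.union_disjoint)
      show "finite (?ch n)" using A by (rule rev_finite_subset) auto
    qed (use A in auto)
    finally show ?thesis by simp
  qed
  show ?thesis
    unfolding cut_integral_def[of E c i s _ A]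
    by (rule DERIV_cong[OF has_field_derivative_prod_within[OF node_integral_deriv[OF wf st]]
          sum.cong[OF refl step]])
qed

lemma cut_integral_same:
  assumes "wf E" "finite A"
  shows "cut_integral E c i s s A = (if A = {} then 1 else 0)"
proof (cases "A = {}")
  case False
  let ?E = "E \<inter> A \<times> A"
  have wf: "wf ?E" using assms(1) by (rule wf_subset) auto
  have "finite ?E" using assms(2) by auto
  then have "wf (?E\<inverse>)" using finite_acyclic_wf_converse wf_acyclic[OF wf] by blast
  moreover obtain x where "x \<in> A" using False by blast
  ultimately obtain n where n: "n \<in> A" "\<And>m. (m, n) \<in> ?E\<inverse> \<Longrightarrow> m \<notin> A" using wfE_min by metis
  then have "n \<in> A - Domain ?E" by blast
  moreover have "node_integral ?E c i s n s = 0" by (subst node_integral_unfold[OF wf]) simp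
  ultimately show ?thesis
    using assms(2) False unfolding cut_integral_def by (auto intro!: prod_zero)
qed (simp add: cut_integral_def)


text \<open>
  By induction on the number of nodes, the differential equation bounds the derivative, and the
  mean value theorem gains one factor \<open>\<bar>t - s\<bar>\<close>. The factorial comes from summing over at most
  \<open>card A\<close> roots in each step.
\<close>

lemma cut_integral_bound:
  assumes E: "wf E" "single_valued E" and s: "s \<in> {0..1}"
  shows "finite A \<Longrightarrow> t \<in> {0..1} \<Longrightarrow>
    \<bar>cut_integral E c i s t A\<bar> \<le> fact (card A) * \<bar>t - s\<bar> ^ card A * (\<Prod>n\<in>A. norm (c n))"
proof (induction "card A" arbitrary: A t)
  case 0
  then have "A = {}" by simp
  then show ?case by (simp add: cut_integral_def)
next
  case (Suc k)
  let ?R = "A - Domain (E \<inter> A \<times> A)" and ?P = "\<Prod>n\<in>A. norm (c n)"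
  let ?S = "closed_segment s t"
  have S: "?S \<subseteq> {0..1}" using closed_segment_subset[of s "{0..1}" t] s Suc.prems(2) by auto
  define f' where "f' u = (\<Sum>n\<in>?R. cut_integral E c i s u (A - {n}) * c1_deriv (c n) u $ i n)" for u
  have bound: "norm (f' u) \<le> fact (Suc k) * \<bar>t - s\<bar> ^ k * ?P" if u: "u \<in> ?S" for u
  proof -
    have u1: "u \<in> {0..1}" using u S by blast
    have us: "\<bar>u - s\<bar> \<le> \<bar>t - s\<bar>" using u by (auto simp: closed_segment_eq_real_ivl split: if_splits)
    have "norm (f' u) \<le> (\<Sum>n\<in>?R. \<bar>cut_integral E c i s u (A - {n}) * c1_deriv (c n) u $ i n\<bar>)"
      unfolding f'_def real_norm_def by (rule sum_abs)
    also have "\<dots> \<le> (\<Sum>n\<in>?R. fact k * \<bar>t - s\<bar> ^ k * ?P)"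
    proof (rule sum_mono)
      fix n assume n: "n \<in> ?R"
      have card: "card (A - {n}) = k" using n Suc.hyps(2) by simp
      have "\<bar>cut_integral E c i s u (A - {n})\<bar> \<le> fact k * \<bar>u - s\<bar> ^ k * (\<Prod>m\<in>A - {n}. norm (c m))"
        using Suc.hyps(1)[of "A - {n}" u] Suc.prems(1) u1 card by simp
      also have "\<dots> \<le> fact k * \<bar>t - s\<bar> ^ k * (\<Prod>m\<in>A - {n}. norm (c m))"
        by (intro mult_right_mono mult_left_mono power_mono us prod_nonneg) auto
      finally have "\<bar>cut_integral E c i s u (A - {n})\<bar> * \<bar>c1_deriv (c n) u $ i n\<bar> \<le>
        (fact k * \<bar>t - s\<bar> ^ k * (\<Prod>m\<in>A - {n}. norm (c m))) * norm (c n)"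
        using order_trans[OF component_le_norm_cart norm_c1_deriv_le[OF u1]]
        by (intro mult_mono) (auto intro!: mult_nonneg_nonneg prod_nonneg)
      also have "\<dots> = fact k * \<bar>t - s\<bar> ^ k * ?P"
        using n Suc.prems(1) by (simp add: prod.remove[of A n] mult_ac)
      finally show "\<bar>cut_integral E c i s u (A - {n}) * c1_deriv (c n) u $ i n\<bar> \<le> fact k * \<bar>t - s\<bar> ^ k * ?P"
        by (simp add: abs_mult)
    qed
    also have "\<dots> = real (card ?R) * (fact k * \<bar>t - s\<bar> ^ k * ?P)" by simp
    also have "\<dots> \<le> real (Suc k) * (fact k * \<bar>t - s\<bar> ^ k * ?P)"
      using card_mono[of A ?R] Suc.hyps(2) Suc.prems(1)
      by (intro mult_right_mono) (auto intro!: mult_nonneg_nonneg prod_nonneg)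
    finally show ?thesis by (simp add: mult_ac)
  qed
  have "norm (cut_integral E c i s t A - cut_integral E c i s s A) \<le>
    (fact (Suc k) * \<bar>t - s\<bar> ^ k * ?P) * norm (t - s)"
  proof (rule field_differentiable_bound)
    fix z assume z: "z \<in> ?S"
    show "((\<lambda>t. cut_integral E c i s t A) has_field_derivative f' z) (at z within ?S)"
      unfolding f'_def
      by (rule DERIV_subset[OF cut_integral_deriv[OF E Suc.prems(1) s] S]) (use z S in blast)
  qed (use bound in auto)
  moreover have "A \<noteq> {}" using Suc.hyps(2) by auto
  ultimately show ?case
    using cut_integral_same[OF E(1) Suc.prems(1), of c i s] Suc.hyps(2)[symmetric] by (simp add: mult_ac)
qed

text \<open>
  The sets \<open>R\<close> over which the convolution sums, for the forest induced on an arbitrary \<open>A\<close>, so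
  that roots of \<open>A\<close> can be removed in the induction.
\<close>

definition up_sets :: "(nat \<times> nat) set \<Rightarrow> nat set \<Rightarrow> nat set set" where
  "up_sets E A = {R. R \<subseteq> A \<and> (\<forall>x y. x \<in> R \<and> (x, y) \<in> E \<and> y \<in> A \<longrightarrow> y \<in> R)}"

lemma finite_up_sets: "finite A \<Longrightarrow> finite (up_sets E A)"
  by (rule finite_subset[of _ "Pow A"]) (auto simp: up_sets_def)

text \<open>
  As functions of the upper limit \<open>u\<close>, both sides satisfy the same differential equation and agree
  at \<open>u = t\<close>. For the left side, a term \<open>R\<close> contributes a sum over the roots of \<open>R\<close>; the pairs
  consisting of an ancestor-closed \<open>R\<close> and a root \<open>n\<close> in it correspond to the roots \<open>n\<close> together
  with the ancestor-closed subsets \<open>R - {n}\<close> of \<open>A - {n}\<close>, where the claim is known by induction.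
\<close>

lemma cut_integral_chen:
  assumes E: "wf E" "single_valued E" and s: "s \<in> {0..1}" and t: "t \<in> {0..1}"
  shows "finite A \<Longrightarrow> u \<in> {0..1} \<Longrightarrow>
    (\<Sum>R\<in>up_sets E A. cut_integral E c i s t (A - R) * cut_integral E c i t u R) = cut_integral E c i s u A"
proof (induction "card A" arbitrary: A u rule: less_induct)
  case less
  note fin = less.prems(1)
  let ?K = "cut_integral E c i"
  let ?rt = "\<lambda>R. R - Domain (E \<inter> R \<times> R)"
  let ?\<psi> = "\<lambda>A u. \<Sum>R\<in>up_sets E A. ?K s t (A - R) * ?K t u R"
  have finU: "finite (up_sets E A)" by (rule finite_up_sets[OF fin])
  have fin_up: "finite R" if "R \<in> up_sets E A" for R
    using that fin by (auto simp: up_sets_def intro: finite_subset)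
  have rt_up: "?rt R = ?rt A \<inter> R" if "R \<in> up_sets E A" for R
    using that by (auto simp: up_sets_def)
  have bij: "bij_betw (\<lambda>R. R - {n}) {R \<in> up_sets E A. n \<in> R} (up_sets E (A - {n}))" if n: "n \<in> ?rt A" for n
  proof (rule bij_betwI[where g = "insert n"])
    show "(\<lambda>R. R - {n}) \<in> {R \<in> up_sets E A. n \<in> R} \<rightarrow> up_sets E (A - {n})"
      by (auto simp: up_sets_def)
    show "insert n \<in> up_sets E (A - {n}) \<rightarrow> {R \<in> up_sets E A. n \<in> R}"
      using n by (auto simp: up_sets_def)
  qed (auto simp: up_sets_def)
  have deriv: "((\<lambda>u. ?\<psi> A u - ?K s u A) has_field_derivative 0) (at v within {0..1})" if v: "v \<in> {0..1}" for v
  proof -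
    have "((\<lambda>u. ?\<psi> A u) has_field_derivative
      (\<Sum>R\<in>up_sets E A. ?K s t (A - R) * (\<Sum>n\<in>?rt R. ?K t v (R - {n}) * c1_deriv (c n) v $ i n)))
      (at v within {0..1})"
      by (intro DERIV_sum DERIV_cmult cut_integral_deriv[OF E _ t v] fin_up)
    moreover have "(\<Sum>R\<in>up_sets E A. ?K s t (A - R) * (\<Sum>n\<in>?rt R. ?K t v (R - {n}) * c1_deriv (c n) v $ i n)) =
      (\<Sum>n\<in>?rt A. ?K s v (A - {n}) * c1_deriv (c n) v $ i n)"
    proof -
      have "(\<Sum>R\<in>up_sets E A. ?K s t (A - R) * (\<Sum>n\<in>?rt R. ?K t v (R - {n}) * c1_deriv (c n) v $ i n)) =
        (\<Sum>R\<in>up_sets E A. \<Sum>n | n \<in> ?rt A \<and> n \<in> R. ?K s t (A - R) * (?K t v (R - {n}) * c1_deriv (c n) v $ i n))"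
        using rt_up by (auto intro!: sum.cong simp: sum_distrib_left Int_def)
      also have "\<dots> = (\<Sum>n\<in>?rt A. \<Sum>R | R \<in> up_sets E A \<and> n \<in> R. ?K s t (A - R) * (?K t v (R - {n}) * c1_deriv (c n) v $ i n))"
        by (rule sum.swap_restrict) (use finU fin in auto)
      also have "\<dots> = (\<Sum>n\<in>?rt A. ?\<psi> (A - {n}) v * c1_deriv (c n) v $ i n)"
      proof (rule sum.cong[OF refl])
        fix n assume n: "n \<in> ?rt A"
        have "(\<Sum>R | R \<in> up_sets E A \<and> n \<in> R. ?K s t (A - R) * (?K t v (R - {n}) * c1_deriv (c n) v $ i n)) =
          (\<Sum>R | R \<in> up_sets E A \<and> n \<in> R. ?K s t (A - {n} - (R - {n})) * ?K t v (R - {n}) * c1_deriv (c n) v $ i n)"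
        proof (rule sum.cong[OF refl])
          fix R assume "R \<in> {R \<in> up_sets E A. n \<in> R}"
          then have "A - {n} - (R - {n}) = A - R" by auto
          then show "?K s t (A - R) * (?K t v (R - {n}) * c1_deriv (c n) v $ i n) =
            ?K s t (A - {n} - (R - {n})) * ?K t v (R - {n}) * c1_deriv (c n) v $ i n" by simp
        qed
        also have "\<dots> = (\<Sum>R\<in>up_sets E (A - {n}). ?K s t (A - {n} - R) * ?K t v R * c1_deriv (c n) v $ i n)"
          by (rule sum.reindex_bij_betw[OF bij[OF n]])
        finally show "(\<Sum>R | R \<in> up_sets E A \<and> n \<in> R. ?K s t (A - R) * (?K t v (R - {n}) * c1_deriv (c n) v $ i n)) =
          ?\<psi> (A - {n}) v * c1_deriv (c n) v $ i n"
          by (simp add: sum_distrib_right)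
      qed
      also have "\<dots> = (\<Sum>n\<in>?rt A. ?K s v (A - {n}) * c1_deriv (c n) v $ i n)"
      proof (rule sum.cong[OF refl])
        fix n assume "n \<in> ?rt A"
        then have "card (A - {n}) < card A" using fin by (meson DiffD1 card_Diff1_less)
        then show "?\<psi> (A - {n}) v * c1_deriv (c n) v $ i n = ?K s v (A - {n}) * c1_deriv (c n) v $ i n"
          using less.hyps[of "A - {n}" v] fin v by simp
      qed
      finally show ?thesis .
    qed
    ultimately have "((\<lambda>u. ?\<psi> A u) has_field_derivative
        (\<Sum>n\<in>?rt A. ?K s v (A - {n}) * c1_deriv (c n) v $ i n)) (at v within {0..1})"
      by (simp only:)
    from DERIV_diff[OF this cut_integral_deriv[OF E fin s v, of c i]] show ?thesis by simp
  qed
  \<comment> \<open>At the upper limit \<open>t\<close> only the cut \<open>R = {}\<close> survives.\<close>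
  then obtain k where k: "\<And>v. v \<in> {0..1} \<Longrightarrow> ?\<psi> A v - ?K s v A = k"
    using has_field_derivative_zero_constant[of "{0..1}" "\<lambda>u. ?\<psi> A u - ?K s u A"] by auto
  have "?\<psi> A t = (\<Sum>R\<in>up_sets E A. if R = {} then ?K s t A else 0)"
    by (rule sum.cong[OF refl]) (simp add: cut_integral_same[OF E(1) fin_up])
  also have "\<dots> = ?K s t A"
    using finU by (simp add: sum.delta up_sets_def)
  finally have "k = 0" using k[OF t] by simp
  then show ?case using k[OF less.prems(2)] by simp
qed

section \<open>Integrals over the pieces of a cut\<close>

lemma partition_unique:
  assumes "lions_forest T" "h \<in> hyper T" "k \<in> hyper T" "n \<in> h" "n \<in> k"
  shows "h = k"
  using the_hyper[OF assms(1,2,4)] the_hyper[OF assms(1,3,5)] by simp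

lemma the_coupled:
  assumes T: "lions_forest T" and h: "h \<in> hyper T" "n \<in> h \<inter> A"
  shows "(THE k. k \<in> hyper T \<and> k \<inter> A = h \<inter> A) = h"
proof (rule the_equality)
  fix k assume "k \<in> hyper T \<and> k \<inter> A = h \<inter> A"
  then have "k \<in> hyper T" "n \<in> k" using h(2) by auto
  then show "k = h" using partition_unique[OF T] h by blast
qed (use h in simp)

lemma coupled_hyper:
  assumes "lions_forest T" "h \<in> hyper T" "n \<in> h \<inter> A"
  shows "coupled T A y (h \<inter> A) = y h"
  using assms(2,3) the_coupled[OF assms] by (auto simp: coupled_def)

lemma coupled_PiE:
  assumes T: "lions_forest T" and y: "y \<in> hyper T \<rightarrow>\<^sub>E \<Omega>"
  shows "coupled T A y \<in> hyper (subforest T A) \<rightarrow>\<^sub>E \<Omega>"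
proof (rule PiE_I)
  fix k assume k: "k \<in> hyper (subforest T A)"
  then obtain h n where h: "h \<in> hyper T" "k = h \<inter> A" "n \<in> h \<inter> A" by auto
  show "coupled T A y k \<in> \<Omega>" using coupled_hyper[OF T h(1,3), of y] h(2) PiE_mem[OF y h(1)] by simp
qed (simp add: coupled_def del: subforest_simps(4))

text \<open>
  Identifying the variables of \<open>h \<inter> A\<close> and \<open>h\<close> means that a node carries the same path before and
  after a cut. This turns the convolution of families into the sum over cuts for a single
  colouring of the nodes by paths.
\<close>

lemma path_at_subforest:
  assumes T: "lions_forest T" and A: "A \<subseteq> nodes T" and n: "n \<in> A"
  shows "path_at (subforest T A) x (coupled T A y) n = path_at T x y n"
proof -
  have "n \<in> nodes T" using A n by blast
  with T show ?thesis
  proof (cases rule: hyper_cases)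
    case 1
    then show ?thesis using n by (simp add: path_at_def)
  next
    case (2 h)
    have "(THE k. k \<in> hyper (subforest T A) \<and> n \<in> k) = h \<inter> A"
    proof (rule the_equality)
      fix k assume "k \<in> hyper (subforest T A) \<and> n \<in> k"
      then obtain h' where "h' \<in> hyper T" "n \<in> h'" "k = h' \<inter> A" by auto
      then show "k = h \<inter> A" using partition_unique[OF T _ 2(1) _ 2(2)] by simp
    qed (use 2 n in auto)
    then have "path_at (subforest T A) x (coupled T A y) n = coupled T A y (h \<inter> A)"
      using 2(3) by (simp add: path_at_def del: subforest_simps(4))
    then show ?thesis using coupled_hyper[OF T 2(1), of n A y] path_at_hyper[OF T 2(1,2), of x y] 2(2) n by simp
  qed
qed

lemma explicit_subforest:
  assumes T: "lions_forest T" and A: "A \<subseteq> nodes T"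
  shows "explicit_integral s t (subforest T A) x (coupled T A y) (restrict i A) =
    cut_integral (edges T) (path_at T x y) i s t A"
proof -
  let ?E = "edges T \<inter> A \<times> A"
  have wf: "wf ?E" by (rule wf_subset[OF lions_forestD(1)[OF T]]) auto
  have "node_integral ?E (path_at T x y) i s (id n) t =
    node_integral ?E (path_at (subforest T A) x (coupled T A y)) (restrict i A) s n t" if n: "n \<in> A" for n
    by (rule node_integral_transfer[OF wf wf inj_on_id]) (use path_at_subforest[OF T A, of _ x y] n in auto)
  then show ?thesis
    unfolding explicit_integral_def cut_integral_def roots_eq subforest_simps
    by (intro prod.cong) auto
qed

lemma explicit_eq_cut_integral:
  assumes "lions_forest T"
  shows "explicit_integral s t T x y i = cut_integral (edges T) (path_at T x y) i s t (nodes T)"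
proof -
  have "edges T \<inter> nodes T \<times> nodes T = edges T" using lions_forestD(3)[OF assms] by blast
  then show ?thesis unfolding explicit_integral_def cut_integral_def roots_eq by simp
qed

lemma explicit_bound:
  assumes T: "lions_forest T" and st: "s \<in> {0..1}" "t \<in> {0..1}"
  shows "\<bar>explicit_integral s t T x y i\<bar> \<le> fact (card (nodes T)) * \<bar>t - s\<bar> ^ card (nodes T) *
    (norm x ^ card (tagged T) * (\<Prod>h\<in>hyper T. norm (y h) ^ card h))"
proof -
  note D = lions_forestD[OF T]
  interpret parent_forest "nodes T" "edges T" by (rule lions_forestE(2)[OF T])
  have un: "nodes T = tagged T \<union> \<Union> (hyper T)"
    using D(4) partition_onD1[OF D(5)] by blast
  have fin: "finite (tagged T)" "finite (\<Union> (hyper T))" "finite (hyper T)"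
    using D(2) unfolding un by (auto intro: finite_UnionD)
  have "(\<Prod>n\<in>nodes T. norm (path_at T x y n)) =
      (\<Prod>n\<in>tagged T. norm (path_at T x y n)) * (\<Prod>n\<in>\<Union> (hyper T). norm (path_at T x y n))"
    unfolding un using D(6) by (intro prod.union_disjoint fin) blast
  also have "(\<Prod>n\<in>tagged T. norm (path_at T x y n)) = norm x ^ card (tagged T)"
    by (simp add: path_at_def)
  also have "(\<Prod>n\<in>\<Union> (hyper T). norm (path_at T x y n)) = (\<Prod>h\<in>hyper T. \<Prod>n\<in>h. norm (path_at T x y n))"
    using fin(2,3) partition_unique[OF T] by (subst prod.Union_disjoint) (auto intro: finite_subset)
  also have "\<dots> = (\<Prod>h\<in>hyper T. norm (y h) ^ card h)"
    by (intro prod.cong) (simp_all add: path_at_hyper[OF T])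
  finally show ?thesis
    using cut_integral_bound[OF edges_wf parent_unique st(1) D(2) st(2), of "path_at T x y" i]
    unfolding explicit_eq_cut_integral[OF T] by simp
qed

lemma subforest_empty: "subforest T {} = empty_forest"
  by (auto simp: subforest_def empty_forest_def)

lemma subforest_in_forests0:
  assumes T: "T \<in> forests0 \<gamma> \<alpha> \<beta>" and ab: "\<alpha> > 0" "\<beta> > 0" and A: "A \<subseteq> nodes T" "edge_closed (edges T) A"
  shows "subforest T A \<in> forests0 \<gamma> \<alpha> \<beta>"
proof (cases "A = {}")
  case True
  then show ?thesis by (simp add: forests0_def subforest_empty)
next
  case False
  then have "T \<noteq> empty_forest" using A(1) by (auto simp: empty_forest_def)
  then have T': "lions_forest T" "grade \<alpha> \<beta> T \<le> \<gamma>" using T by (auto simp: forests0_def forests_def)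
  have fin: "finite (nodes T)" "finite (tagged T)"
    using lions_forestD(2,4)[OF T'(1)] finite_subset by auto
  have "\<alpha> * real (card (tagged T \<inter> A)) \<le> \<alpha> * real (card (tagged T))"
    using ab fin by (intro mult_left_mono) (auto intro: card_mono)
  moreover have "card (A - tagged T \<inter> A) \<le> card (nodes T - tagged T)"
    using A(1) fin by (intro card_mono) auto
  then have "\<beta> * real (card (A - tagged T \<inter> A)) \<le> \<beta> * real (card (nodes T - tagged T))"
    using ab by (intro mult_left_mono) auto
  ultimately have "grade \<alpha> \<beta> (subforest T A) \<le> \<gamma>" using T'(2) by (simp add: grade_def)
  then show ?thesis using lions_subforest[OF T'(1) A(1) False A(2)] by (simp add: forests0_def forests_def)
qed

lemma ancestor_closed_edge_closed:
  assumes "ancestor_closed T R" "edges T \<subseteq> nodes T \<times> nodes T"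
  shows "edge_closed (edges T) R" "edge_closed (edges T) (nodes T - R)"
proof -
  show "edge_closed (edges T) R" using assms(1) unfolding ancestor_closed_def edge_closed_def by blast
  show "edge_closed (edges T) (nodes T - R)" unfolding edge_closed_def
    by (rule disjI2) (use assms in \<open>auto simp: ancestor_closed_def\<close>)
qed

lemma ancestor_closed_up_sets:
  assumes "edges T \<subseteq> nodes T \<times> nodes T"
  shows "{R. ancestor_closed T R} = up_sets (edges T) (nodes T)"
  using assms unfolding ancestor_closed_def up_sets_def by blast

lemma explicit_chen:
  assumes T: "lions_forest T" and stu: "s \<in> {0..1}" "t \<in> {0..1}" "u \<in> {0..1}"
  shows "mv_conv (explicit_integral s t) (explicit_integral t u) T x y i = explicit_integral s u T x y i"
proof -
  interpret parent_forest "nodes T" "edges T" by (rule lions_forestE(2)[OF T])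
  have "mv_conv (explicit_integral s t) (explicit_integral t u) T x y i =
    (\<Sum>R\<in>up_sets (edges T) (nodes T). cut_integral (edges T) (path_at T x y) i s t (nodes T - R) *
       cut_integral (edges T) (path_at T x y) i t u R)"
    unfolding mv_conv_def ancestor_closed_up_sets[OF edges_subset]
    by (intro sum.cong refl arg_cong2[where f = "(*)"] explicit_subforest[OF T])
      (auto simp: up_sets_def)
  then show ?thesis
    using cut_integral_chen[OF edges_wf parent_unique stu(1,2) finite_nodes stu(3)]
    by (simp add: explicit_eq_cut_integral[OF T])
qed

section \<open>Measurable dependence on the paths\<close>

text \<open>
  An integrand that is measurable in the parameter and continuous in the variable of integration
  is jointly measurable, as the limit of its step function approximations in that variable. The
  dependence on the paths thus reduces to the evaluations of derivatives at single times, which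
  are continuous linear functionals.
\<close>

lemma measurable_interval_integral:
  fixes g :: "'a \<Rightarrow> real \<Rightarrow> real" and s t :: real
  assumes meas: "\<And>r. r \<in> {0..1} \<Longrightarrow> (\<lambda>\<omega>. g \<omega> r) \<in> borel_measurable P"
    and cont: "\<And>\<omega>. continuous_on {0..1} (g \<omega>)"
    and st: "s \<in> {0..1}" "t \<in> {0..1}"
  shows "(\<lambda>\<omega>. LBINT r=s..t. g \<omega> r) \<in> borel_measurable P"
proof -
  \<comment> \<open>The integrand at the grid point \<open>z / Suc j\<close>, set to zero outside of the unit interval.\<close>
  define G where "G j z \<omega> = (if 0 \<le> z \<and> z \<le> int (Suc j) then g \<omega> (real_of_int z / real (Suc j)) else 0)"
    for j z \<omega>
  have G [measurable]: "G j z \<in> borel_measurable P" for j z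
  proof (cases "0 \<le> z \<and> z \<le> int (Suc j)")
    case True
    then have "real_of_int z \<le> real_of_int (int (Suc j))" by linarith
    then have "real_of_int z / real (Suc j) \<in> {0..1}" using True by (simp add: divide_le_eq)
    then show ?thesis using meas True unfolding G_def by simp
  next
    case False
    then have "G j z = (\<lambda>_. 0)" unfolding G_def by (simp add: if_not_P)
    then show ?thesis by simp
  qed
  have joint: "(\<lambda>(\<omega>, r). indicator {0..1} r * g \<omega> r) \<in> borel_measurable (P \<Otimes>\<^sub>M lborel)"
  proof (rule borel_measurable_LIMSEQ_real)
    show "(\<lambda>(\<omega>, r). indicator {0..1} r * G j \<lfloor>real (Suc j) * r\<rfloor> \<omega>) \<in> borel_measurable (P \<Otimes>\<^sub>M lborel)" for j
    proof -
      have "(\<lambda>p. (\<lambda>z p. G j z (fst p)) \<lfloor>real (Suc j) * snd p\<rfloor> p) \<in> borel_measurable (P \<Otimes>\<^sub>M lborel)"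
        by (rule measurable_compose_countable) measurable
      then show ?thesis by (simp add: case_prod_beta)
    qed
    fix p :: "'a \<times> real"
    obtain \<omega> r where p: "p = (\<omega>, r)" by force
    show "(\<lambda>j. case p of (\<omega>, r) \<Rightarrow> indicator {0..1} r * G j \<lfloor>real (Suc j) * r\<rfloor> \<omega>)
        \<longlonglongrightarrow> (case p of (\<omega>, r) \<Rightarrow> indicator {0..1} r * g \<omega> r)"
    proof (cases "r \<in> {0..1}")
      case True
      let ?z = "\<lambda>j. real_of_int \<lfloor>real (Suc j) * r\<rfloor> / real (Suc j)"
      have z: "0 \<le> \<lfloor>real (Suc j) * r\<rfloor> \<and> \<lfloor>real (Suc j) * r\<rfloor> \<le> int (Suc j)" for j
      proof -
        have "real (Suc j) * r \<le> real (Suc j) * 1" using True by (intro mult_left_mono) auto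
        then have "\<lfloor>real (Suc j) * r\<rfloor> \<le> \<lfloor>real (Suc j)\<rfloor>" by (intro floor_mono) simp
        then show ?thesis using True by simp
      qed
      have z1: "?z j \<in> {0..1}" for j
      proof -
        have "real_of_int \<lfloor>real (Suc j) * r\<rfloor> \<le> real_of_int (int (Suc j))" using z[of j] by linarith
        then show ?thesis using z[of j] by (simp add: divide_le_eq)
      qed
      have "?z \<longlonglongrightarrow> r"
      proof (rule tendsto_sandwich)
        show "(\<lambda>j. r - 1 / real (Suc j)) \<longlonglongrightarrow> r"
          using tendsto_diff[OF tendsto_const LIMSEQ_inverse_real_of_nat, of r] by (simp add: inverse_eq_divide)
        show "\<forall>\<^sub>F j in sequentially. r - 1 / real (Suc j) \<le> ?z j"
        proof (intro always_eventually allI)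
          fix j
          have "real (Suc j) * r - 1 \<le> real_of_int \<lfloor>real (Suc j) * r\<rfloor>" by linarith
          then have "(real (Suc j) * r - 1) / real (Suc j) \<le> ?z j" by (intro divide_right_mono) auto
          then show "r - 1 / real (Suc j) \<le> ?z j" by (simp add: diff_divide_distrib)
        qed
        show "\<forall>\<^sub>F j in sequentially. ?z j \<le> r"
          by (intro always_eventually allI) (simp add: divide_le_eq mult.commute)
      qed simp
      then have "(\<lambda>j. g \<omega> (?z j)) \<longlonglongrightarrow> g \<omega> r"
        using continuous_on_tendsto_compose[OF cont[of \<omega>], of ?z r] True z1 by simp
      moreover have "indicator {0..1} r * G j \<lfloor>real (Suc j) * r\<rfloor> \<omega> = g \<omega> (?z j)" for j
        using True z[of j] by (simp add: G_def)
      ultimately show ?thesis using True by (simp add: p)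
    qed (simp add: p)
  qed
  have int: "(\<lambda>\<omega>. LINT r:einterval a b|lborel. g \<omega> r) \<in> borel_measurable P"
    if "einterval a b \<subseteq> {0..1}" for a b
  proof -
    have [measurable]: "einterval a b \<in> sets borel" by simp
    have "(\<lambda>\<omega>. LINT r|lborel. indicator (einterval a b) r * (indicator {0..1} r * g \<omega> r)) \<in> borel_measurable P"
      by (rule lborel.borel_measurable_lebesgue_integral) (use joint in measurable)
    moreover have "indicator (einterval a b) r * (indicator {0..1} r * g \<omega> r) =
      indicator (einterval a b) r *\<^sub>R g \<omega> r" for \<omega> r
      using that by (auto simp: indicator_def)
    ultimately show ?thesis unfolding set_lebesgue_integral_def by simp
  qed
  have "einterval s t \<subseteq> {0..1}" "einterval t s \<subseteq> {0..1}"
    using st by (auto simp: einterval_def)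
  note int[OF this(1)] int[OF this(2)]
  then show ?thesis
    unfolding interval_lebesgue_integral_def by (cases "ereal s \<le> ereal t") (simp_all add: if_not_P)
qed

lemma borel_measurable_c1_deriv:
  assumes r: "r \<in> {0..1}"
  shows "(\<lambda>x :: 'd::finite c1_path. c1_deriv x r $ k) \<in> borel_measurable borel"
proof (rule borel_measurable_continuous_onI)
  have add: "c1_deriv (x + y) r = c1_deriv x r + c1_deriv y r" for x y :: "'d c1_path"
    using r by (intro c1_deriv_unique)
      (auto simp: plus_c1_path.rep_eq intro!: has_vector_derivative_add c1_fun_has_deriv)
  have scale: "c1_deriv (a *\<^sub>R x) r = a *\<^sub>R c1_deriv x r" for a and x :: "'d c1_path"
    using r by (intro c1_deriv_unique)
      (auto simp: scaleR_c1_path.rep_eq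
        intro!: bounded_linear.has_vector_derivative[OF bounded_linear_scaleR_right] c1_fun_has_deriv)
  have "bounded_linear (\<lambda>x :: 'd c1_path. c1_deriv x r)"
    by (rule bounded_linear_intro[of _ 1]) (use add scale norm_c1_deriv_le[OF r] in simp_all)
  then have "continuous_on UNIV (\<lambda>x :: 'd c1_path. c1_deriv x r)"
    by (rule bounded_linear.continuous_on) simp
  then show "continuous_on UNIV (\<lambda>x :: 'd c1_path. c1_deriv x r $ k)"
    by (intro continuous_intros)
qed

lemma measurable_node_integral:
  assumes wf: "wf E" and c: "\<And>n. n \<in> N \<Longrightarrow> (\<lambda>\<omega>. c \<omega> n) \<in> borel_measurable P"
    and E: "E \<subseteq> N \<times> N" and s: "s \<in> {0..1}"
  shows "n \<in> N \<Longrightarrow> t \<in> {0..1} \<Longrightarrow> (\<lambda>\<omega>. node_integral E (c \<omega>) i s n t) \<in> borel_measurable P"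
  using wf
proof (induction n arbitrary: t rule: wf_induct_rule)
  case (less n)
  have "continuous_on {0..1} (node_integral E (c \<omega>) i s m)" for m \<omega>
    by (rule DERIV_continuous_on) (rule node_integral_deriv[OF wf s])
  then show ?case
    unfolding node_integral_unfold[OF wf, of _ i s n t]
  proof (intro measurable_interval_integral)
    fix r :: real assume r: "r \<in> {0..1}"
    have "(\<lambda>\<omega>. \<Prod>m\<in>{m. (m, n) \<in> E}. node_integral E (c \<omega>) i s m r) \<in> borel_measurable P"
      using less.IH[OF _ _ r] E by (intro borel_measurable_prod) auto
    moreover have "(\<lambda>\<omega>. c1_deriv (c \<omega> n) r $ i n) \<in> borel_measurable P"
      by (rule measurable_compose[OF c[OF less.prems(1)] borel_measurable_c1_deriv[OF r]])
    ultimately show "(\<lambda>\<omega>. (\<Prod>m\<in>{m. (m, n) \<in> E}. node_integral E (c \<omega>) i s m r) * c1_deriv (c \<omega> n) r $ i n)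
      \<in> borel_measurable P" by (rule borel_measurable_times)
  qed (use s less.prems in \<open>auto intro!: continuous_intros continuous_on_c1_deriv\<close>)
qed

lemma measurable_explicit:
  fixes M :: "'d::finite c1_path measure"
  assumes T: "lions_forest T" and M: "(\<lambda>x. x) \<in> borel_measurable M"
    and st: "s \<in> {0..1}" "t \<in> {0..1}"
  shows "(\<lambda>(x, y). explicit_integral s t T x y i) \<in> borel_measurable (M \<Otimes>\<^sub>M hyper_measure M T)"
proof -
  let ?P = "M \<Otimes>\<^sub>M hyper_measure M T"
  let ?c = "\<lambda>p. path_at T (fst p) (snd p)"
  have colour: "(\<lambda>p. ?c p n) \<in> borel_measurable ?P" if n: "n \<in> nodes T" for n
    using T n
  proof (cases rule: hyper_cases)
    case 1
    then show ?thesis using measurable_compose[OF measurable_fst M] by (simp add: path_at_def)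
  next
    case (2 h)
    have "(\<lambda>p. snd p h) \<in> measurable ?P M"
      by (rule measurable_compose[OF measurable_snd measurable_component_singleton[OF 2(1)]])
    from measurable_compose[OF this M] show ?thesis by (simp add: path_at_hyper[OF T 2(1,2)])
  qed
  have "(\<lambda>p. \<Prod>n\<in>{n. is_root (nodes T) (edges T) n}. node_integral (edges T) (?c p) i s n t)
      \<in> borel_measurable ?P"
    by (intro borel_measurable_prod measurable_node_integral[OF lions_forestD(1)[OF T] colour lions_forestD(3)[OF T]] st)
      (simp_all add: is_root_def)
  then show ?thesis unfolding explicit_integral_def by (simp add: case_prod_beta)
qed

section \<open>Mixed norms of products\<close>

lemma ennpowr_ennreal: "x \<ge> 0 \<Longrightarrow> ennpowr (ennreal x) a = ennreal (x powr a)"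
  by (simp add: ennpowr_def)

lemma ennpowr_mono:
  assumes "x \<le> y" "a \<ge> 0"
  shows "ennpowr x a \<le> ennpowr y a"
proof (cases "y = \<top>")
  case False
  then have "y < \<top>" by (simp add: less_top)
  moreover from this have "x < \<top>" using assms(1) by (rule le_less_trans[rotated])
  ultimately show ?thesis
    using assms enn2real_mono[OF assms(1)] by (auto simp: ennpowr_def intro!: ennreal_leI powr_mono2)
qed (simp add: ennpowr_def)

text \<open>
  A product of functions of the separate variables has a mixed norm that factorises, whatever the
  order of integration.
\<close>

lemma mixed_norm_product_bound:
  fixes M :: "'w measure" and q :: "'h \<Rightarrow> real" and g :: "'h \<Rightarrow> 'w \<Rightarrow> real" and C :: real
  assumes H: "finite H" and C: "C \<ge> 0" and g0: "\<And>h w. g h w \<ge> 0"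
    and g: "\<And>h. h \<in> H \<Longrightarrow> g h \<in> borel_measurable M" and q: "\<And>h. h \<in> H \<Longrightarrow> q h > 0"
    and K: "\<And>h. h \<in> H \<Longrightarrow> (\<integral>\<^sup>+w. ennreal (g h w powr q h) \<partial>M) = ennreal (K h)" "\<And>h. K h \<ge> 0"
    and F: "\<And>\<omega>. \<omega> \<in> H \<rightarrow>\<^sub>E space M \<Longrightarrow> F \<omega> \<le> ennreal (C * (\<Prod>h\<in>H. g h (\<omega> h)))"
  shows "distinct hs \<Longrightarrow> set hs \<subseteq> H \<Longrightarrow> \<omega> \<in> (H - set hs) \<rightarrow>\<^sub>E space M \<Longrightarrow>
    mixed_norm M q hs F \<omega> \<le>
      ennreal (C * (\<Prod>h\<in>H - set hs. g h (\<omega> h)) * (\<Prod>h\<in>set hs. K h powr (1 / q h)))"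
proof (induction hs arbitrary: \<omega>)
  case Nil
  then show ?case using F by simp
next
  case (Cons h hs)
  let ?S = "H - set (h # hs)"
  let ?Q = "\<Prod>k\<in>set hs. K k powr (1 / q k)"
  \<comment> \<open>The bound with the factor of the variable \<open>h\<close>, over which the outermost integral runs, split off.\<close>
  define a where "a = C * (\<Prod>k\<in>?S. g k (\<omega> k)) * ?Q"
  have h: "h \<in> H" "h \<notin> set hs" and a: "a \<ge> 0"
    using Cons.prems(1,2) C g0 by (auto simp: a_def intro!: mult_nonneg_nonneg prod_nonneg)
  have S: "H - set hs = insert h ?S" using h by auto
  have le: "mixed_norm M q hs F (fun_upd \<omega> h w) \<le> ennreal (a * g h w)"
    if w: "w \<in> space M" for w
  proof -
    have upd: "fun_upd \<omega> h w \<in> (H - set hs) \<rightarrow>\<^sub>E space M"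
      unfolding S using PiE_fun_upd[OF w Cons.prems(3)] by simp
    have "mixed_norm M q hs F (fun_upd \<omega> h w) \<le>
      ennreal (C * (\<Prod>k\<in>H - set hs. g k ((fun_upd \<omega> h w) k)) * ?Q)"
      by (rule Cons.IH[OF _ _ upd]) (use Cons.prems(1,2) in simp_all)
    moreover have "(\<Prod>k\<in>H - set hs. g k ((fun_upd \<omega> h w) k)) = g h w * (\<Prod>k\<in>?S. g k (\<omega> k))"
      unfolding S using H by (subst prod.insert) (auto intro!: prod.cong)
    then have "C * (\<Prod>k\<in>H - set hs. g k ((fun_upd \<omega> h w) k)) * ?Q = a * g h w"
      by (simp only: a_def mult_ac)
    ultimately show ?thesis by (simp only:)
  qed
  have "(\<integral>\<^sup>+w. ennpowr (mixed_norm M q hs F (fun_upd \<omega> h w)) (q h) \<partial>M) \<le>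
    (\<integral>\<^sup>+w. ennreal (a powr q h) * ennreal (g h w powr q h) \<partial>M)"
  proof (rule nn_integral_mono)
    fix w assume "w \<in> space M"
    then have "ennpowr (mixed_norm M q hs F (fun_upd \<omega> h w)) (q h) \<le> ennpowr (ennreal (a * g h w)) (q h)"
      using q[OF h(1)] by (intro ennpowr_mono le) auto
    also have "\<dots> = ennreal (a powr q h) * ennreal (g h w powr q h)"
      using a g0[of h w] by (simp add: ennpowr_ennreal powr_mult ennreal_mult[symmetric])
    finally show "ennpowr (mixed_norm M q hs F (fun_upd \<omega> h w)) (q h) \<le>
      ennreal (a powr q h) * ennreal (g h w powr q h)" .
  qed
  also have "\<dots> = ennreal (a powr q h * K h)"
    using g[OF h(1)] K(1)[OF h(1)] K(2)[of h] by (subst nn_integral_cmult) (auto simp: ennreal_mult[symmetric])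
  finally have "mixed_norm M q (h # hs) F \<omega> \<le> ennpowr (ennreal (a powr q h * K h)) (1 / q h)"
    using q[OF h(1)] by (simp add: ennpowr_mono)
  also have "\<dots> = ennreal ((a powr q h) powr (1 / q h) * K h powr (1 / q h))"
    using K(2)[of h] by (subst ennpowr_ennreal) (auto simp: powr_mult)
  also have "(a powr q h) powr (1 / q h) = a"
    using a q[OF h(1)] by (simp add: powr_powr)
  also have "a * K h powr (1 / q h) = C * (\<Prod>k\<in>?S. g k (\<omega> k)) * (\<Prod>k\<in>set (h # hs). K k powr (1 / q k))"
    using h(2) by (simp add: a_def mult_ac)
  finally show ?case .
qed

lemma power_powr_divide: "x \<ge> 0 \<Longrightarrow> n > 0 \<Longrightarrow> (x ^ n) powr (a / real n) = x powr a" for x a :: real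
  by (cases "x = 0") (auto simp: powr_realpow[symmetric] powr_powr)

section \<open>Convolution and its inverses\<close>

lemma subforest_nodes: "lions_forest T \<Longrightarrow> subforest T (nodes T) = T"
proof -
  assume T: "lions_forest T"
  note D = lions_forestD[OF T]
  have "h \<inter> nodes T = h" if "h \<in> hyper T" for h using D(6)[OF that] by blast
  then have "(\<lambda>h. h \<inter> nodes T) ` hyper T - {{}} = hyper T"
    using hyper_nonempty[OF T] by (auto simp: image_iff)
  moreover have "edges T \<inter> nodes T \<times> nodes T = edges T" "tagged T \<inter> nodes T = tagged T"
    using D(3,4) by auto
  ultimately show ?thesis unfolding subforest_def by (cases T) simp
qed

lemma coupled_nodes:
  assumes T: "lions_forest T" and y: "y \<in> hyper T \<rightarrow>\<^sub>E \<Omega>"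
  shows "coupled T (nodes T) y = y"
proof
  fix h
  show "coupled T (nodes T) y h = y h"
  proof (cases "h \<in> hyper T")
    case True
    then have hN: "h \<inter> nodes T = h" using lions_forestD(6)[OF T True] by blast
    obtain n where "n \<in> h" using hyper_nonempty[OF T True] by blast
    then show ?thesis using coupled_hyper[OF T True, of n "nodes T" y] unfolding hN by blast
  next
    case False
    then show ?thesis using y unfolding coupled_def subforest_nodes[OF T] by (auto simp: PiE_def extensional_def)
  qed
qed

lemma ancestor_closed_empty_forest: "{R. ancestor_closed empty_forest R} = {{}}"
  by (auto simp: ancestor_closed_def empty_forest_def)

lemma finite_ancestor_closed: "finite (nodes T) \<Longrightarrow> finite {R. ancestor_closed T R}"
  by (rule finite_subset[of _ "Pow (nodes T)"]) (auto simp: ancestor_closed_def)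

lemma forests0_cases:
  assumes "T \<in> forests0 \<gamma> \<alpha> \<beta>"
  obtains "T = empty_forest" | "lions_forest T" "T \<in> forests \<gamma> \<alpha> \<beta>"
  using assms by (auto simp: forests0_def forests_def)

lemma forests0_cut:
  assumes T: "T \<in> forests0 \<gamma> \<alpha> \<beta>" and ab: "\<alpha> > 0" "\<beta> > 0" and R: "ancestor_closed T R"
    and y: "y \<in> hyper T \<rightarrow>\<^sub>E \<Omega>" and A: "A = R \<or> A = nodes T - R"
  shows "subforest T A \<in> forests0 \<gamma> \<alpha> \<beta>" "coupled T A y \<in> hyper (subforest T A) \<rightarrow>\<^sub>E \<Omega>"
    "restrict i A \<in> multi_index (subforest T A)"
proof -
  have "subforest T A \<in> forests0 \<gamma> \<alpha> \<beta> \<and> coupled T A y \<in> hyper (subforest T A) \<rightarrow>\<^sub>E \<Omega>"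
    using T
  proof (cases rule: forests0_cases)
    case 1
    then have "R = {}" using R ancestor_closed_empty_forest by blast
    then have "A = {}" using A 1 by (auto simp: empty_forest_def)
    then show ?thesis using 1 by (auto simp: subforest_empty forests0_def coupled_def empty_forest_def)
  next
    case 2
    have "A \<subseteq> nodes T" using A R by (auto simp: ancestor_closed_def)
    moreover have "edge_closed (edges T) A"
      using A ancestor_closed_edge_closed[OF R lions_forestD(3)[OF 2(1)]] by blast
    ultimately show ?thesis using subforest_in_forests0[OF T ab] coupled_PiE[OF 2(1) y] by blast
  qed
  then show "subforest T A \<in> forests0 \<gamma> \<alpha> \<beta>" "coupled T A y \<in> hyper (subforest T A) \<rightarrow>\<^sub>E \<Omega>" by auto
  show "restrict i A \<in> multi_index (subforest T A)" by (simp add: restrict_UNIV_PiE del: restrict_PiE_iff)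
qed

lemma space_hyper_measure: "space (hyper_measure M T) = hyper T \<rightarrow>\<^sub>E space M"
  by (simp add: space_PiM)

lemma mv_conv_cong:
  assumes ab: "\<alpha> > 0" "\<beta> > 0" and f: "family_eq \<gamma> \<alpha> \<beta> M f f'" and g: "family_eq \<gamma> \<alpha> \<beta> M g g'"
  shows "family_eq \<gamma> \<alpha> \<beta> M (mv_conv f g) (mv_conv f' g')"
  unfolding family_eq_def mv_conv_def
proof (intro ballI sum.cong refl)
  fix T x y i R
  assume T: "T \<in> forests0 \<gamma> \<alpha> \<beta>" and x: "x \<in> space M" and y: "y \<in> space (hyper_measure M T)"
    and R: "R \<in> {R. ancestor_closed T R}"
  have R': "ancestor_closed T R" using R by simp
  note cut = forests0_cut[OF T ab R' y[unfolded space_hyper_measure]]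
  show "f (subforest T (nodes T - R)) x (coupled T (nodes T - R) y) (restrict i (nodes T - R)) *
      g (subforest T R) x (coupled T R y) (restrict i R) =
    f' (subforest T (nodes T - R)) x (coupled T (nodes T - R) y) (restrict i (nodes T - R)) *
      g' (subforest T R) x (coupled T R y) (restrict i R)"
    using f[unfolded family_eq_def space_hyper_measure, rule_format, OF cut(1) x cut(2) cut(3)]
      g[unfolded family_eq_def space_hyper_measure, rule_format, OF cut(1) x cut(2) cut(3)]
    by metis
qed

lemma family_eq_trans: "family_eq \<gamma> \<alpha> \<beta> M f g \<Longrightarrow> family_eq \<gamma> \<alpha> \<beta> M g h \<Longrightarrow> family_eq \<gamma> \<alpha> \<beta> M f h"
  by (simp add: family_eq_def)

lemma family_eq_sym: "family_eq \<gamma> \<alpha> \<beta> M f g \<Longrightarrow> family_eq \<gamma> \<alpha> \<beta> M g f"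
  by (simp add: family_eq_def)

lemma family_eq_ae: "family_eq \<gamma> \<alpha> \<beta> M f g \<Longrightarrow> family_ae_eq \<gamma> \<alpha> \<beta> M f g"
  unfolding family_eq_def family_ae_eq_def
  by (intro ballI AE_I2) (auto simp: space_pair_measure)

text \<open>
  Since \<open>\<langle>f, \<one>\<rangle> = 1\<close>, the cut \<open>R = {}\<close> contributes \<open>\<langle>g, T\<rangle>\<close> to \<open>\<langle>g * f, T\<rangle>\<close> and all other cuts
  involve \<open>g\<close> only on smaller forests, so \<open>g * f\<close> determines \<open>g\<close> pointwise, without exceptional
  null sets.
\<close>

lemma left_inverse_unique:
  assumes ab: "\<alpha> > 0" "\<beta> > 0"
    and f1: "\<And>x y i. x \<in> space M \<Longrightarrow> y \<in> space (hyper_measure M empty_forest) \<Longrightarrow>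
      i \<in> multi_index empty_forest \<Longrightarrow> f empty_forest x y i = 1"
    and g: "family_eq \<gamma> \<alpha> \<beta> M (mv_conv g f) (mv_conv g' f)"
  shows "family_eq \<gamma> \<alpha> \<beta> M g g'"
proof -
  have "\<lbrakk>T \<in> forests0 \<gamma> \<alpha> \<beta>; x \<in> space M; y \<in> hyper T \<rightarrow>\<^sub>E space M; i \<in> multi_index T\<rbrakk> \<Longrightarrow>
    g T x y i = g' T x y i" for T x y i
  proof (induction "card (nodes T)" arbitrary: T y i rule: less_induct)
    case less
    note T = less.prems(1) and x = less.prems(2) and y = less.prems(3) and i = less.prems(4)
    have fin: "finite (nodes T)"
      using T by (cases rule: forests0_cases) (auto simp: empty_forest_def dest: lions_forestD(2))
    have whole: "subforest T (nodes T) = T \<and> coupled T (nodes T) y = y"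
      using T
    proof (cases rule: forests0_cases)
      case 1
      then have "hyper T = {}" "nodes T = {}" by (simp_all add: empty_forest_def)
      then show ?thesis using y 1 by (auto simp: subforest_empty coupled_def)
    next
      case 2
      then show ?thesis using subforest_nodes coupled_nodes y by blast
    qed
    have ri: "restrict i (nodes T) = i" using i by (rule PiE_restrict)
    let ?t = "\<lambda>g R. g (subforest T (nodes T - R)) x (coupled T (nodes T - R) y) (restrict i (nodes T - R)) *
        f (subforest T R) x (coupled T R y) (restrict i R)"
    have finR: "finite {R. ancestor_closed T R}" by (rule finite_ancestor_closed[OF fin])
    have e: "{} \<in> {R. ancestor_closed T R}" by (simp add: ancestor_closed_def)
    have e': "ancestor_closed T {}" using e by simp
    have "f (subforest T {}) x (coupled T {} y) (restrict i {}) = 1"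
      unfolding subforest_empty
      by (rule f1[OF x forests0_cut(2)[OF T ab e' y disjI1[OF refl], folded space_hyper_measure,
              unfolded subforest_empty]
            forests0_cut(3)[OF T ab e' y disjI1[OF refl], unfolded subforest_empty]])
    then have t0: "?t g {} = g T x y i" for g using whole ri by simp
    have rest: "(\<Sum>R\<in>{R. ancestor_closed T R} - {{}}. ?t g R) = (\<Sum>R\<in>{R. ancestor_closed T R} - {{}}. ?t g' R)"
    proof (intro sum.cong refl arg_cong2[where f = "(*)"])
      fix R assume "R \<in> {R. ancestor_closed T R} - {{}}"
      then have R: "ancestor_closed T R" "R \<noteq> {}" by auto
      have "R \<subseteq> nodes T" using R(1) by (simp add: ancestor_closed_def)
      then have "card (nodes T - R) < card (nodes T)"
        using R(2) fin by (intro psubset_card_mono) auto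
      then show "g (subforest T (nodes T - R)) x (coupled T (nodes T - R) y) (restrict i (nodes T - R)) =
        g' (subforest T (nodes T - R)) x (coupled T (nodes T - R) y) (restrict i (nodes T - R))"
        using less.hyps forests0_cut[OF T ab R(1) y, of "nodes T - R"] x by simp
    qed
    have "mv_conv g f T x y i = mv_conv g' f T x y i"
      using g T x y i unfolding family_eq_def space_hyper_measure by blast
    then have "?t g {} + (\<Sum>R\<in>{R. ancestor_closed T R} - {{}}. ?t g R) =
      ?t g' {} + (\<Sum>R\<in>{R. ancestor_closed T R} - {{}}. ?t g' R)"
      unfolding mv_conv_def by (simp only: sum.remove[OF finR e])
    then show ?case unfolding t0 rest by simp
  qed
  then show ?thesis unfolding family_eq_def space_hyper_measure by blast
qed

section \<open>Comparing the grade with the number of nodes\<close>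

lemma parent_forest_no_edges: "finite N \<Longrightarrow> parent_forest N {}"
  by unfold_locales auto

lemma lions_forest_tagged_roots:
  assumes "finite N" "N \<noteq> {}"
  shows "lions_forest (Forest N {} N {})"
  using assms parent_forest_no_edges[OF assms(1)]
  by (auto simp: lions_forest_iff hyper'_def linked_def height_def partition_on_def)

lemma lions_forest_untagged_node: "lions_forest (Forest {n} {} {} {{n}})"
  using parent_forest_no_edges[of "{n}"]
  by (auto simp: lions_forest_iff hyper'_def linked_def height_def partition_on_def)

text \<open>
  The increments are of order \<open>\<bar>t - s\<bar>\<close> to the number of nodes, so this is what the regularity
  estimate needs. If \<open>\<alpha> > 1\<close>, all forests compete in the infimum, single nodes give \<open>\<gamma> \<le> min \<alpha> \<beta>\<close>,
  and the hypothesis on the floor is violated. Hence \<open>\<alpha> \<le> 1\<close>; then some multiple of \<open>\<alpha>\<close>, the grade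
  of that many tagged roots, lies in \<open>(1 - \<alpha>, 1]\<close>, and \<open>\<gamma> \<le> 1\<close>.
\<close>

lemma grade_le_card_nodes:
  assumes ab: "\<alpha> > 0" "\<beta> > 0"
    and \<gamma>: "\<gamma> = Inf {grade \<alpha> \<beta> T |T. lions_forest T \<and> grade \<alpha> \<beta> T > 1 - \<alpha>}"
    and fl: "\<lfloor>\<gamma> / min \<alpha> \<beta>\<rfloor> > 1"
    and T: "T \<in> forests \<gamma> \<alpha> \<beta>"
  shows "grade \<alpha> \<beta> T \<le> real (card (nodes T))"
proof -
  let ?S = "{grade \<alpha> \<beta> T |T. lions_forest T \<and> grade \<alpha> \<beta> T > 1 - \<alpha>}"
  have bdd: "bdd_below ?S" by (rule bdd_belowI[of _ "1 - \<alpha>"]) auto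
  have le: "\<gamma> \<le> grade \<alpha> \<beta> U" if "lions_forest U" "grade \<alpha> \<beta> U > 1 - \<alpha>" for U
    unfolding \<gamma> using that by (intro cInf_lower bdd) auto
  have "\<alpha> \<le> 1"
  proof (rule ccontr)
    assume "\<not> \<alpha> \<le> 1"
    then have "1 - \<alpha> < 0" by simp
    moreover have "grade \<alpha> \<beta> (Forest {0} {} {0} {}) = \<alpha>" "grade \<alpha> \<beta> (Forest {0} {} {} {{0}}) = \<beta>"
      by (simp_all add: grade_def)
    ultimately have "\<gamma> \<le> \<alpha>" "\<gamma> \<le> \<beta>"
      using le[OF lions_forest_tagged_roots[of "{0}"]] le[OF lions_forest_untagged_node[of 0]] ab by auto
    then have "\<gamma> / min \<alpha> \<beta> \<le> 1" using ab by (simp add: divide_le_eq)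
    then have "\<lfloor>\<gamma> / min \<alpha> \<beta>\<rfloor> \<le> 1" by linarith
    then show False using fl by simp
  qed
  \<comment> \<open>The largest number of tagged nodes whose grade does not exceed 1.\<close>
  define k where "k = nat \<lfloor>1 / \<alpha>\<rfloor>"
  have k: "real k \<le> 1 / \<alpha>" "1 / \<alpha> < real k + 1" and k1: "k \<ge> 1"
    using ab \<open>\<alpha> \<le> 1\<close> by (auto simp: k_def le_nat_iff le_floor_iff)
  have "\<alpha> * real k \<le> 1" "\<alpha> * real k > 1 - \<alpha>"
    using k ab by (auto simp: field_simps)
  moreover have "grade \<alpha> \<beta> (Forest {..<k} {} {..<k} {}) = \<alpha> * real k" by (simp add: grade_def)
  moreover have "lions_forest (Forest {..<k} {} {..<k} {})"
    using k1 by (intro lions_forest_tagged_roots) (auto simp: lessThan_empty_iff)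
  ultimately have "\<gamma> \<le> 1" using le[of "Forest {..<k} {} {..<k} {}"] by simp
  have "lions_forest T" "grade \<alpha> \<beta> T \<le> \<gamma>" using T by (auto simp: forests_def)
  moreover from this have "card (nodes T) > 0"
    using lions_forestD(2)[of T] lions_forestE(1)[of T] by (simp add: card_gt_0_iff)
  ultimately show ?thesis using \<open>\<gamma> \<le> 1\<close> by linarith
qed

lemma family_eq_refl: "family_eq \<gamma> \<alpha> \<beta> M f f"
  unfolding family_eq_def by blast

section \<open>The rough path above a law on path space\<close>

text \<open>
  The law \<open>M\<close> stands for \<open>\<mu>\<close> restricted to its support, and enters the estimates as a finite
  measure with finite moment of order \<open>q'\<close>. The last assumption is the consequence of the choice
  of \<open>\<gamma>\<close> proved above.
\<close>

locale lifted_law =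
  fixes M :: "'d::finite c1_path measure"
    and J :: "real \<Rightarrow> real \<Rightarrow> ('d c1_path, 'd) family"
    and q' \<gamma> \<alpha> \<beta> :: real and q :: "forest \<Rightarrow> nat set \<Rightarrow> real"
  assumes finite_law: "finite_measure M"
    and borel_law: "(\<lambda>x. x) \<in> borel_measurable M"
    and moment: "(\<integral>\<^sup>+x. ennreal (norm x powr q') \<partial>M) < \<infinity>"
    and alpha_pos: "\<alpha> > 0" and beta_pos: "\<beta> > 0"
    and J: "iterated_integrals (space M) J"
    and card_less: "T \<in> forests \<gamma> \<alpha> \<beta> \<Longrightarrow> real (card (nodes T)) < q'"
    and exponent: "T \<in> forests \<gamma> \<alpha> \<beta> \<Longrightarrow> h \<in> hyper T \<Longrightarrow> q T h = q' / real (card h)"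
    and grade_le: "T \<in> forests \<gamma> \<alpha> \<beta> \<Longrightarrow> grade \<alpha> \<beta> T \<le> real (card (nodes T))"
begin

lemma J_explicit:
  assumes T: "T \<in> forests0 \<gamma> \<alpha> \<beta>" and "s \<in> {0..1}" "t \<in> {0..1}" "x \<in> space M"
    "y \<in> hyper T \<rightarrow>\<^sub>E space M" "i \<in> multi_index T"
  shows "J s t T x y i = explicit_integral s t T x y i"
  using T
proof (cases rule: forests0_cases)
  case 1
  then show ?thesis using iterated_integralsD(1)[OF J] assms by (simp add: explicit_empty)
next
  case 2
  show ?thesis by (rule iterated_integrals_explicit[OF J 2(1)]) fact+
qed

lemma J_family_eq:
  "s \<in> {0..1} \<Longrightarrow> t \<in> {0..1} \<Longrightarrow> family_eq \<gamma> \<alpha> \<beta> M (J s t) (explicit_integral s t)"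
  unfolding family_eq_def space_hyper_measure using J_explicit by blast

lemma J_chen:
  assumes stu: "s \<in> {0..1}" "t \<in> {0..1}" "u \<in> {0..1}"
  shows "family_eq \<gamma> \<alpha> \<beta> M (mv_conv (J s t) (J t u)) (J s u)"
proof -
  have "mv_conv (explicit_integral s t) (explicit_integral t u) T x y i = explicit_integral s u T x y i"
    if "T \<in> forests0 \<gamma> \<alpha> \<beta>" for T x y and i :: "nat \<Rightarrow> 'd"
    using that
  proof (cases rule: forests0_cases)
    case 1
    have "nodes empty_forest = {}" by (simp add: empty_forest_def)
    then show ?thesis
      unfolding 1 mv_conv_def ancestor_closed_empty_forest
      by (simp add: subforest_empty explicit_empty)
  next
    case 2
    then show ?thesis by (intro explicit_chen stu)
  qed
  then have "family_eq \<gamma> \<alpha> \<beta> M (mv_conv (explicit_integral s t) (explicit_integral t u)) (explicit_integral s u)"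
    by (simp add: family_eq_def)
  moreover have "family_eq \<gamma> \<alpha> \<beta> M (mv_conv (J s t) (J t u)) (mv_conv (explicit_integral s t) (explicit_integral t u))"
    by (intro mv_conv_cong alpha_pos beta_pos J_family_eq stu)
  ultimately show ?thesis
    using family_eq_trans family_eq_trans[OF _ family_eq_sym[OF J_family_eq[OF stu(1,3)]]] by metis
qed

lemma J_unit:
  assumes s: "s \<in> {0..1}"
  shows "family_eq \<gamma> \<alpha> \<beta> M (J s s) mv_unit"
proof -
  have "explicit_integral s s T x y i = mv_unit T x y i"
    if "T \<in> forests0 \<gamma> \<alpha> \<beta>" for T x y and i :: "nat \<Rightarrow> 'd"
    using that
  proof (cases rule: forests0_cases)
    case 1
    then show ?thesis by (simp add: explicit_empty mv_unit_def)
  next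
    case 2
    note L = lions_forestE(1)[OF 2(1)] and D = lions_forestD(1,2)[OF 2(1)]
    have "T \<noteq> empty_forest" using L by (auto simp: empty_forest_def)
    then show ?thesis
      using cut_integral_same[OF D] L by (simp add: explicit_eq_cut_integral[OF 2(1)] mv_unit_def)
  qed
  then have "family_eq \<gamma> \<alpha> \<beta> M (explicit_integral s s) mv_unit" by (simp add: family_eq_def)
  then show ?thesis by (rule family_eq_trans[OF J_family_eq[OF s s]])
qed

text \<open>
  The tensor norm is estimated by the sum of the absolute values of all coordinates, whence the
  cardinality.
\<close>

definition size_factor :: "forest \<Rightarrow> real" where
  "size_factor T = real (card (multi_index T :: (nat \<Rightarrow> 'd) set)) * fact (card (nodes T))"

text \<open>
  A node contributes the norm of the path it carries, so a hyperedge \<open>h\<close> contributes the power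
  \<open>card h\<close> of the norm of its variable. This is why the exponent \<open>q' / card h\<close> matches a moment of
  order \<open>q'\<close>.
\<close>

lemma tensor_norm_J_le:
  assumes T: "T \<in> forests \<gamma> \<alpha> \<beta>" and st: "s \<in> {0..1}" "t \<in> {0..1}" and x: "x \<in> space M"
    and y: "y \<in> hyper T \<rightarrow>\<^sub>E space M"
  shows "tensor_norm (nodes T) (J s t T x y) \<le>
    size_factor T * \<bar>t - s\<bar> ^ card (nodes T) * norm x ^ card (tagged T) * (\<Prod>h\<in>hyper T. norm (y h) ^ card h)"
proof -
  have L: "lions_forest T" and T0: "T \<in> forests0 \<gamma> \<alpha> \<beta>" using T by (auto simp: forests_def forests0_def)
  have "tensor_norm (nodes T) (J s t T x y) \<le> (\<Sum>i\<in>multi_index T. \<bar>J s t T x y i\<bar>)"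
    unfolding tensor_norm_def by (rule L2_set_le_sum_abs)
  also have "\<dots> \<le> (\<Sum>i\<in>(multi_index T :: (nat \<Rightarrow> 'd) set). fact (card (nodes T)) * \<bar>t - s\<bar> ^ card (nodes T) *
    (norm x ^ card (tagged T) * (\<Prod>h\<in>hyper T. norm (y h) ^ card h)))"
    using explicit_bound[OF L st] J_explicit[OF T0 st x y] by (intro sum_mono) simp
  finally show ?thesis by (simp add: size_factor_def mult_ac)
qed

lemma measurable_J:
  assumes T: "T \<in> forests0 \<gamma> \<alpha> \<beta>" and st: "s \<in> {0..1}" "t \<in> {0..1}" and i: "i \<in> multi_index T"
  shows "(\<lambda>(x, y). J s t T x y i) \<in> borel_measurable (M \<Otimes>\<^sub>M hyper_measure M T)"
proof -
  have "(\<lambda>(x, y). explicit_integral s t T x y i) \<in> borel_measurable (M \<Otimes>\<^sub>M hyper_measure M T)"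
    using T
  proof (cases rule: forests0_cases)
    case 1
    then show ?thesis by (simp add: explicit_empty)
  next
    case 2
    then show ?thesis by (intro measurable_explicit borel_law st)
  qed
  moreover have "(\<lambda>(x, y). J s t T x y i) p = (\<lambda>(x, y). explicit_integral s t T x y i) p"
    if "p \<in> space (M \<Otimes>\<^sub>M hyper_measure M T)" for p
    using that J_explicit[OF T st _ _ i] by (auto simp: space_pair_measure space_hyper_measure)
  ultimately show ?thesis by (simp cong: measurable_cong)
qed

lemma measurable_tensor_norm_J:
  assumes T: "T \<in> forests0 \<gamma> \<alpha> \<beta>" and st: "s \<in> {0..1}" "t \<in> {0..1}" and x: "x \<in> space M"
  shows "(\<lambda>y. tensor_norm (nodes T) (J s t T x y)) \<in> borel_measurable (hyper_measure M T)"
proof -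
  have "(\<lambda>y. J s t T x y i) \<in> borel_measurable (hyper_measure M T)" if "i \<in> multi_index T" for i
    using measurable_compose[OF measurable_Pair1'[OF x] measurable_J[OF T st that]] by simp
  then have "(\<lambda>y. \<Sum>i\<in>multi_index T. (J s t T x y i)\<^sup>2) \<in> borel_measurable (hyper_measure M T)"
    by (intro borel_measurable_sum borel_measurable_power)
  then show ?thesis unfolding tensor_norm_def L2_set_def by measurable
qed

lemma measurable_norm_law: "(\<lambda>x. norm x) \<in> borel_measurable M"
  by (rule measurable_compose[OF borel_law borel_measurable_continuous_onI[OF continuous_on_norm_id]])

lemma forests_facts:
  assumes T: "T \<in> forests \<gamma> \<alpha> \<beta>"
  shows "lions_forest T" "T \<in> forests0 \<gamma> \<alpha> \<beta>" "finite (nodes T)" "finite (hyper T)" "card (nodes T) > 0" "q' > 0"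
    "h \<in> hyper T \<Longrightarrow> card h > 0 \<and> real (card h) < q'"
proof -
  show L: "lions_forest T" and "T \<in> forests0 \<gamma> \<alpha> \<beta>" using T by (auto simp: forests_def forests0_def)
  note D = lions_forestD[OF L]
  show fin: "finite (nodes T)" by (rule D(2))
  have sub: "h \<subseteq> nodes T" if "h \<in> hyper T" for h using D(6)[OF that] by blast
  then show "finite (hyper T)" using fin by (auto intro: finite_subset[of _ "Pow (nodes T)"])
  show "card (nodes T) > 0" using lions_forestE(1)[OF L] fin by (simp add: card_gt_0_iff)
  show "q' > 0" using card_less[OF T] by linarith
  show "card h > 0 \<and> real (card h) < q'" if h: "h \<in> hyper T"
  proof
    show "card h > 0" using hyper_nonempty[OF L h] sub[OF h] fin finite_subset by (auto simp: card_gt_0_iff)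
    have "card h \<le> card (nodes T)" by (rule card_mono[OF fin sub[OF h]])
    then show "real (card h) < q'" using card_less[OF T] by linarith
  qed
qed

lemma in_mixed_space_J:
  assumes T: "T \<in> forests \<gamma> \<alpha> \<beta>" and st: "s \<in> {0..1}" "t \<in> {0..1}" and x: "x \<in> space M"
  shows "in_mixed_space M (q T) (hyper T) (\<lambda>y. ennreal (tensor_norm (nodes T) (J s t T x y)))"
  unfolding in_mixed_space_def
proof (intro conjI allI impI)
  note F = forests_facts[OF T]
  show "(\<lambda>y. ennreal (tensor_norm (nodes T) (J s t T x y))) \<in> borel_measurable (hyper_measure M T)"
    using measurable_tensor_norm_J[OF F(2) st x] by measurable
  fix hs assume hs: "distinct hs \<and> set hs = hyper T"
  define C where "C = size_factor T * \<bar>t - s\<bar> ^ card (nodes T) * norm x ^ card (tagged T)"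
  define K where "K = enn2real (\<integral>\<^sup>+x. ennreal (norm x powr q') \<partial>M)"
  have "mixed_norm M (q T) hs (\<lambda>y. ennreal (tensor_norm (nodes T) (J s t T x y))) (\<lambda>_. undefined) \<le>
    ennreal (C * (\<Prod>h\<in>hyper T - set hs. norm (undefined :: 'd c1_path) ^ card h) * (\<Prod>h\<in>set hs. K powr (1 / q T h)))"
  proof (rule mixed_norm_product_bound[where g = "\<lambda>h w. norm w ^ card h" and K = "\<lambda>_. K" and H = "hyper T"])
    show "0 \<le> C" by (simp add: C_def size_factor_def)
    show "q T h > 0" if "h \<in> hyper T" for h
      using F(6) F(7)[OF that] exponent[OF T that] by simp
    show "(\<integral>\<^sup>+w. ennreal ((norm w ^ card h) powr q T h) \<partial>M) = ennreal K" if "h \<in> hyper T" for h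
      using F(7)[OF that] exponent[OF T that] moment by (simp add: power_powr_divide K_def less_top)
    show "ennreal (tensor_norm (nodes T) (J s t T x \<omega>)) \<le> ennreal (C * (\<Prod>h\<in>hyper T. norm (\<omega> h) ^ card h))"
      if "\<omega> \<in> hyper T \<rightarrow>\<^sub>E space M" for \<omega>
      unfolding C_def by (rule ennreal_leI[OF tensor_norm_J_le[OF T st x that]])
  qed (use F hs measurable_norm_law in \<open>auto simp: K_def\<close>)
  then show "mixed_norm M (q T) hs (\<lambda>y. ennreal (tensor_norm (nodes T) (J s t T x y))) (\<lambda>_. undefined) < \<infinity>"
    by (rule le_less_trans) simp
qed

lemma J_in_mv_characters:
  assumes st: "s \<in> {0..1}" "t \<in> {0..1}"
  shows "J s t \<in> mv_characters \<gamma> \<alpha> \<beta> q M"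
  unfolding mv_characters_def mem_Collect_eq
proof (intro conjI ballI allI impI)
  show empty: "J s t empty_forest x y i = 1"
    if "x \<in> space M" "y \<in> space (hyper_measure M empty_forest)" "i \<in> multi_index empty_forest" for x y and i :: "nat \<Rightarrow> 'd"
    using that iterated_integralsD(1)[OF J st] by (simp add: space_hyper_measure)
  fix T assume T: "T \<in> forests0 \<gamma> \<alpha> \<beta>"
  show "(\<lambda>(x, y). J s t T x y i) \<in> borel_measurable (M \<Otimes>\<^sub>M hyper_measure M T)" if "i \<in> multi_index T" for i :: "nat \<Rightarrow> 'd"
    by (rule measurable_J[OF T st that])
  show "AE x in M. in_mixed_space M (q T) (hyper T) (\<lambda>y. ennreal (tensor_norm (nodes T) (J s t T x y)))"
  proof (rule AE_I2)
    fix x assume x: "x \<in> space M"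
    show "in_mixed_space M (q T) (hyper T) (\<lambda>y. ennreal (tensor_norm (nodes T) (J s t T x y)))"
      using T
    proof (cases rule: forests0_cases)
      case 1
      then have "hyper T = {}" by (simp add: empty_forest_def)
      then show ?thesis
        using measurable_tensor_norm_J[OF T st x] by (auto simp: in_mixed_space_def)
    next
      case 2
      show ?thesis by (rule in_mixed_space_J[OF 2(2) st x])
    qed
  qed
next
  fix T and \<pi> :: "nat \<Rightarrow> nat" assume "T \<in> forests \<gamma> \<alpha> \<beta>" and inj: "inj_on \<pi> (nodes T)"
  then have L: "lions_forest T" by (simp add: forests_def)
  show "AE (x, y) in M \<Otimes>\<^sub>M hyper_measure M (relabel \<pi> T). \<forall>i\<in>multi_index (relabel \<pi> T).
    J s t (relabel \<pi> T) x y i = J s t T x (\<lambda>h\<in>hyper T. y (\<pi> ` h)) (\<lambda>n\<in>nodes T. i (\<pi> n))"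
  proof (rule AE_I2, clarify)
    fix x y and i :: "nat \<Rightarrow> 'd"
    assume "(x, y) \<in> space (M \<Otimes>\<^sub>M hyper_measure M (relabel \<pi> T))" and i: "i \<in> multi_index (relabel \<pi> T)"
    then have "x \<in> space M" "y \<in> hyper (relabel \<pi> T) \<rightarrow>\<^sub>E space M"
      by (auto simp: space_pair_measure space_hyper_measure)
    from iterated_integralsD(3)[OF J st this(1) L inj this(2) i]
    show "J s t (relabel \<pi> T) x y i = J s t T x (\<lambda>h\<in>hyper T. y (\<pi> ` h)) (\<lambda>n\<in>nodes T. i (\<pi> n))" .
  qed
next
  fix T1 T2
  assume *: "lions_forest T1 \<and> lions_forest T2 \<and> nodes T1 \<inter> nodes T2 = {} \<and> join T1 T2 \<in> forests \<gamma> \<alpha> \<beta>"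
  show "AE (x, y) in M \<Otimes>\<^sub>M hyper_measure M (join T1 T2). \<forall>i\<in>multi_index (join T1 T2).
    J s t (join T1 T2) x y i = J s t T1 x (restrict y (hyper T1)) (restrict i (nodes T1)) *
      J s t T2 x (restrict y (hyper T2)) (restrict i (nodes T2))"
  proof (rule AE_I2, clarify)
    fix x y and i :: "nat \<Rightarrow> 'd"
    assume "(x, y) \<in> space (M \<Otimes>\<^sub>M hyper_measure M (join T1 T2))" and i: "i \<in> multi_index (join T1 T2)"
    then have xy: "x \<in> space M" "y \<in> hyper (join T1 T2) \<rightarrow>\<^sub>E space M"
      by (auto simp: space_pair_measure space_hyper_measure)
    show "J s t (join T1 T2) x y i = J s t T1 x (restrict y (hyper T1)) (restrict i (nodes T1)) *
      J s t T2 x (restrict y (hyper T2)) (restrict i (nodes T2))"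
      by (rule iterated_integralsD(4)[OF J st xy(1) _ _ _ xy(2) i]) (use * in blast)+
  qed
next
  fix T
  assume *: "tagged T \<noteq> {} \<and> T \<in> forests \<gamma> \<alpha> \<beta> \<and> decouple T \<in> forests \<gamma> \<alpha> \<beta>"
  then have L: "lions_forest T" by (simp add: forests_def)
  show "AE (x, y) in M \<Otimes>\<^sub>M hyper_measure M (decouple T). \<forall>i\<in>multi_index T.
    J s t T (y (tagged T)) (restrict y (hyper T)) i = J s t (decouple T) x y i"
  proof (rule AE_I2, clarify)
    fix x y and i :: "nat \<Rightarrow> 'd"
    assume "(x, y) \<in> space (M \<Otimes>\<^sub>M hyper_measure M (decouple T))" and i: "i \<in> multi_index T"
    then have xy: "x \<in> space M" "y \<in> hyper (decouple T) \<rightarrow>\<^sub>E space M"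
      by (auto simp: space_pair_measure space_hyper_measure)
    have "i \<in> multi_index (decouple T)" using i by (simp add: decouple_def)
    from iterated_integralsD(5)[OF J st xy(1) L _ xy(2) this] *
    show "J s t T (y (tagged T)) (restrict y (hyper T)) i = J s t (decouple T) x y i" by simp
  qed
next
  fix T
  assume T: "T \<in> forests \<gamma> \<alpha> \<beta>" and tag: "tagged T = {}"
  note F = forests_facts(2)[OF T]
  show "AE ((x, x'), y) in (M \<Otimes>\<^sub>M M) \<Otimes>\<^sub>M hyper_measure M T. \<forall>i\<in>multi_index T. J s t T x y i = J s t T x' y i"
  proof (rule AE_I2, clarify)
    fix x x' y and i :: "nat \<Rightarrow> 'd"
    assume "((x, x'), y) \<in> space ((M \<Otimes>\<^sub>M M) \<Otimes>\<^sub>M hyper_measure M T)" and i: "i \<in> multi_index T"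
    then have xy: "x \<in> space M" "x' \<in> space M" "y \<in> hyper T \<rightarrow>\<^sub>E space M"
      by (auto simp: space_pair_measure space_hyper_measure)
    have "path_at T x y = path_at T x' y" using tag by (simp add: path_at_def fun_eq_iff)
    then show "J s t T x y i = J s t T x' y i"
      using J_explicit[OF F st xy(1,3) i] J_explicit[OF F st xy(2,3) i] by (simp add: explicit_integral_def)
  qed
qed

text \<open>
  By Chen's relation \<open>J s 0\<close> is a two-sided inverse of \<open>J 0 s\<close>. The inverse picked in the
  definition of the increments is an unspecified one, but by uniqueness it agrees with \<open>J s 0\<close>
  pointwise.
\<close>

lemma mv_increment_J:
  assumes st: "s \<in> {0..1}" "t \<in> {0..1}"
  shows "family_eq \<gamma> \<alpha> \<beta> M (mv_increment \<gamma> \<alpha> \<beta> q M (\<lambda>t. J 0 t) s t) (J s t)"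
proof -
  have z: "0 \<in> {0..1::real}" by simp
  let ?P = "\<lambda>g. g \<in> mv_characters \<gamma> \<alpha> \<beta> q M \<and> family_eq \<gamma> \<alpha> \<beta> M (mv_conv (J 0 s) g) mv_unit \<and>
    family_eq \<gamma> \<alpha> \<beta> M (mv_conv g (J 0 s)) mv_unit"
  have inv: "family_eq \<gamma> \<alpha> \<beta> M (mv_conv (J s 0) (J 0 s)) mv_unit"
    using family_eq_trans[OF J_chen[OF st(1) z st(1)] J_unit[OF st(1)]] .
  have "?P (J s 0)"
    using J_in_mv_characters[OF st(1) z] family_eq_trans[OF J_chen[OF z st(1) z] J_unit[OF z]] inv by blast
  then have "?P (mv_inverse \<gamma> \<alpha> \<beta> q M (J 0 s))" unfolding mv_inverse_def by (rule someI[of ?P])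
  then have left: "family_eq \<gamma> \<alpha> \<beta> M (mv_conv (mv_inverse \<gamma> \<alpha> \<beta> q M (J 0 s)) (J 0 s)) (mv_conv (J s 0) (J 0 s))"
    by (elim conjE) (rule family_eq_trans[OF _ family_eq_sym[OF inv]])
  have "J 0 s empty_forest x y i = 1"
    if "x \<in> space M" "y \<in> space (hyper_measure M empty_forest)" "i \<in> multi_index empty_forest" for x y i
    using iterated_integralsD(1)[OF J z st(1) that(1) _ that(3)] that(2) unfolding space_hyper_measure .
  note inverse = left_inverse_unique[OF alpha_pos beta_pos this left]
  have "family_eq \<gamma> \<alpha> \<beta> M (mv_increment \<gamma> \<alpha> \<beta> q M (\<lambda>t. J 0 t) s t) (mv_conv (J s 0) (J 0 t))"
    unfolding mv_increment_def
    by (rule mv_conv_cong[OF alpha_pos beta_pos inverse family_eq_refl])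
  then show ?thesis by (rule family_eq_trans[OF _ J_chen[OF st(1) z st(2)]])
qed

lemma moment_power:
  assumes "real k < q'"
  shows "(\<integral>\<^sup>+w. ennreal (norm w ^ k) \<partial>M) < \<infinity>"
proof -
  have "norm w ^ k \<le> 1 + norm w powr q'" for w :: "'d c1_path"
  proof (cases "norm w \<le> 1")
    case True
    then have "norm w ^ k \<le> 1" by (intro power_le_one) auto
    then show ?thesis using powr_ge_zero[of "norm w" q'] by linarith
  next
    case False
    then have "norm w ^ k = norm w powr real k" by (intro powr_realpow[symmetric]) linarith
    also have "\<dots> \<le> norm w powr q'" using False assms by (intro powr_mono) auto
    finally show ?thesis by simp
  qed
  then have "(\<integral>\<^sup>+w. ennreal (norm w ^ k) \<partial>M) \<le> (\<integral>\<^sup>+w. 1 + ennreal (norm w powr q') \<partial>M)"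
    by (intro nn_integral_mono) (simp flip: ennreal_1 ennreal_plus)
  also have "\<dots> = emeasure M (space M) + (\<integral>\<^sup>+w. ennreal (norm w powr q') \<partial>M)"
    using measurable_norm_law by (subst nn_integral_add) auto
  also have "\<dots> < \<infinity>"
    using moment finite_measure.emeasure_finite[OF finite_law] by (simp add: less_top)
  finally show ?thesis .
qed

lemma integral_J_le:
  assumes T: "T \<in> forests \<gamma> \<alpha> \<beta>" and x: "x \<in> space M"
  obtains B where "B \<ge> 0" "\<And>s t. s \<in> {0..1} \<Longrightarrow> t \<in> {0..1} \<Longrightarrow>
    (\<integral>\<^sup>+y. ennreal (tensor_norm (nodes T) (J s t T x y)) \<partial>hyper_measure M T) \<le>
      ennreal (B * \<bar>t - s\<bar> ^ card (nodes T))"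
proof -
  note F = forests_facts[OF T]
  interpret product_sigma_finite "\<lambda>_ :: nat set. M"
    by (intro product_sigma_finite.intro finite_measure.sigma_finite_measure finite_law)
  define L where "L h = enn2real (\<integral>\<^sup>+w. ennreal (norm w ^ card h) \<partial>M)" for h :: "nat set"
  have L: "(\<integral>\<^sup>+w. ennreal (norm w ^ card h) \<partial>M) = ennreal (L h)" if "h \<in> hyper T" for h
    using moment_power F(7)[OF that] by (simp add: L_def less_top)
  define A where "A = size_factor T * norm x ^ card (tagged T)"
  have A: "A \<ge> 0" by (simp add: A_def size_factor_def)
  have prod_meas: "(\<lambda>y. \<Prod>h\<in>hyper T. ennreal (norm (y h) ^ card h)) \<in> borel_measurable (hyper_measure M T)"
  proof (intro borel_measurable_prod_ennreal)
    fix h assume "h \<in> hyper T"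
    then have "(\<lambda>y. y h) \<in> measurable (hyper_measure M T) M" by (rule measurable_component_singleton)
    then have "(\<lambda>y. norm (y h)) \<in> borel_measurable (hyper_measure M T)"
      by (rule measurable_compose[OF _ measurable_norm_law])
    then show "(\<lambda>y. ennreal (norm (y h) ^ card h)) \<in> borel_measurable (hyper_measure M T)" by measurable
  qed
  show thesis
  proof (rule that)
    show "A * (\<Prod>h\<in>hyper T. L h) \<ge> 0"
      using A by (intro mult_nonneg_nonneg prod_nonneg) (auto simp: L_def)
    fix s t :: real assume st: "s \<in> {0..1}" "t \<in> {0..1}"
    let ?c = "A * \<bar>t - s\<bar> ^ card (nodes T)"
    have "(\<integral>\<^sup>+y. ennreal (tensor_norm (nodes T) (J s t T x y)) \<partial>hyper_measure M T) \<le>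
      (\<integral>\<^sup>+y. ennreal ?c * (\<Prod>h\<in>hyper T. ennreal (norm (y h) ^ card h)) \<partial>hyper_measure M T)"
    proof (rule nn_integral_mono)
      fix y assume "y \<in> space (hyper_measure M T)"
      then have "y \<in> hyper T \<rightarrow>\<^sub>E space M" by (simp add: space_hyper_measure)
      from tensor_norm_J_le[OF T st x this]
      have "tensor_norm (nodes T) (J s t T x y) \<le> ?c * (\<Prod>h\<in>hyper T. norm (y h) ^ card h)"
        by (simp add: A_def mult_ac)
      then show "ennreal (tensor_norm (nodes T) (J s t T x y)) \<le>
        ennreal ?c * (\<Prod>h\<in>hyper T. ennreal (norm (y h) ^ card h))"
        using A by (simp add: prod_ennreal ennreal_mult[symmetric] prod_nonneg ennreal_leI)
    qed
    also have "\<dots> = ennreal ?c * (\<Prod>h\<in>hyper T. (\<integral>\<^sup>+w. ennreal (norm w ^ card h) \<partial>M))"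
      using prod_meas measurable_norm_law
      by (subst nn_integral_cmult[OF prod_meas], subst product_nn_integral_prod[OF F(4)]) auto
    also have "\<dots> = ennreal ?c * (\<Prod>h\<in>hyper T. ennreal (L h))"
      using L by (simp cong: prod.cong)
    also have "\<dots> = ennreal (A * (\<Prod>h\<in>hyper T. L h) * \<bar>t - s\<bar> ^ card (nodes T))"
      using A by (simp add: prod_ennreal L_def prod_nonneg mult_ac flip: ennreal_mult)
    finally show "(\<integral>\<^sup>+y. ennreal (tensor_norm (nodes T) (J s t T x y)) \<partial>hyper_measure M T) \<le>
      ennreal (A * (\<Prod>h\<in>hyper T. L h) * \<bar>t - s\<bar> ^ card (nodes T))" .
  qed
qed

lemma J_rough_path: "mv_rough_path \<gamma> \<alpha> \<beta> q M (\<lambda>t. J 0 t)"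
  unfolding mv_rough_path_def
proof (intro conjI ballI)
  let ?W = "mv_increment \<gamma> \<alpha> \<beta> q M (\<lambda>t. J 0 t)"
  show "J 0 t \<in> mv_characters \<gamma> \<alpha> \<beta> q M" if "t \<in> {0..1}" for t
    by (rule J_in_mv_characters) (use that in auto)
  show "family_ae_eq \<gamma> \<alpha> \<beta> M (mv_conv (?W s t) (?W t u)) (?W s u)"
    if stu: "s \<in> {0..1}" "t \<in> {0..1}" "u \<in> {0..1}" for s t u
  proof (rule family_eq_ae)
    have "family_eq \<gamma> \<alpha> \<beta> M (mv_conv (?W s t) (?W t u)) (mv_conv (J s t) (J t u))"
      by (intro mv_conv_cong alpha_pos beta_pos mv_increment_J stu)
    then show "family_eq \<gamma> \<alpha> \<beta> M (mv_conv (?W s t) (?W t u)) (?W s u)"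
      by (rule family_eq_trans[OF _ family_eq_trans[OF J_chen[OF stu] family_eq_sym[OF mv_increment_J[OF stu(1,3)]]]])
  qed
  fix T assume T: "T \<in> forests \<gamma> \<alpha> \<beta>"
  note F = forests_facts[OF T]
  show "AE x in M. (SUP s\<in>{0..1}. SUP t\<in>{0..1}.
    (\<integral>\<^sup>+y. ennreal (tensor_norm (nodes T) (?W s t T x y)) \<partial>hyper_measure M T) /
      ennreal (\<bar>t - s\<bar> powr grade \<alpha> \<beta> T)) < \<infinity>"
  proof (rule AE_I2)
    fix x assume x: "x \<in> space M"
    obtain B where B: "B \<ge> 0" "\<And>s t. s \<in> {0..1} \<Longrightarrow> t \<in> {0..1} \<Longrightarrow>
      (\<integral>\<^sup>+y. ennreal (tensor_norm (nodes T) (J s t T x y)) \<partial>hyper_measure M T) \<le>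
        ennreal (B * \<bar>t - s\<bar> ^ card (nodes T))"
      using integral_J_le[OF T x] by blast
    have "(\<integral>\<^sup>+y. ennreal (tensor_norm (nodes T) (?W s t T x y)) \<partial>hyper_measure M T) /
      ennreal (\<bar>t - s\<bar> powr grade \<alpha> \<beta> T) \<le> ennreal B" if st: "s \<in> {0..1}" "t \<in> {0..1}" for s t
    proof -
      have "(\<integral>\<^sup>+y. ennreal (tensor_norm (nodes T) (?W s t T x y)) \<partial>hyper_measure M T) =
        (\<integral>\<^sup>+y. ennreal (tensor_norm (nodes T) (J s t T x y)) \<partial>hyper_measure M T)"
      proof (rule nn_integral_cong)
        fix y assume y: "y \<in> space (hyper_measure M T)"
        have "?W s t T x y i = J s t T x y i" if "i \<in> multi_index T" for i
          using mv_increment_J[OF st] F(2) x y that unfolding family_eq_def by blast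
        then show "ennreal (tensor_norm (nodes T) (?W s t T x y)) = ennreal (tensor_norm (nodes T) (J s t T x y))"
          unfolding tensor_norm_def by (simp cong: L2_set_cong)
      qed
      also have "\<dots> \<le> ennreal (B * \<bar>t - s\<bar> ^ card (nodes T))" by (rule B(2)[OF st])
      finally have le: "(\<integral>\<^sup>+y. ennreal (tensor_norm (nodes T) (?W s t T x y)) \<partial>hyper_measure M T) \<le>
        ennreal (B * \<bar>t - s\<bar> ^ card (nodes T))" .
      show ?thesis
      proof (cases "s = t")
        case True
        \<comment> \<open>The quotient is \<open>0 / 0 = 0\<close>, since \<open>T\<close> has at least one node.\<close>
        then show ?thesis using le F(5) by (simp add: zero_power)
      next
        case False
        let ?d = "\<bar>t - s\<bar> powr grade \<alpha> \<beta> T"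
        have "\<bar>t - s\<bar> ^ card (nodes T) = \<bar>t - s\<bar> powr real (card (nodes T))"
          using False by (intro powr_realpow[symmetric]) simp
        also have "\<dots> \<le> ?d"
          using grade_le[OF T] st by (intro powr_mono') auto
        finally have "B * \<bar>t - s\<bar> ^ card (nodes T) \<le> B * ?d" by (rule mult_left_mono[OF _ B(1)])
        then have "(\<integral>\<^sup>+y. ennreal (tensor_norm (nodes T) (?W s t T x y)) \<partial>hyper_measure M T) \<le> ennreal (B * ?d)"
          using le by (meson ennreal_leI order_trans)
        then have "(\<integral>\<^sup>+y. ennreal (tensor_norm (nodes T) (?W s t T x y)) \<partial>hyper_measure M T) / ennreal ?d \<le>
          ennreal (B * ?d) / ennreal ?d"
          by (rule divide_right_mono_ennreal)
        also have "\<dots> = ennreal B" using False B(1) by (subst divide_ennreal) auto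
        finally show ?thesis .
      qed
    qed
    then have "(SUP s\<in>{0..1}. SUP t\<in>{0..1}.
      (\<integral>\<^sup>+y. ennreal (tensor_norm (nodes T) (?W s t T x y)) \<partial>hyper_measure M T) /
        ennreal (\<bar>t - s\<bar> powr grade \<alpha> \<beta> T)) \<le> ennreal B"
      by (intro SUP_least)
    then show "(SUP s\<in>{0..1}. SUP t\<in>{0..1}.
      (\<integral>\<^sup>+y. ennreal (tensor_norm (nodes T) (?W s t T x y)) \<partial>hyper_measure M T) /
        ennreal (\<bar>t - s\<bar> powr grade \<alpha> \<beta> T)) < \<infinity>"
      by (rule le_less_trans) simp
  qed
qed

end

lemma closed_measure_support: "closed (measure_support \<mu>)"
proof -
  have "- measure_support \<mu> = \<Union> {U. open U \<and> emeasure \<mu> U = 0}"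
    by (auto simp: measure_support_def)
  then show ?thesis by (auto simp: closed_def)
qed

theorem proposition3p9:
  fixes \<alpha> \<beta> \<gamma> q' :: real
    and p q :: "forest \<Rightarrow> nat set \<Rightarrow> real"
    and \<mu> :: "'d::finite c1_path measure"
    and J :: "real \<Rightarrow> real \<Rightarrow> ('d c1_path, 'd) family"
  defines "\<Omega> \<equiv> measure_support \<mu>"
  defines "M \<equiv> restrict_space \<mu> \<Omega>"
  assumes "\<alpha> > 0" and "\<beta> > 0"
    and "\<gamma> = Inf {grade \<alpha> \<beta> T |T. lions_forest T \<and> grade \<alpha> \<beta> T > 1 - \<alpha>}"
    and "q' \<ge> real_of_int \<lfloor>\<gamma> / min \<alpha> \<beta>\<rfloor>" and "\<lfloor>\<gamma> / min \<alpha> \<beta>\<rfloor> > 1"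
    and "\<And>T. T \<in> forests \<gamma> \<alpha> \<beta> \<Longrightarrow> q' / real (card (nodes T)) > 1"
    and "dual_integrability_functional \<gamma> \<alpha> \<beta> p q"
    and "\<And>T h. T \<in> forests \<gamma> \<alpha> \<beta> \<Longrightarrow> h \<in> hyper T \<Longrightarrow> q T h = q' / real (card h)"
    and "prob_space \<mu>" and "sets \<mu> = sets borel"
    and "integrable \<mu> (\<lambda>x. norm x powr q')"
    and "iterated_integrals \<Omega> J"
  shows "(\<forall>s\<in>{0..1}. \<forall>t\<in>{0..1}. J s t \<in> mv_characters \<gamma> \<alpha> \<beta> q M) \<and>
    (\<forall>s\<in>{0..1}. \<forall>t\<in>{0..1}. \<forall>u\<in>{0..1}. \<forall>x\<in>\<Omega>. \<forall>T\<in>forests0 \<gamma> \<alpha> \<beta>.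
       \<forall>y\<in>hyper T \<rightarrow>\<^sub>E \<Omega>. \<forall>i\<in>multi_index T.
       mv_conv (J s t) (J t u) T x y i = J s u T x y i) \<and>
    mv_rough_path \<gamma> \<alpha> \<beta> q M (\<lambda>t. J 0 t)"
proof -
  have space: "space M = \<Omega>"
    using sets_eq_imp_space_eq[OF assms(12)] by (simp add: M_def space_restrict_space)
  have \<Omega>: "\<Omega> \<in> sets \<mu>"
    using closed_measure_support[of \<mu>] assms(12) by (simp add: \<Omega>_def)
  interpret lifted_law M J q' \<gamma> \<alpha> \<beta> q
  proof (rule lifted_law.intro)
    have "finite_measure \<mu>" by (rule prob_space.finite_measure[OF assms(11)])
    then show "finite_measure M" unfolding M_def by (rule finite_measure_restrict_space[OF _ \<Omega>])
    have "(\<lambda>x. x) \<in> borel_measurable \<mu>" by (rule measurable_ident_sets[OF assms(12)])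
    then show "(\<lambda>x. x) \<in> borel_measurable M" unfolding M_def by (rule measurable_restrict_space1)
    have "(\<integral>\<^sup>+x. ennreal (norm x powr q') \<partial>M) = (\<integral>\<^sup>+x. ennreal (norm x powr q') * indicator \<Omega> x \<partial>\<mu>)"
      unfolding M_def using \<Omega> sets.Int_space_eq2[OF \<Omega>] by (intro nn_integral_restrict_space) simp
    also have "\<dots> \<le> (\<integral>\<^sup>+x. ennreal (norm (norm x powr q')) \<partial>\<mu>)"
      by (intro nn_integral_mono) (auto simp: indicator_def)
    also have "\<dots> < \<infinity>" using assms(13) unfolding integrable_iff_bounded by blast
    finally show "(\<integral>\<^sup>+x. ennreal (norm x powr q') \<partial>M) < \<infinity>" .
    show "iterated_integrals (space M) J" unfolding space by (rule assms(14))
    show "real (card (nodes T)) < q'" if "T \<in> forests \<gamma> \<alpha> \<beta>" for T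
      using assms(8)[OF that] by (cases "card (nodes T) = 0") (auto simp: less_divide_eq)
    show "grade \<alpha> \<beta> T \<le> real (card (nodes T))" if "T \<in> forests \<gamma> \<alpha> \<beta>" for T
      by (rule grade_le_card_nodes[OF assms(3,4,5,7) that])
  qed (fact assms)+
  have "mv_conv (J s t) (J t u) T x y i = J s u T x y i"
    if "s \<in> {0..1}" "t \<in> {0..1}" "u \<in> {0..1}" "x \<in> \<Omega>" "T \<in> forests0 \<gamma> \<alpha> \<beta>"
      "y \<in> hyper T \<rightarrow>\<^sub>E \<Omega>" "i \<in> multi_index T" for s t u x T y i
    using J_chen[OF that(1-3)] that unfolding family_eq_def space_hyper_measure space by blast
  then show ?thesis using J_in_mv_characters J_rough_path by blast
qed

end
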